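(* Let $k\ge 3$ be an integer and let $S$ be the star graph with $k$ arms: the infinite graph with one central vertex of degree $k$ and $k$ infinite arms (half-lines) emanating from it, on which each vertex has degree $2$. Then the critical ratio for the ground state quantum Ising model with transverse field on $S$, with spin-coupling intensity $\lambda>0$ and external-field intensity $\delta>0$, is $\lambda/\delta=2$. That is, the ground state on $S$ exhibits long range order whenever $\lambda/\delta>2$, and does not exhibit long range order whenever $\lambda/\delta<2$.
   Context: Quantum Ising model. For a finite graph $G=(V,E)$ and $\lambda,\delta>0$, the Hamiltonian of the quantum Ising model with transverse field is the operator $$H=-\frac12\lambda\sum_{e=xy\in E}\sigma_x^{(3)}\sigma_y^{(3)}-\delta\sum_{x\in V}\sigma_x^{(1)}$$ on the Hilbert space $\mathcal H=\bigotimes_{x\in V}\mathbb C^2$. Here $\sigma_x^{(3)}$ and $\sigma_x^{(1)}$ are the operators acting on the factor of $\mathcal H$ indexed by $x$ as the Pauli matrices $\sigma^{(3)}=\begin{pmatrix}1&0\\0&-1\end{pmatrix}$ and $\sigma^{(1)}=\begin{pmatrix}0&1\\1&0\end{pmatrix}$, respectively, and as the identity on the other factors. States. For inverse temperature $\beta\ge 0$ and an operator $Q$ on $\mathcal H$, set $\rho_{G,\beta}(Q)=\frac{1}{Z_G(\beta)}\mathrm{tr}(e^{-\beta H}Q)$, where $Z_G(\beta)=\mathrm{tr}(e^{-\beta H})$. The ground state on $G$ is the limit $\rho_G=\lim_{\beta\to\infty}\rho_{G,\beta}$. For an infinite graph $S$ and an increasing sequence $G_n$ of finite graphs tending to $S$,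 the ground state on $S$ is $\rho_S=\lim_{n\to\infty}\rho_{G_n}$ (the existence of these limits is known). Long range order. The ground state on $S$ exhibits long range order if for every vertex $x$ the correlation function $G(x,y)=\rho_S(\sigma_x^{(3)}\sigma_y^{(3)})$ is bounded below by a positive function of $x$; that is, for every $x$ there is $c(x)>0$ with $G(x,y)\ge c(x)$ for all vertices $y$. The critical ratio is the value of $\lambda/\delta$ above which the model exhibits long range order and below which it does not. *)

theory Defs
  imports "HOL-Analysis.Analysis"
begin

section \<open>Operators as matrices over a finite index set\<close>

text \<open>
  The dimension of the Hilbert space varies with the graph, so an operator is a function
  giving its matrix entries in a basis indexed by a finite set \<open>C\<close>; only the entries indexed
  by \<open>C \<times> C\<close> are meaningful.
\<close>

type_synonym 'c operator = "'c \<Rightarrow> 'c \<Rightarrow> complex"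

definition op_mult :: "'c set \<Rightarrow> 'c operator \<Rightarrow> 'c operator \<Rightarrow> 'c operator" where
  "op_mult C A B = (\<lambda>s t. \<Sum>u\<in>C. A s u * B u t)"

primrec op_power :: "'c set \<Rightarrow> 'c operator \<Rightarrow> nat \<Rightarrow> 'c operator" where
  "op_power C A 0 = (\<lambda>s t. if s = t then 1 else 0)"
| "op_power C A (Suc n) = op_mult C A (op_power C A n)"

definition op_exp :: "'c set \<Rightarrow> 'c operator \<Rightarrow> 'c operator" where
  "op_exp C A = (\<lambda>s t. \<Sum>n. op_power C A n s t / fact n)"

definition op_trace :: "'c set \<Rightarrow> 'c operator \<Rightarrow> complex" where
  "op_trace C A = (\<Sum>s\<in>C. A s s)"


section \<open>Spin operators\<close>

text \<open>
  The standard basis of the tensor product over \<open>x \<in> V\<close> of copies of \<open>\<complex>\<^sup>2\<close> is indexed by the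
  functions from \<open>V\<close> to the index type \<open>2\<close>, taken to be \<open>undefined\<close> off \<open>V\<close>.
\<close>

type_synonym 'v config = "'v \<Rightarrow> 2"

definition configs :: "'v set \<Rightarrow> 'v config set" where
  "configs V = (V \<rightarrow>\<^sub>E UNIV)"

definition tensor_op :: "'v set \<Rightarrow> ('v \<Rightarrow> complex^2^2) \<Rightarrow> 'v config operator" where
  "tensor_op V M = (\<lambda>s t. \<Prod>x\<in>V. M x $ s x $ t x)"

definition pauli1 :: "complex^2^2" where
  "pauli1 = vector [vector [0, 1], vector [1, 0]]"

definition pauli3 :: "complex^2^2" where
  "pauli3 = vector [vector [1, 0], vector [0, -1]]"

definition sigma1 :: "'v set \<Rightarrow> 'v \<Rightarrow> 'v config operator" where
  "sigma1 V x = tensor_op V (\<lambda>z. if z = x then pauli1 else mat 1)"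

definition sigma3 :: "'v set \<Rightarrow> 'v \<Rightarrow> 'v config operator" where
  "sigma3 V x = tensor_op V (\<lambda>z. if z = x then pauli3 else mat 1)"

text \<open>
  For an edge \<open>e = {x, y}\<close> this is the product of \<open>sigma3 V x\<close> and \<open>sigma3 V y\<close>, written without
  choosing an order of the endpoints; see \<open>bond_op_eq_mult\<close> below.
\<close>

definition bond_op :: "'v set \<Rightarrow> 'v set \<Rightarrow> 'v config operator" where
  "bond_op V e = tensor_op V (\<lambda>z. if z \<in> e then pauli3 else mat 1)"

lemma op_mult_tensor_op:
  assumes "finite V"
  shows "op_mult (configs V) (tensor_op V A) (tensor_op V B) = tensor_op V (\<lambda>z. A z ** B z)"
proof (intro ext)
  fix s t :: "'a config"
  have "op_mult (configs V) (tensor_op V A) (tensor_op V B) s t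
      = (\<Sum>u\<in>V \<rightarrow>\<^sub>E UNIV. \<Prod>z\<in>V. A z $ s z $ u z * B z $ u z $ t z)"
    by (simp add: op_mult_def tensor_op_def configs_def prod.distrib)
  also have "\<dots> = (\<Prod>z\<in>V. \<Sum>i\<in>UNIV. A z $ s z $ i * B z $ i $ t z)"
    using assms by (subst prod_sum_PiE) auto
  also have "\<dots> = tensor_op V (\<lambda>z. A z ** B z) s t"
    by (simp add: tensor_op_def matrix_matrix_mult_def)
  finally show "op_mult (configs V) (tensor_op V A) (tensor_op V B) s t
      = tensor_op V (\<lambda>z. A z ** B z) s t" .
qed

lemma bond_op_eq_mult:
  assumes "finite V" "x \<noteq> y"
  shows "bond_op V {x, y} = op_mult (configs V) (sigma3 V x) (sigma3 V y)"
  unfolding sigma3_def bond_op_def op_mult_tensor_op[OF assms(1)]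
  using assms(2) by (intro arg_cong[where f = "tensor_op V"]) auto


section \<open>Graphs\<close>

record 'v graph =
  verts :: "'v set"
  edges :: "'v set set"

definition finite_graph :: "'v graph \<Rightarrow> bool" where
  "finite_graph G \<longleftrightarrow> finite (verts G) \<and> (\<forall>e\<in>edges G. e \<subseteq> verts G \<and> card e = 2)"

definition exhaustion :: "'v graph \<Rightarrow> (nat \<Rightarrow> 'v graph) \<Rightarrow> bool" where
  "exhaustion S G \<longleftrightarrow>
     (\<forall>n. finite_graph (G n)) \<and>
     (\<forall>n. verts (G n) \<subseteq> verts (G (Suc n)) \<and> edges (G n) \<subseteq> edges (G (Suc n))) \<and>
     (\<Union>n. verts (G n)) = verts S \<and> (\<Union>n. edges (G n)) = edges S"

text \<open>\<open>Arm j m\<close> is the vertex at distance \<open>m + 1\<close> from the centre on the \<open>j\<close>-th arm.\<close>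

datatype star_vertex = Centre | Arm nat nat

definition star_graph :: "nat \<Rightarrow> star_vertex graph" where
  "star_graph k =
     \<lparr>verts = {Centre} \<union> {Arm j m | j m. j < k},
      edges = {{Centre, Arm j 0} | j. j < k} \<union> {{Arm j m, Arm j (Suc m)} | j m. j < k}\<rparr>"


section \<open>The quantum Ising model\<close>

definition hamiltonian :: "real \<Rightarrow> real \<Rightarrow> 'v graph \<Rightarrow> 'v config operator" where
  "hamiltonian lam \<delta> G = (\<lambda>s t.
     - (1 / 2) * complex_of_real lam * (\<Sum>e\<in>edges G. bond_op (verts G) e s t)
     - complex_of_real \<delta> * (\<Sum>x\<in>verts G. sigma1 (verts G) x s t))"

definition gibbs_operator :: "real \<Rightarrow> real \<Rightarrow> 'v graph \<Rightarrow> real \<Rightarrow> 'v config operator" where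
  "gibbs_operator lam \<delta> G \<beta> =
     op_exp (configs (verts G)) (\<lambda>s t. - complex_of_real \<beta> * hamiltonian lam \<delta> G s t)"

definition partition_function :: "real \<Rightarrow> real \<Rightarrow> 'v graph \<Rightarrow> real \<Rightarrow> complex" where
  "partition_function lam \<delta> G \<beta> = op_trace (configs (verts G)) (gibbs_operator lam \<delta> G \<beta>)"

definition gibbs_state :: "real \<Rightarrow> real \<Rightarrow> 'v graph \<Rightarrow> real \<Rightarrow> 'v config operator \<Rightarrow> complex" where
  "gibbs_state lam \<delta> G \<beta> Q =
     op_trace (configs (verts G)) (op_mult (configs (verts G)) (gibbs_operator lam \<delta> G \<beta>) Q)
       / partition_function lam \<delta> G \<beta>"

definition ground_state :: "real \<Rightarrow> real \<Rightarrow> 'v graph \<Rightarrow> 'v config operator \<Rightarrow> complex" where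
  "ground_state lam \<delta> G Q = Lim at_top (\<lambda>\<beta>. gibbs_state lam \<delta> G \<beta> Q)"

text \<open>
  An observable of the infinite system is given by the operators \<open>Q V\<close> representing it on the
  finite vertex sets \<open>V\<close>. The sequence \<open>G\<close> is meant to exhaust the infinite graph.
\<close>

definition ground_state_limit ::
    "real \<Rightarrow> real \<Rightarrow> (nat \<Rightarrow> 'v graph) \<Rightarrow> ('v set \<Rightarrow> 'v config operator) \<Rightarrow> complex" where
  "ground_state_limit lam \<delta> G Q = lim (\<lambda>n. ground_state lam \<delta> (G n) (Q (verts (G n))))"

text \<open>Taking the real part loses nothing: \<open>sigma3 V x\<close> and the Hamiltonian have real entries.\<close>

definition correlation :: "real \<Rightarrow> real \<Rightarrow> (nat \<Rightarrow> 'v graph) \<Rightarrow> 'v \<Rightarrow> 'v \<Rightarrow> real" where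
  "correlation lam \<delta> G x y =
     Re (ground_state_limit lam \<delta> G (\<lambda>V. op_mult (configs V) (sigma3 V x) (sigma3 V y)))"

definition long_range_order ::
    "real \<Rightarrow> real \<Rightarrow> 'v graph \<Rightarrow> (nat \<Rightarrow> 'v graph) \<Rightarrow> bool" where
  "long_range_order lam \<delta> S G \<longleftrightarrow>
     (\<forall>x\<in>verts S. \<exists>c>0. \<forall>y\<in>verts S. correlation lam \<delta> G x y \<ge> c)"

definition is_critical_ratio :: "'v graph \<Rightarrow> (nat \<Rightarrow> 'v graph) \<Rightarrow> real \<Rightarrow> bool" where
  "is_critical_ratio S G r \<longleftrightarrow>
     (\<forall>lam \<delta>. lam > 0 \<and> \<delta> > 0 \<longrightarrow>
        (lam / \<delta> > r \<longrightarrow> long_range_order lam \<delta> S G) \<and>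
        (lam / \<delta> < r \<longrightarrow> \<not> long_range_order lam \<delta> S G))"

end

theory Submission
  imports Defs
begin

text \<open>
Write \<open>J = \<lambda> / 2\<close> and \<open>K = - H\<close>. In the standard basis \<open>K\<close> is a real symmetric matrix whose
off-diagonal entries are nonnegative and connect all configurations, so by Perron and Frobenius it has a
positive eigenvector \<open>\<psi>\<close>, unique up to scale, for its top eigenvalue. The ground state on a finite
graph is the expectation in \<open>\<psi>\<close> (\<open>ground_state_spins\<close>).

The star is reduced to single chains by Griffiths inequalities: correlations of \<open>\<sigma>\<^sup>(\<^sup>3\<^sup>)\<close> increase when
edges or vertices are added or when the field at a vertex is lowered (\<open>spin_mean_mono\<close>), and
\<open>\<langle>\<sigma>\<^sub>x\<sigma>\<^sub>c\<rangle>\<langle>\<sigma>\<^sub>c\<sigma>\<^sub>y\<rangle> \<le> \<langle>\<sigma>\<^sub>x\<sigma>\<^sub>y\<rangle>\<close> (\<open>spin_mean_product_le\<close>). They come from a convex cone in the doubled system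
that contains \<open>\<psi>' \<otimes> \<psi>\<close> (\<open>ground_vectors_griffiths_cone\<close>). Monotonicity also makes the limit along
the exhaustion exist. It remains to bound correlations on a chain, with bond strength \<open>J\<close> and field \<open>\<delta>\<close>,
on both sides of \<open>J = \<delta>\<close>.

For \<open>J < \<delta>\<close>, lower the field at the centre to \<open>0\<close>. The centre spin then commutes with \<open>K\<close>, and a second
operator commuting with \<open>K\<close> is an explicit combination \<open>b = \<Sum>\<^sub>i r\<^sup>i B\<^sub>i\<close>, \<open>r = J / \<delta>\<close>, of Jordan-Wigner
fermions along one arm, a zero mode localised at the centre. Uniqueness of the even ground vector gives
\<open>b \<psi> = \<kappa> \<sigma>\<^sub>0 \<psi>\<close> with \<open>\<bar>\<kappa>\<bar> \<ge> 1\<close>. As \<open>\<langle>\<psi>, \<sigma>\<^sub>m B\<^sub>i \<psi>\<rangle> = 0\<close> for \<open>i < m\<close>, only the tail \<open>\<Sum>\<^sub>i\<^sub>\<ge>\<^sub>m r\<^sup>i\<close> contributes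
to \<open>\<langle>\<sigma>\<^sub>m \<sigma>\<^sub>0\<rangle>\<close>, which therefore decays exponentially, uniformly in the size of the graph
(\<open>frozen_end_correlation_le\<close>).

For \<open>J > \<delta>\<close>, take a path with \<open>N\<close> edges, let \<open>q = \<delta> / J\<close>, and let \<open>\<alpha> = \<Sum>\<^sub>i q\<^sup>i A\<^sub>i \<psi>\<close> be the almost
zero mode at its left end: \<open>(M - K) \<alpha> = \<epsilon> \<sigma>\<^sub>N \<psi>\<close>, where \<open>M\<close> is the top eigenvalue and \<open>\<epsilon> = 2 \<delta> q\<^sup>N\<close>; its
mirror image satisfies \<open>(M - K) \<beta> = \<epsilon> \<sigma>\<^sub>0 \<psi>\<close>. A Griffiths inequality for unequal times
(\<open>unequal_time_correlation_le\<close>) bounds the imaginary-time correlation of \<open>\<sigma>\<^sub>0\<close> and \<open>\<sigma>\<^sub>N\<close> by \<open>\<langle>\<sigma>\<^sub>0 \<sigma>\<^sub>N\<rangle>\<close>;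
summing it over times up to order \<open>1 / \<epsilon>\<close> and comparing with \<open>\<alpha>\<close> and \<open>\<beta>\<close> yields
\<open>\<langle>\<sigma>\<^sub>0 \<sigma>\<^sub>N\<rangle> \<ge> (1 - q\<^sup>2) / 4\<close> for all \<open>N\<close> (\<open>end_to_end_correlation_ge\<close>). Any vertex of the star is joined to the
centre by such a path, and the product inequality through the centre gives long range order.
\<close>

section \<open>Symmetric kernels on a finite set\<close>

definition ip :: "'c set \<Rightarrow> ('c \<Rightarrow> real) \<Rightarrow> ('c \<Rightarrow> real) \<Rightarrow> real" where
  "ip C u v = (\<Sum>s\<in>C. u s * v s)"

definition apply_kernel :: "'c set \<Rightarrow> ('c \<Rightarrow> 'c \<Rightarrow> real) \<Rightarrow> ('c \<Rightarrow> real) \<Rightarrow> 'c \<Rightarrow> real" where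
  "apply_kernel C K u s = (\<Sum>t\<in>C. K s t * u t)"

lemma ip_commute: "ip C u v = ip C v u"
  by (simp add: ip_def mult.commute)

lemma ip_add_right: "ip C u (\<lambda>s. v s + w s) = ip C u v + ip C u w"
  by (simp add: ip_def algebra_simps sum.distrib)

lemma ip_scale_right: "ip C u (\<lambda>s. a * v s) = a * ip C u v"
  by (simp add: ip_def sum_distrib_left mult_ac)

lemma ip_diff_right: "ip C u (\<lambda>s. v s - w s) = ip C u v - ip C u w"
  by (simp add: ip_def algebra_simps sum_subtractf)

lemma ip_add_left: "ip C (\<lambda>s. v s + w s) u = ip C v u + ip C w u"
  by (simp add: ip_def algebra_simps sum.distrib)

lemma ip_scale_left: "ip C (\<lambda>s. a * v s) u = a * ip C v u"
  by (simp add: ip_def sum_distrib_left mult_ac)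

lemma ip_diff_left: "ip C (\<lambda>s. v s - w s) u = ip C v u - ip C w u"
  by (simp add: ip_def algebra_simps sum_subtractf)

lemma ip_sum_right: "ip C u (\<lambda>s. \<Sum>i\<in>I. v i s) = (\<Sum>i\<in>I. ip C u (v i))"
  unfolding ip_def by (subst sum.swap) (simp add: sum_distrib_left)

lemma ip_sum_left: "ip C (\<lambda>s. \<Sum>i\<in>I. v i s) u = (\<Sum>i\<in>I. ip C (v i) u)"
  unfolding ip_def by (subst sum.swap) (simp add: sum_distrib_right)

lemma ip_cong:
  assumes "\<And>s. s \<in> C \<Longrightarrow> u s = u' s" "\<And>s. s \<in> C \<Longrightarrow> v s = v' s"
  shows "ip C u v = ip C u' v'"
  unfolding ip_def using assms by (intro sum.cong) auto

lemma ip_self_nonneg: "ip C u u \<ge> 0"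
  unfolding ip_def by (intro sum_nonneg) auto

lemma ip_self_eq_0_iff: "finite C \<Longrightarrow> ip C u u = 0 \<longleftrightarrow> (\<forall>s\<in>C. u s = 0)"
  unfolding ip_def by (subst sum_nonneg_eq_0_iff) auto

lemma apply_kernel_cong: "(\<And>t. t \<in> C \<Longrightarrow> u t = v t) \<Longrightarrow> apply_kernel C K u s = apply_kernel C K v s"
  unfolding apply_kernel_def by (intro sum.cong) auto

lemma apply_kernel_add: "apply_kernel C K (\<lambda>s. u s + v s) s = apply_kernel C K u s + apply_kernel C K v s"
  by (simp add: apply_kernel_def algebra_simps sum.distrib)

lemma apply_kernel_scale: "apply_kernel C K (\<lambda>s. a * u s) s = a * apply_kernel C K u s"
  by (simp add: apply_kernel_def sum_distrib_left mult_ac)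

lemma apply_kernel_sum: "apply_kernel C K (\<lambda>s. \<Sum>i\<in>I. u i s) s = (\<Sum>i\<in>I. apply_kernel C K (u i) s)"
  unfolding apply_kernel_def by (subst sum.swap) (simp add: sum_distrib_left)

lemma ip_apply_kernel_symmetric:
  assumes "\<And>s t. s \<in> C \<Longrightarrow> t \<in> C \<Longrightarrow> K s t = K t s"
  shows "ip C u (apply_kernel C K v) = ip C (apply_kernel C K u) v"
proof -
  have "ip C u (apply_kernel C K v) = (\<Sum>s\<in>C. \<Sum>t\<in>C. K s t * u s * v t)"
    by (simp add: ip_def apply_kernel_def sum_distrib_left mult_ac)
  also have "\<dots> = (\<Sum>t\<in>C. \<Sum>s\<in>C. K s t * u s * v t)"
    by (rule sum.swap)
  also have "\<dots> = (\<Sum>t\<in>C. \<Sum>s\<in>C. K t s * u s * v t)"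
    using assms by (intro sum.cong) auto
  also have "\<dots> = ip C (apply_kernel C K u) v"
    by (simp add: ip_def apply_kernel_def sum_distrib_left sum_distrib_right mult_ac)
  finally show ?thesis .
qed

text \<open>
The first-order condition at a maximum, in the form needed for the quadratic form of a kernel.
\<close>

lemma quadratic_nonpos_imp_linear_zero:
  fixes a b :: real
  assumes "\<And>x. 2 * x * a + x\<^sup>2 * b \<le> 0"
  shows "a = 0"
proof (rule ccontr)
  assume a: "a \<noteq> 0"
  define x where "x = a / (\<bar>b\<bar> + 1)"
  have bp: "\<bar>b\<bar> + 1 > 0" by simp
  have eq: "a = x * (\<bar>b\<bar> + 1)" using bp by (simp add: x_def)
  have x: "x\<^sup>2 > 0" using a bp by (simp add: x_def)
  have "2 * x * a + x\<^sup>2 * b = x\<^sup>2 * (2 * (\<bar>b\<bar> + 1) + b)"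
    by (subst eq) (simp add: power2_eq_square algebra_simps)
  moreover have "2 * (\<bar>b\<bar> + 1) + b > 0" using abs_ge_minus_self[of b] abs_ge_zero[of b] by argo
  ultimately have "2 * x * a + x\<^sup>2 * b > 0" using x by simp
  then show False using assms[of x] by simp
qed

definition orthonormal :: "'c set \<Rightarrow> nat \<Rightarrow> (nat \<Rightarrow> 'c \<Rightarrow> real) \<Rightarrow> bool" where
  "orthonormal C m \<phi> \<longleftrightarrow> (\<forall>i<m. \<forall>j<m. ip C (\<phi> i) (\<phi> j) = of_bool (i = j))"

lemma compact_unit_sphere:
  fixes C :: "'c set"
  assumes C: "finite C"
  shows "compact {u :: 'c \<Rightarrow> real. (\<forall>s. s \<notin> C \<longrightarrow> u s = 0) \<and> ip C u u = 1 \<and> (\<forall>i<m. ip C (\<phi> i) u = 0)}"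
    (is "compact ?S")
proof -
  define B where "B = Pi\<^sub>E UNIV (\<lambda>s. if s \<in> C then {-1..1} else {0 :: real})"
  have "compactin (product_topology (\<lambda>i. euclidean) UNIV) B"
    unfolding B_def by (subst compactin_PiE) auto
  then have cB: "compact B"
    by (simp add: euclidean_product_topology)
  have co: "continuous_on UNIV (\<lambda>u :: 'c \<Rightarrow> real. u s)" for s
    by (rule continuous_on_product_coordinates)
  have cont: "continuous_on UNIV (\<lambda>u :: 'c \<Rightarrow> real. ip C u u)"
      "continuous_on UNIV (\<lambda>u. ip C v u)" for v
    unfolding ip_def by (intro continuous_on_sum continuous_on_mult continuous_on_const co)+
  have c1: "closed {u. ip C u u = 1}" using cont(1)
    by (intro closed_Collect_eq continuous_intros) 
  have c2: "closed {u. \<forall>i<m. ip C (\<phi> i) u = 0}" using cont(2)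
    by (intro closed_Collect_all closed_Collect_imp closed_Collect_eq continuous_intros) auto
  have sub: "\<bar>u s\<bar> \<le> 1" if "ip C u u = 1" "s \<in> C" for u s
  proof -
    have "u s * u s \<le> ip C u u" unfolding ip_def
      using that C by (intro member_le_sum) auto
    then show ?thesis using that abs_le_square_iff[of "u s" 1] by (simp add: power2_eq_square)
  qed
  have "?S = B \<inter> ({u. ip C u u = 1} \<inter> {u. \<forall>i<m. ip C (\<phi> i) u = 0})"
    using sub by (fastforce simp: B_def abs_le_iff split: if_splits)
  then show ?thesis using compact_Int_closed[OF cB closed_Int[OF c1 c2]] by simp
qed

text \<open>
The maximiser of the quadratic form on the unit sphere of the orthogonal complement, which is invariant
under the kernel, is an eigenvector.
\<close>

lemma next_eigenvector:
  fixes C :: "'c set"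
  assumes C: "finite C" and sym: "\<And>s t. s \<in> C \<Longrightarrow> t \<in> C \<Longrightarrow> K s t = K t s"
    and on: "orthonormal C m \<phi>" and eig: "\<And>i s. i < m \<Longrightarrow> s \<in> C \<Longrightarrow> apply_kernel C K (\<phi> i) s = \<mu> i * \<phi> i s"
    and v: "\<And>i. i < m \<Longrightarrow> ip C (\<phi> i) v = 0" "ip C v v \<noteq> 0"
  shows "\<exists>u M. ip C u u = 1 \<and> (\<forall>i<m. ip C (\<phi> i) u = 0) \<and> (\<forall>s\<in>C. apply_kernel C K u s = M * u s)"
proof -
  let ?S = "{u :: 'c \<Rightarrow> real. (\<forall>s. s \<notin> C \<longrightarrow> u s = 0) \<and> ip C u u = 1 \<and> (\<forall>i<m. ip C (\<phi> i) u = 0)}"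
  define v' where "v' = (\<lambda>s. if s \<in> C then v s / sqrt (ip C v v) else 0)"
  have ipv': "ip C w v' = ip C w v / sqrt (ip C v v)" for w
    unfolding v'_def ip_def by (simp add: sum_divide_distrib)
  have "ip C v' v' = 1"
    using v(2) ip_self_nonneg[of C v] by (simp add: ipv' ip_commute[of C v' v])
  moreover have "ip C (\<phi> i) v' = 0" if "i < m" for i using v(1)[OF that] by (simp add: ipv')
  ultimately have "v' \<in> ?S" by (simp add: v'_def)
  then have ne: "?S \<noteq> {}" by blast
  have "continuous_on UNIV (\<lambda>u. ip C u (apply_kernel C K u))"
    unfolding ip_def apply_kernel_def
    by (intro continuous_on_sum continuous_on_mult continuous_on_const continuous_on_product_coordinates)
  then have "continuous_on ?S (\<lambda>u. ip C u (apply_kernel C K u))"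
    by (rule continuous_on_subset) simp
  from continuous_attains_sup[OF compact_unit_sphere[OF C] ne this]
  obtain u where u: "u \<in> ?S" and max: "\<And>w. w \<in> ?S \<Longrightarrow> ip C w (apply_kernel C K w) \<le> ip C u (apply_kernel C K u)" by blast
  define M where "M = ip C u (apply_kernel C K u)"
  have max': "ip C w (apply_kernel C K w) \<le> M * ip C w w" if w: "\<And>i. i < m \<Longrightarrow> ip C (\<phi> i) w = 0" for w
  proof (cases "ip C w w = 0")
    case True
    then have "\<forall>s\<in>C. w s = 0" using C by (simp add: ip_self_eq_0_iff)
    then show ?thesis by (simp add: ip_def)
  next
    case False
    then have pos: "ip C w w > 0" using ip_self_nonneg[of C w] by simp
    define w' where "w' = (\<lambda>s. if s \<in> C then (1 / sqrt (ip C w w)) * w s else 0)"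
    have ipw': "ip C x w' = ip C x w / sqrt (ip C w w)" for x
      unfolding w'_def ip_def by (simp add: sum_divide_distrib)
    have "ip C w' w' = 1"
      using pos by (simp add: ipw' ip_commute[of C w' w])
    moreover have "ip C (\<phi> i) w' = 0" if "i < m" for i using w[OF that] by (simp add: ipw')
    ultimately have "w' \<in> ?S" by (simp add: w'_def)
    from max[OF this] have "ip C w' (apply_kernel C K w') \<le> M" by (simp add: M_def)
    moreover have "apply_kernel C K w' = (\<lambda>s. (1 / sqrt (ip C w w)) * apply_kernel C K w s)"
      unfolding apply_kernel_scale[symmetric] by (intro ext apply_kernel_cong) (simp add: w'_def)
    then have "ip C w' (apply_kernel C K w') = ip C w (apply_kernel C K w) / ip C w w"
      using pos by (simp only: ip_scale_right ip_commute[of C w'] ipw') (simp add: ip_commute)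
    ultimately show ?thesis using pos by (simp add: field_simps)
  qed
  have uu: "ip C u u = 1" and uo: "\<And>i. i < m \<Longrightarrow> ip C (\<phi> i) u = 0" using u by auto
  define r where "r = (\<lambda>s. apply_kernel C K u s - M * u s)"
  have ro: "ip C (\<phi> i) r = 0" if "i < m" for i
  proof -
    have "ip C (\<phi> i) (apply_kernel C K u) = ip C (\<lambda>s. \<mu> i * \<phi> i s) u"
      using eig that by (subst ip_apply_kernel_symmetric[OF sym]) (auto intro!: ip_cong)
    then show ?thesis using uo[OF that] unfolding r_def
      by (simp add: ip_diff_right ip_scale_right ip_scale_left)
  qed
  have "2 * x * ip C r r + x\<^sup>2 * (ip C r (apply_kernel C K r) - M * ip C r r) \<le> 0" for x
  proof -
    have "ip C (\<lambda>s. u s + x * r s) (apply_kernel C K (\<lambda>s. u s + x * r s)) \<le> M * ip C (\<lambda>s. u s + x * r s) (\<lambda>s. u s + x * r s)"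
      by (rule max') (simp add: ip_add_right ip_scale_right uo ro)
    moreover have "ip C u (apply_kernel C K r) = ip C r (apply_kernel C K u)"
      by (subst ip_apply_kernel_symmetric[OF sym]) (auto simp: ip_commute)
    moreover have "ip C r (apply_kernel C K u) - M * ip C r u = ip C r r"
      by (simp add: r_def ip_diff_right ip_scale_right ip_diff_left ip_scale_left)
    ultimately show ?thesis
      by (simp add: apply_kernel_add[abs_def] apply_kernel_scale[abs_def] ip_add_right ip_add_left ip_scale_right ip_scale_left uu
          M_def[symmetric] power2_eq_square algebra_simps ip_commute[of C u r])
  qed
  then have "ip C r r = 0" by (rule quadratic_nonpos_imp_linear_zero)
  then have "\<forall>s\<in>C. apply_kernel C K u s = M * u s" using C by (simp add: ip_self_eq_0_iff r_def)
  then show ?thesis using uu uo by blast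
qed

text \<open>
The component of the point mass at \<open>s\<close> orthogonal to an orthonormal family. Its norm shows whether the
family is complete at \<open>s\<close>; together with \<open>sum_of_squares_orthonormal\<close> this replaces a dimension count.
\<close>

lemma residual_of_orthonormal:
  assumes C: "finite C" and on: "orthonormal C m \<phi>" and s: "s \<in> C"
  defines "v \<equiv> (\<lambda>t. of_bool (s = t) - (\<Sum>i<m. \<phi> i s * \<phi> i t))"
  shows "i < m \<Longrightarrow> ip C (\<phi> i) v = 0" "ip C v v = 1 - (\<Sum>i<m. (\<phi> i s)\<^sup>2)"
proof -
  have delta: "ip C w (\<lambda>t. of_bool (s = t)) = w s" for w
    using C s by (simp add: ip_def if_distrib sum.delta' cong: if_cong)
  have o: "ip C (\<phi> i) v = 0" if "i < m" for i
  proof -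
    have "(\<Sum>j<m. \<phi> j s * ip C (\<phi> i) (\<phi> j)) = (\<Sum>j<m. \<phi> j s * of_bool (i = j))"
      using on that by (intro sum.cong) (auto simp: orthonormal_def)
    also have "\<dots> = \<phi> i s" using that by (simp add: if_distrib sum.delta' cong: if_cong)
    finally show ?thesis unfolding v_def
      by (simp add: ip_diff_right delta ip_sum_right ip_scale_right)
  qed
  show "ip C (\<phi> i) v = 0" if "i < m" using o that .
  have "ip C v v = ip C v (\<lambda>t. of_bool (s = t)) - (\<Sum>i<m. \<phi> i s * ip C v (\<phi> i))"
    by (subst (2) v_def) (simp add: ip_diff_right ip_sum_right ip_scale_right)
  also have "\<dots> = v s" using o by (simp add: delta ip_commute[of C v])
  finally show "ip C v v = 1 - (\<Sum>i<m. (\<phi> i s)\<^sup>2)"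
    by (simp add: v_def power2_eq_square)
qed

lemma sum_of_squares_orthonormal:
  assumes "orthonormal C m \<phi>"
  shows "(\<Sum>s\<in>C. \<Sum>i<m. (\<phi> i s)\<^sup>2) = real m"
proof -
  have "(\<Sum>s\<in>C. \<Sum>i<m. (\<phi> i s)\<^sup>2) = (\<Sum>i<m. ip C (\<phi> i) (\<phi> i))"
    unfolding ip_def by (subst sum.swap) (simp add: power2_eq_square)
  also have "\<dots> = (\<Sum>i<m. 1)" using assms by (intro sum.cong) (auto simp: orthonormal_def)
  finally show ?thesis by simp
qed

definition eigenbasis :: "'c set \<Rightarrow> ('c \<Rightarrow> 'c \<Rightarrow> real) \<Rightarrow> (nat \<Rightarrow> 'c \<Rightarrow> real) \<Rightarrow> (nat \<Rightarrow> real) \<Rightarrow> bool" where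
  "eigenbasis C K \<phi> \<mu> \<longleftrightarrow> orthonormal C (card C) \<phi> \<and>
     (\<forall>i<card C. \<forall>s\<in>C. apply_kernel C K (\<phi> i) s = \<mu> i * \<phi> i s) \<and>
     (\<forall>s\<in>C. \<forall>t\<in>C. (\<Sum>i<card C. \<phi> i s * \<phi> i t) = of_bool (s = t))"

text \<open>
The spectral theorem. Eigenvectors are added one at a time: a family of fewer than \<open>card C\<close> vectors
has a nonzero residual at some point, hence a nonzero orthogonal complement. With \<open>card C\<close> vectors all
residuals vanish, which is completeness.
\<close>

theorem eigenbasis_exists:
  fixes C :: "'c set"
  assumes C: "finite C" and sym: "\<And>s t. s \<in> C \<Longrightarrow> t \<in> C \<Longrightarrow> K s t = K t s"
  shows "\<exists>\<phi> \<mu>. eigenbasis C K \<phi> \<mu>"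
proof -
  have "\<exists>\<phi> \<mu>. orthonormal C m \<phi> \<and> (\<forall>i<m. \<forall>s\<in>C. apply_kernel C K (\<phi> i) s = \<mu> i * \<phi> i s)" if "m \<le> card C" for m
    using that
  proof (induction m)
    case 0
    show ?case by (auto simp: orthonormal_def)
  next
    case (Suc m)
    then obtain \<phi> \<mu> where on: "orthonormal C m \<phi>" and eig: "\<And>i s. i < m \<Longrightarrow> s \<in> C \<Longrightarrow> apply_kernel C K (\<phi> i) s = \<mu> i * \<phi> i s"
      by (auto simp: Suc_le_eq)
    have "\<exists>s\<in>C. (\<Sum>i<m. (\<phi> i s)\<^sup>2) \<noteq> 1"
    proof (rule ccontr)
      assume "\<not> ?thesis"
      then have "(\<Sum>s\<in>C. \<Sum>i<m. (\<phi> i s)\<^sup>2) = real (card C)" by simp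
      then show False using sum_of_squares_orthonormal[OF on] Suc.prems by simp
    qed
    then obtain s where s: "s \<in> C" "(\<Sum>i<m. (\<phi> i s)\<^sup>2) \<noteq> 1" by blast
    define v where "v = (\<lambda>t. of_bool (s = t) - (\<Sum>i<m. \<phi> i s * \<phi> i t))"
    have "\<exists>u M. ip C u u = 1 \<and> (\<forall>i<m. ip C (\<phi> i) u = 0) \<and> (\<forall>s\<in>C. apply_kernel C K u s = M * u s)"
    proof (rule next_eigenvector[OF C sym on eig])
      show "ip C (\<phi> i) v = 0" if "i < m" for i
        unfolding v_def by (rule residual_of_orthonormal(1)[OF C on s(1) that])
      have "ip C v v = 1 - (\<Sum>i<m. (\<phi> i s)\<^sup>2)"
        unfolding v_def by (rule residual_of_orthonormal(2)[OF C on s(1)])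
      then show "ip C v v \<noteq> 0" using s(2) by simp
    qed
    then obtain u M where u: "ip C u u = 1" "\<And>i. i < m \<Longrightarrow> ip C (\<phi> i) u = 0" "\<And>s. s \<in> C \<Longrightarrow> apply_kernel C K u s = M * u s"
      by blast
    have "orthonormal C (Suc m) (\<phi>(m := u))"
      using on u(1,2) u(2)[unfolded ip_commute[of C _ u]] by (auto simp: orthonormal_def less_Suc_eq)
    moreover have "\<forall>i<Suc m. \<forall>s\<in>C. apply_kernel C K ((\<phi>(m := u)) i) s = (\<mu>(m := M)) i * (\<phi>(m := u)) i s"
      using eig u(3) by (auto simp: less_Suc_eq)
    ultimately show ?case by blast
  qed
  then obtain \<phi> \<mu> where on: "orthonormal C (card C) \<phi>"
    and eig: "\<forall>i<card C. \<forall>s\<in>C. apply_kernel C K (\<phi> i) s = \<mu> i * \<phi> i s" by blast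
  have "(\<Sum>s\<in>C. 1 - (\<Sum>i<card C. (\<phi> i s)\<^sup>2)) = 0"
    using sum_of_squares_orthonormal[OF on] by (simp add: sum_subtractf)
  moreover have nn: "1 - (\<Sum>i<card C. (\<phi> i s)\<^sup>2) \<ge> 0" if "s \<in> C" for s
    using residual_of_orthonormal(2)[OF C on that]
      ip_self_nonneg[of C "\<lambda>t. of_bool (s = t) - (\<Sum>i<card C. \<phi> i s * \<phi> i t)"] by linarith
  ultimately have z: "1 - (\<Sum>i<card C. (\<phi> i s)\<^sup>2) = 0" if "s \<in> C" for s
    using C that by (subst (asm) sum_nonneg_eq_0_iff) auto
  have "(\<Sum>i<card C. \<phi> i s * \<phi> i t) = of_bool (s = t)" if st: "s \<in> C" "t \<in> C" for s t
  proof -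
    have "ip C (\<lambda>t. of_bool (s = t) - (\<Sum>i<card C. \<phi> i s * \<phi> i t))
        (\<lambda>t. of_bool (s = t) - (\<Sum>i<card C. \<phi> i s * \<phi> i t)) = 0"
      using residual_of_orthonormal(2)[OF C on st(1)] z[OF st(1)] by linarith
    then show ?thesis using st(2) by (simp add: ip_self_eq_0_iff[OF C])
  qed
  then show ?thesis using on eig unfolding eigenbasis_def by blast
qed

lemma eigenbasis_expansion:
  assumes "finite C" "eigenbasis C K \<phi> \<mu>" "s \<in> C"
  shows "u s = (\<Sum>i<card C. ip C (\<phi> i) u * \<phi> i s)"
proof -
  have "(\<Sum>i<card C. ip C (\<phi> i) u * \<phi> i s) = (\<Sum>t\<in>C. \<Sum>i<card C. \<phi> i t * u t * \<phi> i s)"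
    by (simp add: ip_def sum_distrib_right sum.swap[of _ C])
  also have "\<dots> = (\<Sum>t\<in>C. u t * (\<Sum>i<card C. \<phi> i s * \<phi> i t))"
    by (simp add: sum_distrib_left mult_ac)
  also have "\<dots> = (\<Sum>t\<in>C. u t * of_bool (s = t))"
    using assms by (intro sum.cong) (auto simp: eigenbasis_def)
  also have "\<dots> = u s"
    using assms by (simp add: if_distrib sum.delta' cong: if_cong)
  finally show ?thesis by simp
qed

lemma eigenbasis_Parseval:
  assumes "finite C" "eigenbasis C K \<phi> \<mu>"
  shows "ip C u v = (\<Sum>i<card C. ip C (\<phi> i) u * ip C (\<phi> i) v)"
proof -
  have "ip C u v = ip C (\<lambda>s. \<Sum>i<card C. ip C (\<phi> i) u * \<phi> i s) v"
    using eigenbasis_expansion[OF assms] by (intro ip_cong) auto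
  then show ?thesis by (simp add: ip_sum_left ip_scale_left)
qed

lemma ip_eigenvector_apply_kernel:
  assumes sym: "\<And>s t. s \<in> C \<Longrightarrow> t \<in> C \<Longrightarrow> K s t = K t s" and "\<And>s. s \<in> C \<Longrightarrow> apply_kernel C K u s = M * u s"
  shows "ip C u (apply_kernel C K v) = M * ip C u v"
proof -
  have "ip C u (apply_kernel C K v) = ip C (\<lambda>s. M * u s) v"
    using assms(2) by (subst ip_apply_kernel_symmetric[OF sym]) (auto intro!: ip_cong)
  then show ?thesis by (simp add: ip_scale_left)
qed

lemma eigenvectors_orthogonal:
  assumes sym: "\<And>s t. s \<in> C \<Longrightarrow> t \<in> C \<Longrightarrow> K s t = K t s"
    and "\<And>s. s \<in> C \<Longrightarrow> apply_kernel C K u s = M * u s" "\<And>s. s \<in> C \<Longrightarrow> apply_kernel C K v s = N * v s" "M \<noteq> N"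
  shows "ip C u v = 0"
proof -
  have "M * ip C u v = ip C u (apply_kernel C K v)"
    using ip_eigenvector_apply_kernel[OF sym assms(2)] by simp
  also have "\<dots> = N * ip C u v"
    using assms(3) by (simp add: ip_scale_right[symmetric] cong: ip_cong)
  finally show ?thesis using assms(4) by simp
qed

lemma Rayleigh_maximiser_is_eigenvector:
  assumes C: "finite C" and sym: "\<And>s t. s \<in> C \<Longrightarrow> t \<in> C \<Longrightarrow> K s t = K t s"
    and eb: "eigenbasis C K \<phi> \<mu>" and le: "\<And>i. i < card C \<Longrightarrow> \<mu> i \<le> M"
    and u: "ip C u (apply_kernel C K u) \<ge> M * ip C u u" and s: "s \<in> C"
  shows "apply_kernel C K u s = M * u s"
proof -
  have eig: "apply_kernel C K (\<phi> i) t = \<mu> i * \<phi> i t" if "i < card C" "t \<in> C" for i t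
    using eb that by (auto simp: eigenbasis_def)
  have coef: "ip C (\<phi> i) (apply_kernel C K u) = \<mu> i * ip C (\<phi> i) u" if "i < card C" for i
    using ip_eigenvector_apply_kernel[OF sym eig[OF that]] .
  have "(\<Sum>i<card C. (M - \<mu> i) * (ip C (\<phi> i) u)\<^sup>2) = M * ip C u u - ip C u (apply_kernel C K u)"
    by (simp add: eigenbasis_Parseval[OF C eb, of u] coef sum_distrib_left sum_subtractf
        power2_eq_square algebra_simps)
  also have "\<dots> \<le> 0" using u by simp
  finally have "(\<Sum>i<card C. (M - \<mu> i) * (ip C (\<phi> i) u)\<^sup>2) = 0"
    by (rule antisym) (use le in \<open>auto intro!: sum_nonneg\<close>)
  then have z: "(M - \<mu> i) * (ip C (\<phi> i) u)\<^sup>2 = 0" if "i < card C" for i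
    using that le by (subst (asm) sum_nonneg_eq_0_iff) auto
  have "apply_kernel C K u s = (\<Sum>i<card C. \<mu> i * ip C (\<phi> i) u * \<phi> i s)"
    using eigenbasis_expansion[OF C eb s, of "apply_kernel C K u"] by (simp add: coef)
  also have "\<dots> = (\<Sum>i<card C. M * (ip C (\<phi> i) u * \<phi> i s))"
    using z by (intro sum.cong) auto
  also have "\<dots> = M * u s"
    using eigenbasis_expansion[OF C eb s, of u] by (simp add: sum_distrib_left)
  finally show ?thesis .
qed

text \<open>
Replacing a top eigenvector by its absolute value does not decrease the quadratic form, so the absolute
value is again a maximiser.
\<close>

lemma nonneg_top_eigenvector:
  fixes C :: "'c set"
  assumes C: "finite C" "C \<noteq> {}" and sym: "\<And>s t. s \<in> C \<Longrightarrow> t \<in> C \<Longrightarrow> K s t = K t s"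
    and nn: "\<And>s t. s \<in> C \<Longrightarrow> t \<in> C \<Longrightarrow> s \<noteq> t \<Longrightarrow> K s t \<ge> 0"
    and eb: "eigenbasis C K \<phi> \<mu>"
  shows "\<exists>u M. (\<forall>i<card C. \<mu> i \<le> M) \<and> (\<forall>s\<in>C. u s \<ge> 0) \<and> (\<exists>s\<in>C. u s > 0) \<and> (\<forall>s\<in>C. apply_kernel C K u s = M * u s)"
proof -
  have cpos: "card C > 0" using C by (simp add: card_gt_0_iff)
  define M where "M = Max (\<mu> ` {..<card C})"
  have le: "\<mu> i \<le> M" if "i < card C" for i using that by (auto simp: M_def)
  have "M \<in> \<mu> ` {..<card C}" unfolding M_def using cpos by (intro Max_in) auto
  then obtain k where k: "k < card C" "\<mu> k = M" by auto
  define u where "u = (\<lambda>s. \<bar>\<phi> k s\<bar>)"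
  have eig: "apply_kernel C K (\<phi> k) t = M * \<phi> k t" if "t \<in> C" for t
    using eb that k by (auto simp: eigenbasis_def)
  have one: "ip C (\<phi> k) (\<phi> k) = 1" using eb k by (auto simp: eigenbasis_def orthonormal_def)
  have uu: "ip C u u = ip C (\<phi> k) (\<phi> k)" by (simp add: u_def ip_def)
  have "M * ip C u u = ip C (\<phi> k) (apply_kernel C K (\<phi> k))"
    using ip_eigenvector_apply_kernel[OF sym eig] uu by simp
  also have "\<dots> \<le> ip C u (apply_kernel C K u)"
    unfolding ip_def apply_kernel_def sum_distrib_left
  proof (intro sum_mono)
    fix s t assume st: "s \<in> C" "t \<in> C"
    show "\<phi> k s * (K s t * \<phi> k t) \<le> u s * (K s t * u t)"
    proof (cases "s = t")
      case False
      have "K s t * (\<phi> k s * \<phi> k t) \<le> K s t * \<bar>\<phi> k s * \<phi> k t\<bar>"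
        using nn[OF st False] by (intro mult_left_mono) auto
      then show ?thesis by (simp add: u_def abs_mult mult_ac)
    qed (simp add: u_def mult_ac flip: abs_mult)
  qed
  finally have "apply_kernel C K u s = M * u s" if "s \<in> C" for s
    using Rayleigh_maximiser_is_eigenvector[OF C(1) sym eb le _ that] by blast
  moreover have "\<exists>s\<in>C. u s > 0"
  proof (rule ccontr)
    assume "\<not> ?thesis"
    then have "ip C u u = 0" using C(1) by (simp add: ip_self_eq_0_iff u_def)
    then show False using uu one by simp
  qed
  ultimately show ?thesis using le by (intro exI[of _ u] exI[of _ M]) (auto simp: u_def)
qed

text \<open>
For an eigenbasis \<open>\<phi>\<close>, \<open>\<mu>\<close> this is the orthogonal projection onto the eigenspace of \<open>M\<close>.
\<close>

definition top_projection where
  "top_projection C \<phi> \<mu> M u s = (\<Sum>i | i < card C \<and> \<mu> i = (M :: real). ip C (\<phi> i) u * \<phi> i s)"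

lemma apply_kernel_top_projection:
  assumes "eigenbasis C K \<phi> \<mu>" "s \<in> C"
  shows "apply_kernel C K (top_projection C \<phi> \<mu> M u) s = M * top_projection C \<phi> \<mu> M u s"
proof -
  have "apply_kernel C K (top_projection C \<phi> \<mu> M u) s
      = (\<Sum>i | i < card C \<and> \<mu> i = M. ip C (\<phi> i) u * apply_kernel C K (\<phi> i) s)"
    unfolding top_projection_def[abs_def] by (simp only: apply_kernel_sum apply_kernel_scale)
  also have "\<dots> = M * top_projection C \<phi> \<mu> M u s"
    unfolding top_projection_def sum_distrib_left
    using assms by (intro sum.cong) (auto simp: eigenbasis_def)
  finally show ?thesis .
qed

lemma ip_top_projection:
  assumes C: "finite C" and sym: "\<And>s t. s \<in> C \<Longrightarrow> t \<in> C \<Longrightarrow> K s t = K t s"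
    and eb: "eigenbasis C K \<phi> \<mu>" and f: "\<And>s. s \<in> C \<Longrightarrow> apply_kernel C K f s = M * f s"
  shows "ip C f (top_projection C \<phi> \<mu> M u) = ip C f u"
proof -
  have z: "ip C (\<phi> i) f = 0" if "i < card C" "\<mu> i \<noteq> M" for i
    by (rule eigenvectors_orthogonal[where K = K and M = "\<mu> i" and N = M])
      (use eb that f sym in \<open>auto simp: eigenbasis_def\<close>)
  have "ip C f u = (\<Sum>i<card C. ip C (\<phi> i) f * ip C (\<phi> i) u)"
    by (rule eigenbasis_Parseval[OF C eb])
  also have "\<dots> = (\<Sum>i | i < card C \<and> \<mu> i = M. ip C (\<phi> i) f * ip C (\<phi> i) u)"
    using z by (intro sum.mono_neutral_right) auto
  also have "\<dots> = ip C f (top_projection C \<phi> \<mu> M u)"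
    unfolding top_projection_def[abs_def] ip_sum_right ip_scale_right
    by (intro sum.cong) (simp_all add: ip_commute[of C f])
  finally show ?thesis by simp
qed

section \<open>Spin configurations\<close>

definition spin :: "2 \<Rightarrow> real" where
  "spin i = (if i = 1 then 1 else -1)"

definition flip :: "'v set \<Rightarrow> 'v config \<Rightarrow> 'v config" where
  "flip D s = (\<lambda>x. if x \<in> D then s x + 1 else s x)"

definition chi :: "'v set \<Rightarrow> 'v config \<Rightarrow> real" where
  "chi A s = (\<Prod>x\<in>A. spin (s x))"

definition symdiff :: "'v set \<Rightarrow> 'v set \<Rightarrow> 'v set" where
  "symdiff A B = (A - B) \<union> (B - A)"

lemma two_cases: "(i :: 2) = 0 \<or> i = 1"
  using exhaust_2[of i] by auto

lemma add_one_one [simp]: "(i :: 2) + 1 + 1 = i"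
  using two_cases[of i] by auto

lemma add_one_neq [simp]: "(i :: 2) + 1 \<noteq> i"
  using two_cases[of i] by auto

lemma eq_add_one_iff: "(i :: 2) \<noteq> j \<longleftrightarrow> i = j + 1"
  using two_cases[of i] two_cases[of j] by auto

lemma spin_add_one [simp]: "spin (i + 1) = - spin i"
  using two_cases[of i] by (auto simp: spin_def)

lemma spin_mult_self [simp]: "spin i * spin i = 1" "spin i * (spin i * a) = a"
  by (auto simp: spin_def)

lemma abs_spin [simp]: "\<bar>spin i\<bar> = 1"
  by (simp add: spin_def)

lemma flip_apply: "flip D s x = (if x \<in> D then s x + 1 else s x)"
  by (simp add: flip_def)

lemma flip_flip: "flip D (flip D' s) = flip (symdiff D D') s"
  by (auto simp: flip_def symdiff_def fun_eq_iff)

lemma symdiff_self [simp]: "symdiff D D = {}" by (simp add: symdiff_def)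

lemma symdiff_subset [simp]: "A \<subseteq> V \<Longrightarrow> B \<subseteq> V \<Longrightarrow> symdiff A B \<subseteq> V" by (auto simp: symdiff_def)

lemma symdiff_commute: "symdiff A B = symdiff B A" by (auto simp: symdiff_def)

lemma symdiff_symdiff [simp]: "symdiff A (symdiff A B) = B" by (auto simp: symdiff_def)

lemma flip_empty [simp]: "flip {} s = s" by (simp add: flip_def)

lemma flip_twice [simp]: "flip D (flip D s) = s" by (simp add: flip_flip)

lemma flip_in_configs [simp]: "D \<subseteq> V \<Longrightarrow> s \<in> configs V \<Longrightarrow> flip D s \<in> configs V"
  by (auto simp: configs_def flip_def PiE_iff extensional_def)

lemma finite_configs [simp]: "finite V \<Longrightarrow> finite (configs V)"
  unfolding configs_def by (intro finite_PiE) auto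

lemma configs_nonempty [simp]: "configs V \<noteq> {}"
  by (auto simp: configs_def PiE_eq_empty_iff)

lemma card_configs: "finite V \<Longrightarrow> card (configs V) = 2 ^ card V"
  by (simp add: configs_def card_PiE)

lemma sum_flip:
  assumes "D \<subseteq> V"
  shows "(\<Sum>s\<in>configs V. f (flip D s)) = (\<Sum>s\<in>configs V. f s)"
  by (rule sum.reindex_bij_witness[of _ "flip D" "flip D"]) (use assms in auto)

lemma config_eq_flip:
  assumes "s \<in> configs V" "t \<in> configs V"
  shows "t = flip {x \<in> V. s x \<noteq> t x} s"
proof
  fix x
  show "t x = flip {x \<in> V. s x \<noteq> t x} s x"
  proof (cases "x \<in> V")
    case True
    have "t x = s x + 1" if "s x \<noteq> t x" using that eq_add_one_iff by metis
    then show ?thesis using True by (simp add: flip_def)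
  next
    case False
    then show ?thesis using assms by (simp add: flip_def configs_def PiE_iff extensional_def)
  qed
qed

lemma ip_flip:
  assumes "D \<subseteq> V"
  shows "ip (configs V) (\<lambda>s. u (flip D s)) (\<lambda>s. v (flip D s)) = ip (configs V) u v"
  unfolding ip_def using sum_flip[OF assms, of "\<lambda>s. u s * v s"] by simp

lemma chi_flip:
  assumes "finite A"
  shows "chi A (flip D s) = (-1) ^ card (A \<inter> D) * chi A s"
  using assms
proof (induction A rule: finite_induct)
  case (insert x A)
  then show ?case by (auto simp: chi_def flip_apply)
qed (simp add: chi_def)

lemma chi_mult:
  assumes "finite A" "finite B"
  shows "chi A s * chi B s = chi (symdiff A B) s"
proof -
  have "chi A s = chi (A - B) s * chi (A \<inter> B) s" "chi B s = chi (B - A) s * chi (A \<inter> B) s"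
    unfolding chi_def using assms
    by (subst prod.union_disjoint[symmetric]; auto intro!: prod.cong)+
  moreover have "chi (A \<inter> B) s * chi (A \<inter> B) s = 1"
    unfolding chi_def by (simp flip: prod.distrib)
  ultimately have "chi A s * chi B s = chi (A - B) s * chi (B - A) s"
    by (simp add: mult_ac)
  also have "\<dots> = chi (symdiff A B) s"
    unfolding chi_def symdiff_def using assms by (subst prod.union_disjoint[symmetric]) auto
  finally show ?thesis .
qed

lemma chi_singleton [simp]: "chi {x} s = spin (s x)" by (simp add: chi_def)

lemma chi_empty [simp]: "chi {} s = 1" by (simp add: chi_def)

lemma abs_chi [simp]: "\<bar>chi A s\<bar> = 1" by (simp add: chi_def abs_prod)

lemma sum_chi:
  assumes "finite V" "A \<subseteq> V"
  shows "(\<Sum>s\<in>configs V. chi A s) = (if A = {} then 2 ^ card V else 0)"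
proof (cases "A = {}")
  case False
  then obtain x where x: "x \<in> A" by blast
  have fA: "finite A" using assms finite_subset by blast
  have "(\<Sum>s\<in>configs V. chi A s) = (\<Sum>s\<in>configs V. chi A (flip {x} s))"
    using x assms by (intro sum_flip[symmetric]) auto
  also have "\<dots> = - (\<Sum>s\<in>configs V. chi A s)"
    using x fA by (simp add: chi_flip sum_negf Int_insert_right)
  finally show ?thesis using False by simp
qed (use assms in \<open>simp add: card_configs\<close>)

text \<open>
Completeness of the characters; the involution \<open>A \<mapsto> A \<triangle> {x}\<close> at a site \<open>x\<close> where \<open>s\<close> and \<open>t\<close> differ
changes the sign of every term.
\<close>

lemma sum_chi_chi:
  assumes V: "finite V" and st: "s \<in> configs V" "t \<in> configs V"
  shows "(\<Sum>A\<in>Pow V. chi A s * chi A t) = (if s = t then 2 ^ card V else 0)"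
proof (cases "s = t")
  case True
  have "chi A t * chi A t = 1" for A unfolding chi_def by (simp flip: prod.distrib)
  then show ?thesis using True V by (simp add: card_Pow)
next
  case False
  have "{x \<in> V. s x \<noteq> t x} \<noteq> {}" using config_eq_flip[OF st] False by force
  then obtain x where x: "x \<in> V" "s x \<noteq> t x" by blast
  have fin: "finite A" if "A \<in> Pow V" for A using that V finite_subset by auto
  have "(\<Sum>A\<in>Pow V. chi A s * chi A t) = (\<Sum>A\<in>Pow V. chi (symdiff {x} A) s * chi (symdiff {x} A) t)"
    by (rule sum.reindex_bij_witness[of _ "symdiff {x}" "symdiff {x}"]) (use x in auto)
  also have "\<dots> = (\<Sum>A\<in>Pow V. - (chi A s * chi A t))"
  proof (intro sum.cong refl)
    fix A assume "A \<in> Pow V"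
    then have "chi (symdiff {x} A) s * chi (symdiff {x} A) t = spin (s x) * chi A s * (spin (t x) * chi A t)"
      using chi_mult[of "{x}" A s] chi_mult[of "{x}" A t] fin by simp
    also have "s x = t x + 1" using x eq_add_one_iff by blast
    finally show "chi (symdiff {x} A) s * chi (symdiff {x} A) t = - (chi A s * chi A t)"
      by (simp add: mult_ac)
  qed
  finally show ?thesis using False by (simp add: sum_negf)
qed

section \<open>The Ising operator and its positive eigenvector\<close>

definition simple_graph :: "'v set \<Rightarrow> 'v set set \<Rightarrow> bool" where
  "simple_graph V E \<longleftrightarrow> finite V \<and> (\<forall>e\<in>E. e \<subseteq> V \<and> card e = 2)"

text \<open>
Minus the Hamiltonian as an operator on real functions of the configuration. The field may depend on
the vertex, since fields are lowered locally in comparisons.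
\<close>

definition ising :: "'v set \<Rightarrow> 'v set set \<Rightarrow> real \<Rightarrow> ('v \<Rightarrow> real) \<Rightarrow> ('v config \<Rightarrow> real) \<Rightarrow> 'v config \<Rightarrow> real" where
  "ising V E J \<delta> u s = J * (\<Sum>e\<in>E. chi e s) * u s + (\<Sum>x\<in>V. \<delta> x * u (flip {x} s))"

definition ising_kernel :: "'v set \<Rightarrow> 'v set set \<Rightarrow> real \<Rightarrow> ('v \<Rightarrow> real) \<Rightarrow> 'v config \<Rightarrow> 'v config \<Rightarrow> real" where
  "ising_kernel V E J \<delta> s t =
     (if s = t then J * (\<Sum>e\<in>E. chi e s) else 0) + (\<Sum>x\<in>V. if t = flip {x} s then \<delta> x else 0)"

definition even_fun :: "'v set \<Rightarrow> ('v config \<Rightarrow> real) \<Rightarrow> bool" where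
  "even_fun V u \<longleftrightarrow> (\<forall>s\<in>configs V. u (flip V s) = u s)"

text \<open>
Evenness is part of the notion because a vanishing field at one vertex makes the positive eigenvectors
non-unique; under the global spin flip exactly one even direction survives.
\<close>

definition ground_vector ::
    "'v set \<Rightarrow> 'v set set \<Rightarrow> real \<Rightarrow> ('v \<Rightarrow> real) \<Rightarrow> ('v config \<Rightarrow> real) \<Rightarrow> real \<Rightarrow> bool" where
  "ground_vector V E J \<delta> \<psi> M \<longleftrightarrow> (\<forall>s\<in>configs V. \<psi> s > 0) \<and> even_fun V \<psi> \<and>
     (\<forall>s\<in>configs V. ising V E J \<delta> \<psi> s = M * \<psi> s)"

text \<open>
The field may vanish at the single vertex \<open>c\<close>.
\<close>

definition transverse_field :: "'v set \<Rightarrow> ('v \<Rightarrow> real) \<Rightarrow> 'v \<Rightarrow> bool" where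
  "transverse_field V \<delta> c \<longleftrightarrow> (\<forall>x\<in>V. \<delta> x \<ge> 0) \<and> (\<forall>x\<in>V. x \<noteq> c \<longrightarrow> \<delta> x > 0)"

lemma simple_graph_finite: "simple_graph V E \<Longrightarrow> finite V" "simple_graph V E \<Longrightarrow> finite E"
  unfolding simple_graph_def using finite_subset[of E "Pow V"] by auto

lemma apply_kernel_ising_kernel:
  assumes "finite V" "s \<in> configs V"
  shows "apply_kernel (configs V) (ising_kernel V E J \<delta>) u s = ising V E J \<delta> u s"
proof -
  have "(\<Sum>t\<in>configs V. (if s = t then J * (\<Sum>e\<in>E. chi e s) else 0) * u t) = J * (\<Sum>e\<in>E. chi e s) * u s"
    using assms by (simp add: if_distrib[of "\<lambda>z. z * _"] sum.delta' cong: if_cong)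
  moreover have "(\<Sum>t\<in>configs V. (\<Sum>x\<in>V. if t = flip {x} s then \<delta> x else 0) * u t)
      = (\<Sum>x\<in>V. \<delta> x * u (flip {x} s))"
  proof -
    have "(\<Sum>t\<in>configs V. (\<Sum>x\<in>V. if t = flip {x} s then \<delta> x else 0) * u t)
        = (\<Sum>x\<in>V. \<Sum>t\<in>configs V. (if t = flip {x} s then \<delta> x * u t else 0))"
      unfolding sum_distrib_right by (subst sum.swap) (auto intro!: sum.cong)
    also have "\<dots> = (\<Sum>x\<in>V. \<delta> x * u (flip {x} s))"
      using assms by (intro sum.cong) (auto simp: sum.delta)
    finally show ?thesis .
  qed
  ultimately show ?thesis
    by (simp add: apply_kernel_def ising_kernel_def ising_def algebra_simps sum.distrib)
qed

lemma ising_kernel_symmetric: "ising_kernel V E J \<delta> s t = ising_kernel V E J \<delta> t s"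
proof -
  have "t = flip {x} s \<longleftrightarrow> s = flip {x} t" for x by auto
  then show ?thesis by (simp add: ising_kernel_def)
qed

lemma ip_ising:
  assumes "finite V"
  shows "ip (configs V) u (ising V E J \<delta> v) = ip (configs V) (ising V E J \<delta> u) v"
proof -
  have "ip (configs V) u (apply_kernel (configs V) (ising_kernel V E J \<delta>) v)
      = ip (configs V) (apply_kernel (configs V) (ising_kernel V E J \<delta>) u) v"
    by (rule ip_apply_kernel_symmetric) (rule ising_kernel_symmetric)
  then show ?thesis using assms by (simp add: apply_kernel_ising_kernel cong: ip_cong)
qed

lemma ising_cong:
  assumes "\<And>t. t \<in> configs V \<Longrightarrow> u t = v t" "s \<in> configs V"
  shows "ising V E J \<delta> u s = ising V E J \<delta> v s"
  unfolding ising_def using assms by (simp cong: sum.cong)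

text \<open>
At a zero of a nonnegative eigenfunction the eigenvalue equation is a vanishing sum of nonnegative terms,
so the neighbours reached by flipping a spin with positive field are zeros too.
\<close>

lemma zero_propagates:
  assumes V: "finite V" and nn: "\<And>x. x \<in> V \<Longrightarrow> \<delta> x \<ge> 0"
    and eta: "\<And>s. s \<in> configs V \<Longrightarrow> \<eta> s \<ge> 0" "\<And>s. s \<in> configs V \<Longrightarrow> ising V E J \<delta> \<eta> s = M * \<eta> s"
    and s: "s \<in> configs V" "\<eta> s = 0" and D: "D \<subseteq> V" "\<And>x. x \<in> D \<Longrightarrow> \<delta> x > 0"
  shows "\<eta> (flip D s) = 0"
proof -
  have "finite D" using V D finite_subset by blast
  then show ?thesis using D
  proof (induction D rule: finite_induct)
    case empty
    then show ?case using s by simp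
  next
    case (insert x D)
    define t where "t = flip D s"
    have t: "t \<in> configs V" "\<eta> t = 0" using insert s by (auto simp: t_def)
    have "(\<Sum>x\<in>V. \<delta> x * \<eta> (flip {x} t)) = 0"
      using eta(2)[OF t(1)] t(2) by (simp add: ising_def)
    then have "\<delta> x * \<eta> (flip {x} t) = 0"
      using V nn eta(1) t(1) insert.prems by (subst (asm) sum_nonneg_eq_0_iff) auto
    then have "\<eta> (flip {x} t) = 0" using insert.prems(2)[of x] by simp
    moreover have "flip {x} t = flip (insert x D) s"
      using insert.hyps by (auto simp: t_def flip_def fun_eq_iff)
    ultimately show ?case by simp
  qed
qed

text \<open>
If the spin at \<open>c\<close> cannot be flipped by the field, it is flipped together with all others using evenness.
\<close>

lemma zero_everywhere:
  assumes V: "finite V" and c: "transverse_field V \<delta> c" "\<delta> c > 0 \<or> even_fun V \<eta>"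
    and eta: "\<And>s. s \<in> configs V \<Longrightarrow> \<eta> s \<ge> 0" "\<And>s. s \<in> configs V \<Longrightarrow> ising V E J \<delta> \<eta> s = M * \<eta> s"
    and s: "s \<in> configs V" "\<eta> s = 0" and t: "t \<in> configs V"
  shows "\<eta> t = 0"
proof -
  define D where "D = {x \<in> V. s x \<noteq> t x}"
  have tD: "t = flip D s" unfolding D_def using config_eq_flip[OF s(1) t] .
  have nn: "\<And>x. x \<in> V \<Longrightarrow> \<delta> x \<ge> 0" using c by (simp add: transverse_field_def)
  have spread: "\<eta> (flip D' s') = 0"
    if "s' \<in> configs V" "\<eta> s' = 0" "D' \<subseteq> V" "\<And>x. x \<in> D' \<Longrightarrow> \<delta> x > 0" for s' D'
    by (rule zero_propagates[where \<delta> = \<delta> and \<eta> = \<eta> and E = E and J = J and M = M])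
      (use V nn eta that in auto)
  show ?thesis
  proof (cases "c \<in> D \<and> \<not> \<delta> c > 0")
    case False
    then have "\<eta> (flip D s) = 0" using c
      by (intro spread[OF s]) (auto simp: D_def transverse_field_def)
    then show ?thesis using tD by simp
  next
    case True
    then have ev: "even_fun V \<eta>" using c by auto
    have s': "flip V s \<in> configs V" "\<eta> (flip V s) = 0" using ev s by (auto simp: even_fun_def)
    have "\<eta> (flip (V - D) (flip V s)) = 0"
      using c True by (intro spread[OF s']) (auto simp: transverse_field_def)
    moreover have "flip (V - D) (flip V s) = flip D s"
      by (auto simp: flip_def D_def fun_eq_iff)
    ultimately show ?thesis using tD by simp
  qed
qed

lemma ising_diff: "ising V E J \<delta> (\<lambda>s. u s - v s) s = ising V E J \<delta> u s - ising V E J \<delta> v s"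
  by (simp add: ising_def algebra_simps sum_subtractf)

lemma ising_add: "ising V E J \<delta> (\<lambda>s. u s + v s) s = ising V E J \<delta> u s + ising V E J \<delta> v s"
  by (simp add: ising_def algebra_simps sum.distrib)

lemma ising_scale: "ising V E J \<delta> (\<lambda>s. a * u s) s = a * ising V E J \<delta> u s"
  by (simp add: ising_def algebra_simps sum_distrib_left)

lemma ising_sum: "ising V E J \<delta> (\<lambda>s. \<Sum>i\<in>I. u i s) s = (\<Sum>i\<in>I. ising V E J \<delta> (u i) s)"
  by (simp add: ising_def sum.distrib sum_distrib_left sum.swap[of _ V])

text \<open>
Subtracting the largest multiple of \<open>\<psi>\<close> that stays below \<open>f\<close> leaves a nonnegative eigenfunction with a
zero.
\<close>

lemma eigenvector_unique:
  assumes V: "finite V" and c: "transverse_field V \<delta> c" "\<delta> c > 0 \<or> even_fun V f"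
    and g: "ground_vector V E J \<delta> \<psi> M" and chi: "\<And>s. s \<in> configs V \<Longrightarrow> ising V E J \<delta> f s = M * f s"
  shows "\<exists>a. \<forall>s\<in>configs V. f s = a * \<psi> s"
proof -
  define a where "a = Min ((\<lambda>s. f s / \<psi> s) ` configs V)"
  have "a \<in> (\<lambda>s. f s / \<psi> s) ` configs V"
    unfolding a_def using V by (intro Min_in) auto
  then obtain s0 where s0: "s0 \<in> configs V" "a = f s0 / \<psi> s0" by blast
  have le: "a \<le> f s / \<psi> s" if "s \<in> configs V" for s using V that by (simp add: a_def)
  have pos: "\<psi> s > 0" if "s \<in> configs V" for s using g that by (simp add: ground_vector_def)
  define \<eta> where "\<eta> = (\<lambda>s. f s - a * \<psi> s)"
  have "\<eta> s = 0" if "s \<in> configs V" for s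
  proof (rule zero_everywhere[OF V c(1) _ _ _ s0(1) _ that])
    show "\<delta> c > 0 \<or> even_fun V \<eta>" using c(2) g by (auto simp: even_fun_def \<eta>_def ground_vector_def)
    show "\<eta> s \<ge> 0" if "s \<in> configs V" for s
      using le[OF that] pos[OF that] by (simp add: \<eta>_def field_simps)
    show "ising V E J \<delta> \<eta> s = M * \<eta> s" if "s \<in> configs V" for s
      using chi[OF that] g that by (simp add: \<eta>_def ising_diff ising_scale ground_vector_def algebra_simps)
    show "\<eta> s0 = 0" using s0 pos[OF s0(1)] by (simp add: \<eta>_def)
  qed
  then show ?thesis by (auto simp: \<eta>_def)
qed

lemma ising_flip_all:
  assumes G: "simple_graph V E"
  shows "ising V E J \<delta> u (flip V s) = ising V E J \<delta> (\<lambda>s. u (flip V s)) s"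
proof -
  have "chi e (flip V s) = chi e s" if "e \<in> E" for e
  proof -
    have "e \<inter> V = e" "finite e" "card e = 2"
      using G that simple_graph_finite[OF G] by (auto simp: simple_graph_def intro: finite_subset)
    then show ?thesis by (simp add: chi_flip)
  qed
  moreover have "flip {x} (flip V s) = flip V (flip {x} s)" for x
    by (simp add: flip_flip symdiff_commute)
  ultimately show ?thesis by (simp add: ising_def)
qed

lemma eigenbasis_ising_exists:
  assumes "finite V"
  shows "\<exists>\<phi> \<mu>. eigenbasis (configs V) (ising_kernel V E J \<delta>) \<phi> \<mu>"
  using assms by (intro eigenbasis_exists ising_kernel_symmetric) auto

lemma ground_vector_exists:
  assumes G: "simple_graph V E" and c: "transverse_field V \<delta> c"
    and eb: "eigenbasis (configs V) (ising_kernel V E J \<delta>) \<phi> \<mu>"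
  shows "\<exists>\<psi> M. ground_vector V E J \<delta> \<psi> M \<and> (\<forall>i<card (configs V). \<mu> i \<le> M)"
proof -
  have V: "finite V" using G by (rule simple_graph_finite)
  have "ising_kernel V E J \<delta> s t \<ge> 0" if "s \<noteq> t" for s t
    using that c by (auto simp: ising_kernel_def transverse_field_def intro!: sum_nonneg)
  then have "\<exists>u M. (\<forall>i<card (configs V). \<mu> i \<le> M) \<and> (\<forall>s\<in>configs V. u s \<ge> 0) \<and>
      (\<exists>s\<in>configs V. u s > 0) \<and> (\<forall>s\<in>configs V. apply_kernel (configs V) (ising_kernel V E J \<delta>) u s = M * u s)"
    using V by (intro nonneg_top_eigenvector[OF _ _ ising_kernel_symmetric _ eb]) auto
  then obtain u M where M: "\<forall>i<card (configs V). \<mu> i \<le> M" and u: "\<And>s. s \<in> configs V \<Longrightarrow> u s \<ge> 0"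
    "\<exists>s\<in>configs V. u s > 0" "\<And>s. s \<in> configs V \<Longrightarrow> ising V E J \<delta> u s = M * u s"
    using V by (simp add: apply_kernel_ising_kernel) blast
  define \<psi> where "\<psi> = (\<lambda>s. u s + u (flip V s))"
  have ev: "even_fun V \<psi>" by (simp add: even_fun_def \<psi>_def)
  have nn: "\<psi> s \<ge> 0" if "s \<in> configs V" for s using u(1) that by (simp add: \<psi>_def)
  have eig: "ising V E J \<delta> \<psi> s = M * \<psi> s" if "s \<in> configs V" for s
    using u(3) that by (simp add: \<psi>_def ising_add ising_flip_all[OF G, symmetric] algebra_simps)
  obtain t where t: "t \<in> configs V" "u t > 0" using u(2) by blast
  have "u (flip V t) \<ge> 0" using t u(1) by simp
  then have "\<psi> t \<noteq> 0" using t by (simp add: \<psi>_def)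
  then have "\<psi> s > 0" if "s \<in> configs V" for s
    using zero_everywhere[OF V c _ nn eig that _ t(1)] ev nn[OF that] by fastforce
  then show ?thesis using ev eig M by (auto simp: ground_vector_def)
qed

text \<open>
Two positive vectors are never orthogonal, so a positive eigenvector belongs to the top eigenvalue.
\<close>

lemma ground_vector_top:
  assumes G: "simple_graph V E" and c: "transverse_field V \<delta> c"
    and g: "ground_vector V E J \<delta> \<psi> M"
    and eb: "eigenbasis (configs V) (ising_kernel V E J \<delta>) \<phi> \<mu>" and i: "i < card (configs V)"
  shows "\<mu> i \<le> M"
proof -
  have V: "finite V" using G by (rule simple_graph_finite)
  obtain \<psi>' M' where g': "ground_vector V E J \<delta> \<psi>' M'" and le: "\<mu> i \<le> M'"
    using ground_vector_exists[OF G c eb] i by blast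
  have pos: "ip (configs V) \<psi> \<psi>' > 0"
    unfolding ip_def using g g' V by (intro sum_pos) (auto simp: ground_vector_def)
  have "M' * ip (configs V) \<psi> \<psi>' = ip (configs V) \<psi> (ising V E J \<delta> \<psi>')"
    using g' by (simp add: ground_vector_def ip_scale_right[symmetric] cong: ip_cong)
  also have "\<dots> = M * ip (configs V) \<psi> \<psi>'"
    using g by (simp add: ip_ising[OF V] ground_vector_def ip_scale_left[symmetric] cong: ip_cong)
  finally show ?thesis using pos le by simp
qed

text \<open>
The constant function is even and has positive inner product with \<open>\<psi>\<close>. This identifies the limit of
powers of the operator applied to the constant function.
\<close>

lemma top_projection_one:
  assumes G: "simple_graph V E" and c: "transverse_field V \<delta> c"
    and g: "ground_vector V E J \<delta> \<psi> M"
    and eb: "eigenbasis (configs V) (ising_kernel V E J \<delta>) \<phi> \<mu>"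
  shows "\<exists>a>0. \<forall>s\<in>configs V. top_projection (configs V) \<phi> \<mu> M (\<lambda>s. 1) s = a * \<psi> s"
proof -
  let ?C = "configs V" and ?K = "ising_kernel V E J \<delta>"
  have V: "finite V" using G by (rule simple_graph_finite)
  define f where "f = top_projection ?C \<phi> \<mu> M (\<lambda>s. 1)"
  have eig: "ising V E J \<delta> f s = M * f s" if "s \<in> ?C" for s
    using apply_kernel_top_projection[OF eb that] V that by (simp add: f_def apply_kernel_ising_kernel)
  have proj: "ip ?C h f = ip ?C h (\<lambda>s. 1)" if "\<And>s. s \<in> ?C \<Longrightarrow> ising V E J \<delta> h s = M * h s" for h
    unfolding f_def using V that
    by (intro ip_top_projection[OF _ ising_kernel_symmetric eb]) (auto simp: apply_kernel_ising_kernel)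
  \<comment> \<open>\<open>f\<close> is even: its odd part is a top eigenvector orthogonal to the even function \<open>1\<close>, of which \<open>f\<close> is the projection\<close>
  define h where "h = (\<lambda>s. f s - f (flip V s))"
  have "ising V E J \<delta> h s = M * h s" if "s \<in> ?C" for s
    using eig[OF that] eig[of "flip V s"] that
    by (simp add: h_def ising_diff ising_flip_all[OF G, symmetric] algebra_simps)
  then have "ip ?C h f = ip ?C h (\<lambda>s. 1)" by (rule proj)
  also have "\<dots> = 0" using sum_flip[of V V f] by (simp add: ip_def h_def sum_subtractf)
  finally have hf: "ip ?C h f = 0" .
  have "ip ?C h (\<lambda>s. f (flip V s)) = ip ?C (\<lambda>s. h (flip V s)) f"
    using ip_flip[of V V "\<lambda>s. h (flip V s)" f] by simp
  also have "\<dots> = - ip ?C h f" by (simp add: ip_def h_def sum_negf[symmetric] algebra_simps)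
  finally have "ip ?C h h = 0" using hf by (subst (2) h_def) (simp add: ip_diff_right)
  then have h0: "h s = 0" if "s \<in> ?C" for s using V that by (simp add: ip_self_eq_0_iff)
  have "f (flip V s) = f s" if "s \<in> ?C" for s using h0[OF that] unfolding h_def by linarith
  then have "even_fun V f" by (simp add: even_fun_def)
  then obtain a where a: "\<forall>s\<in>?C. f s = a * \<psi> s"
    using eigenvector_unique[OF V c _ g eig] by blast
  have pp: "ip ?C \<psi> \<psi> > 0" "ip ?C \<psi> (\<lambda>s. 1) > 0"
    unfolding ip_def using g V by (auto intro!: sum_pos simp: ground_vector_def)
  have "a * ip ?C \<psi> \<psi> = ip ?C \<psi> f"
    using a by (simp add: ip_scale_right[symmetric] cong: ip_cong)
  also have "\<dots> = ip ?C \<psi> (\<lambda>s. 1)" using g by (intro proj) (simp add: ground_vector_def)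
  finally have "a > 0" using pp by (metis zero_less_mult_pos2)
  then show ?thesis using a by (auto simp: f_def)
qed

section \<open>Griffiths inequalities\<close>

text \<open>
In the doubled system write a pair of configurations as \<open>(s, flip D s)\<close>. The number below is the Fourier
coefficient of \<open>\<Phi>\<close> in \<open>s\<close> at the character \<open>A\<close> for a fixed set \<open>D\<close> of disagreement. In the corresponding
orthogonal basis every operator of interest has nonnegative entries, which is the idea behind
the Griffiths inequalities below.
\<close>

definition griffiths_coef :: "'v set \<Rightarrow> ('v config \<Rightarrow> 'v config \<Rightarrow> real) \<Rightarrow> 'v set \<Rightarrow> 'v set \<Rightarrow> real" where
  "griffiths_coef V \<Phi> A D = (\<Sum>s\<in>configs V. chi A s * \<Phi> s (flip D s))"

definition griffiths_cone :: "'v set \<Rightarrow> ('v config \<Rightarrow> 'v config \<Rightarrow> real) \<Rightarrow> bool" where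
  "griffiths_cone V \<Phi> \<longleftrightarrow> (\<forall>A\<subseteq>V. \<forall>D\<subseteq>V. griffiths_coef V \<Phi> A D \<ge> 0)"

lemma griffiths_cone_add: "griffiths_cone V \<Phi> \<Longrightarrow> griffiths_cone V \<Psi> \<Longrightarrow> griffiths_cone V (\<lambda>s t. \<Phi> s t + \<Psi> s t)"
  by (simp add: griffiths_cone_def griffiths_coef_def algebra_simps sum.distrib)

lemma griffiths_cone_scale: "griffiths_cone V \<Phi> \<Longrightarrow> a \<ge> 0 \<Longrightarrow> griffiths_cone V (\<lambda>s t. a * \<Phi> s t)"
  unfolding griffiths_cone_def griffiths_coef_def
  by (simp add: mult.left_commute[of _ a] flip: sum_distrib_left)

lemma griffiths_cone_zero: "griffiths_cone V (\<lambda>s t. 0)"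
  by (simp add: griffiths_cone_def griffiths_coef_def)

lemma griffiths_cone_sum: "(\<And>i. i \<in> I \<Longrightarrow> griffiths_cone V (\<Phi> i)) \<Longrightarrow> griffiths_cone V (\<lambda>s t. \<Sum>i\<in>I. \<Phi> i s t)"
  by (induction I rule: infinite_finite_induct) (auto intro: griffiths_cone_add griffiths_cone_zero)

lemma griffiths_cone_limit:
  assumes "\<And>n. griffiths_cone V (\<Phi> n)"
    and "\<And>s t. s \<in> configs V \<Longrightarrow> t \<in> configs V \<Longrightarrow> (\<lambda>n. \<Phi> n s t) \<longlonglongrightarrow> \<Psi> s t"
  shows "griffiths_cone V \<Psi>"
  unfolding griffiths_cone_def
proof (intro allI impI)
  fix A D assume AD: "A \<subseteq> V" "D \<subseteq> V"
  have "(\<lambda>n. griffiths_coef V (\<Phi> n) A D) \<longlonglongrightarrow> griffiths_coef V \<Psi> A D"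
    unfolding griffiths_coef_def using AD by (intro tendsto_intros assms(2)) auto
  then show "griffiths_coef V \<Psi> A D \<ge> 0"
    by (rule LIMSEQ_le_const) (use assms(1) AD in \<open>auto simp: griffiths_cone_def\<close>)
qed

lemma griffiths_cone_cong:
  assumes "griffiths_cone V \<Phi>" "\<And>s t. s \<in> configs V \<Longrightarrow> t \<in> configs V \<Longrightarrow> \<Phi> s t = \<Psi> s t"
  shows "griffiths_cone V \<Psi>"
  by (rule griffiths_cone_limit[where \<Phi> = "\<lambda>n. \<Phi>"]) (use assms in auto)

lemma griffiths_cone_one: "finite V \<Longrightarrow> griffiths_cone V (\<lambda>s t. 1)"
  by (simp add: griffiths_cone_def griffiths_coef_def sum_chi)

text \<open>
On pairs with disagreement set \<open>D\<close> the multiplier equals \<open>chi B s\<close> times the nonnegative constant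
\<open>a + b (-1)\<^bsup>|B \<inter> D|\<^esup>\<close>, and \<open>chi B\<close> only shifts the Fourier index.
\<close>

lemma griffiths_cone_chi:
  assumes V: "finite V" "B \<subseteq> V" and P: "griffiths_cone V \<Phi>" and ab: "\<bar>b\<bar> \<le> a"
  shows "griffiths_cone V (\<lambda>s t. (a * chi B s + b * chi B t) * \<Phi> s t)"
  unfolding griffiths_cone_def
proof (intro allI impI)
  fix A D assume AD: "A \<subseteq> V" "D \<subseteq> V"
  have fin: "finite A" "finite B" using AD V finite_subset by blast+
  have "griffiths_coef V (\<lambda>s t. (a * chi B s + b * chi B t) * \<Phi> s t) A D
      = (\<Sum>s\<in>configs V. (a + b * (-1) ^ card (B \<inter> D)) * (chi (symdiff A B) s * \<Phi> s (flip D s)))"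
    unfolding griffiths_coef_def
    by (intro sum.cong refl) (simp add: chi_flip fin algebra_simps flip: chi_mult[OF fin])
  also have "\<dots> = (a + b * (-1) ^ card (B \<inter> D)) * griffiths_coef V \<Phi> (symdiff A B) D"
    by (simp add: griffiths_coef_def sum_distrib_left)
  also have "\<dots> \<ge> 0"
  proof (intro mult_nonneg_nonneg)
    show "a + b * (-1) ^ card (B \<inter> D) \<ge> 0"
      using ab by (cases "even (card (B \<inter> D))") auto
    show "griffiths_coef V \<Phi> (symdiff A B) D \<ge> 0"
      using P AD V by (simp add: griffiths_cone_def)
  qed
  finally show "griffiths_coef V (\<lambda>s t. (a * chi B s + b * chi B t) * \<Phi> s t) A D \<ge> 0" .
qed

text \<open>
Flipping \<open>x\<close> in either copy toggles \<open>x\<close> in the disagreement set; in the first copy it also multiplies the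
coefficient by \<open>-1\<close> if \<open>x \<in> A\<close>. So the field has to be at least as strong in the second copy.
\<close>

lemma griffiths_cone_flip:
  assumes V: "finite V" "x \<in> V" and P: "griffiths_cone V \<Phi>" and ab: "\<bar>a\<bar> \<le> b"
  shows "griffiths_cone V (\<lambda>s t. a * \<Phi> (flip {x} s) t + b * \<Phi> s (flip {x} t))"
  unfolding griffiths_cone_def
proof (intro allI impI)
  fix A D assume AD: "A \<subseteq> V" "D \<subseteq> V"
  have fin: "finite A" using AD V finite_subset by blast
  define D' where "D' = symdiff D {x}"
  have "(\<Sum>s\<in>configs V. chi A s * \<Phi> (flip {x} s) (flip D s))
      = (\<Sum>s\<in>configs V. chi A (flip {x} s) * \<Phi> (flip {x} (flip {x} s)) (flip D (flip {x} s)))"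
    using V by (intro sum_flip[symmetric]) auto
  also have "\<dots> = (-1) ^ card (A \<inter> {x}) * griffiths_coef V \<Phi> A D'"
    by (simp add: chi_flip[OF fin] flip_flip D'_def griffiths_coef_def sum_distrib_left mult_ac)
  finally have 1: "(\<Sum>s\<in>configs V. chi A s * \<Phi> (flip {x} s) (flip D s)) = (-1) ^ card (A \<inter> {x}) * griffiths_coef V \<Phi> A D'" .
  have "griffiths_coef V (\<lambda>s t. a * \<Phi> (flip {x} s) t + b * \<Phi> s (flip {x} t)) A D
     = a * (\<Sum>s\<in>configs V. chi A s * \<Phi> (flip {x} s) (flip D s)) + b * griffiths_coef V \<Phi> A D'"
    by (simp add: griffiths_coef_def algebra_simps sum.distrib sum_distrib_left flip_flip D'_def symdiff_commute[of "{x}"])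
  also have "\<dots> = (b + a * (-1) ^ card (A \<inter> {x})) * griffiths_coef V \<Phi> A D'"
    unfolding 1 by (simp add: algebra_simps)
  also have "\<dots> \<ge> 0"
  proof (intro mult_nonneg_nonneg)
    show "b + a * (-1) ^ card (A \<inter> {x}) \<ge> 0"
      using ab by (cases "even (card (A \<inter> {x}))") auto
    show "griffiths_coef V \<Phi> A D' \<ge> 0"
      using P AD V by (simp add: griffiths_cone_def D'_def)
  qed
  finally show "griffiths_coef V (\<lambda>s t. a * \<Phi> (flip {x} s) t + b * \<Phi> s (flip {x} t)) A D \<ge> 0" .
qed

lemma sum_config_pairs:
  assumes "s \<in> configs V"
  shows "(\<Sum>t\<in>configs V. f t) = (\<Sum>D\<in>Pow V. f (flip D s))"
proof (rule sum.reindex_bij_witness[of _ "\<lambda>D. flip D s" "\<lambda>t. {x \<in> V. s x \<noteq> t x}"])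
  fix t assume t: "t \<in> configs V"
  show "flip {x \<in> V. s x \<noteq> t x} s = t" using config_eq_flip[OF assms t] by simp
  then show "f (flip {x \<in> V. s x \<noteq> t x} s) = f t" by simp
next
  fix D assume "D \<in> Pow V"
  then show "{x \<in> V. s x \<noteq> flip D s x} = D" "flip D s \<in> configs V"
    using assms by (auto simp: flip_apply)
qed auto

text \<open>
Parseval's identity in \<open>s\<close> for each fixed disagreement set.
\<close>

lemma griffiths_cone_inner_nonneg:
  assumes V: "finite V" and P: "griffiths_cone V \<Phi>" "griffiths_cone V \<Psi>"
  shows "(\<Sum>s\<in>configs V. \<Sum>t\<in>configs V. \<Phi> s t * \<Psi> s t) \<ge> 0"
proof -
  let ?C = "configs V"
  have D: "(\<Sum>s\<in>?C. \<Phi> s (flip D s) * \<Psi> s (flip D s)) \<ge> 0" if D: "D \<subseteq> V" for D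
  proof -
    define f where "f = (\<lambda>s. \<Phi> s (flip D s))"
    define g where "g = (\<lambda>s. \<Psi> s (flip D s))"
    have "(\<Sum>A\<in>Pow V. griffiths_coef V \<Phi> A D * griffiths_coef V \<Psi> A D)
        = (\<Sum>A\<in>Pow V. \<Sum>s\<in>?C. \<Sum>t\<in>?C. f s * g t * (chi A s * chi A t))"
      unfolding griffiths_coef_def f_def g_def sum_product by (simp add: mult_ac)
    also have "\<dots> = (\<Sum>s\<in>?C. \<Sum>t\<in>?C. f s * g t * (\<Sum>A\<in>Pow V. chi A s * chi A t))"
      unfolding sum_distrib_left
      by (subst sum.swap, intro sum.cong refl, rule sum.swap)
    also have "\<dots> = (\<Sum>s\<in>?C. \<Sum>t\<in>?C. if s = t then f s * g t * 2 ^ card V else 0)"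
      using V by (intro sum.cong refl) (simp add: sum_chi_chi)
    also have "\<dots> = 2 ^ card V * (\<Sum>s\<in>?C. f s * g s)"
      using V by (simp add: sum.delta sum_distrib_left mult_ac)
    finally have "2 ^ card V * (\<Sum>s\<in>?C. f s * g s) = (\<Sum>A\<in>Pow V. griffiths_coef V \<Phi> A D * griffiths_coef V \<Psi> A D)" by simp
    also have "\<dots> \<ge> 0" using P D by (intro sum_nonneg mult_nonneg_nonneg) (auto simp: griffiths_cone_def)
    finally have "0 \<le> 2 ^ card V * (\<Sum>s\<in>?C. f s * g s)" .
    then show ?thesis
      using mult_le_cancel_left_pos[of "2 ^ card V :: real" 0 "\<Sum>s\<in>?C. f s * g s"] by (simp add: f_def g_def)
  qed
  have "(\<Sum>s\<in>?C. \<Sum>t\<in>?C. \<Phi> s t * \<Psi> s t) = (\<Sum>s\<in>?C. \<Sum>D\<in>Pow V. \<Phi> s (flip D s) * \<Psi> s (flip D s))"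
    by (intro sum.cong refl sum_config_pairs)
  also have "\<dots> = (\<Sum>D\<in>Pow V. \<Sum>s\<in>?C. \<Phi> s (flip D s) * \<Psi> s (flip D s))" by (rule sum.swap)
  also have "\<dots> \<ge> 0" by (rule sum_nonneg) (use D in auto)
  finally show ?thesis .
qed

text \<open>
The doubled operator \<open>K' \<otimes> 1 + 1 \<otimes> K + c\<close>; the copies share the coupling \<open>J\<close> but may have different
edges and fields.
\<close>

definition pair_op :: "'v set \<Rightarrow> real \<Rightarrow> 'v set set \<Rightarrow> ('v \<Rightarrow> real) \<Rightarrow> 'v set set \<Rightarrow> ('v \<Rightarrow> real) \<Rightarrow> real \<Rightarrow>
    ('v config \<Rightarrow> 'v config \<Rightarrow> real) \<Rightarrow> 'v config \<Rightarrow> 'v config \<Rightarrow> real" where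
  "pair_op V J E' \<delta>' E \<delta> c \<Phi> s t =
     ising V E' J \<delta>' (\<lambda>s. \<Phi> s t) s + ising V E J \<delta> (\<lambda>t. \<Phi> s t) t + c * \<Phi> s t"

lemma pair_op_griffiths_cone:
  assumes G: "simple_graph V E'" and E: "E \<subseteq> E'" and J: "J \<ge> 0" and c: "c \<ge> 0"
    and d: "\<And>x. x \<in> V \<Longrightarrow> \<bar>\<delta>' x\<bar> \<le> \<delta> x" and P: "griffiths_cone V \<Phi>"
  shows "griffiths_cone V (pair_op V J E' \<delta>' E \<delta> c \<Phi>)"
proof -
  have V: "finite V" "finite E'" using simple_graph_finite[OF G] by auto
  let ?\<Psi> = "\<lambda>s t. (\<Sum>e\<in>E'. (J * chi e s + (if e \<in> E then J else 0) * chi e t) * \<Phi> s t)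
     + (\<Sum>x\<in>V. \<delta>' x * \<Phi> (flip {x} s) t + \<delta> x * \<Phi> s (flip {x} t)) + c * \<Phi> s t"
  have "griffiths_cone V ?\<Psi>"
    using G V J c d by (intro griffiths_cone_add griffiths_cone_sum griffiths_cone_chi griffiths_cone_flip griffiths_cone_scale P) (auto simp: simple_graph_def)
  moreover have "pair_op V J E' \<delta>' E \<delta> c \<Phi> = ?\<Psi>"
  proof (intro ext)
    fix s t
    have "(\<Sum>e\<in>E'. (if e \<in> E then J else 0) * chi e t * \<Phi> s t) = (\<Sum>e\<in>E. J * chi e t * \<Phi> s t)"
      using V E by (intro sum.mono_neutral_cong_right) auto
    then show "pair_op V J E' \<delta>' E \<delta> c \<Phi> s t = ?\<Psi> s t"
      by (simp add: pair_op_def ising_def distrib_right sum.distrib sum_distrib_left sum_distrib_right)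
  qed
  ultimately show ?thesis by simp
qed

lemma pair_op_power_griffiths_cone:
  assumes "simple_graph V E'" "E \<subseteq> E'" "J \<ge> 0" "c \<ge> 0"
    and "\<And>x. x \<in> V \<Longrightarrow> \<bar>\<delta>' x\<bar> \<le> \<delta> x" and "griffiths_cone V \<Phi>"
  shows "griffiths_cone V ((pair_op V J E' \<delta>' E \<delta> c ^^ n) \<Phi>)"
proof (induction n)
  case (Suc n)
  show ?case unfolding funpow.simps o_def by (rule pair_op_griffiths_cone[OF assms(1-5) Suc])
qed (use assms(6) in simp)

lemma pair_op_cong:
  assumes "\<And>s t. s \<in> configs V \<Longrightarrow> t \<in> configs V \<Longrightarrow> \<Phi> s t = \<Psi> s t" "s \<in> configs V" "t \<in> configs V"
  shows "pair_op V J E' \<delta>' E \<delta> c \<Phi> s t = pair_op V J E' \<delta>' E \<delta> c \<Psi> s t"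
  unfolding pair_op_def using assms by (auto intro!: arg_cong2[where f = "(+)"] ising_cong)

lemma pair_op_sum:
  "pair_op V J E' \<delta>' E \<delta> c (\<lambda>s t. \<Sum>i\<in>I. \<Phi> i s t) s t = (\<Sum>i\<in>I. pair_op V J E' \<delta>' E \<delta> c (\<Phi> i) s t)"
  by (simp add: pair_op_def ising_sum sum.distrib sum_distrib_left)

lemma pair_op_product:
  "pair_op V J E' \<delta>' E \<delta> c (\<lambda>s t. a * (u s * v t)) s t =
     a * (ising V E' J \<delta>' u s * v t + u s * ising V E J \<delta> v t + c * (u s * v t))"
  by (simp add: pair_op_def ising_def algebra_simps sum_distrib_left sum_distrib_right)

lemma power_tendsto_indicator:
  fixes x :: real
  assumes "0 < x" "x \<le> 1"
  shows "(\<lambda>n. x ^ n) \<longlonglongrightarrow> of_bool (x = 1)"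
proof (cases "x = 1")
  case False
  then have "(\<lambda>n. x ^ n) \<longlonglongrightarrow> 0" using assms by (intro LIMSEQ_realpow_zero) auto
  then show ?thesis using False by simp
qed simp

text \<open>
The cone is closed and preserved by \<open>pair_op\<close>, and contains the constant function. Powers of
\<open>pair_op\<close> applied to the constant function, divided by powers of the top eigenvalue, converge to a
positive multiple of \<open>\<psi>' \<otimes> \<psi>\<close>.
\<close>

theorem ground_vectors_griffiths_cone:
  assumes G: "simple_graph V E'" and E: "E \<subseteq> E'" and J: "J \<ge> 0"
    and d: "\<And>x. x \<in> V \<Longrightarrow> \<delta>' x \<le> \<delta> x"
    and tf: "transverse_field V \<delta>' c'" "transverse_field V \<delta> c"
    and g: "ground_vector V E' J \<delta>' \<psi>' M'" "ground_vector V E J \<delta> \<psi> M"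
  shows "griffiths_cone V (\<lambda>s t. \<psi>' s * \<psi> t)"
proof -
  let ?C = "configs V"
  let ?N = "card ?C"
  have V: "finite V" using simple_graph_finite[OF G] by auto
  have G2: "simple_graph V E" using G E by (auto simp: simple_graph_def)
  obtain \<phi>' \<mu>' where eb': "eigenbasis ?C (ising_kernel V E' J \<delta>') \<phi>' \<mu>'"
    using eigenbasis_ising_exists[OF V] by blast
  obtain \<phi> \<mu> where eb: "eigenbasis ?C (ising_kernel V E J \<delta>) \<phi> \<mu>"
    using eigenbasis_ising_exists[OF V] by blast
  have eig': "ising V E' J \<delta>' (\<phi>' i) s = \<mu>' i * \<phi>' i s" if "i < ?N" "s \<in> ?C" for i s
    using eb' that V by (auto simp: eigenbasis_def apply_kernel_ising_kernel)
  have eig: "ising V E J \<delta> (\<phi> i) s = \<mu> i * \<phi> i s" if "i < ?N" "s \<in> ?C" for i s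
    using eb that V by (auto simp: eigenbasis_def apply_kernel_ising_kernel)
  have le': "\<mu>' i \<le> M'" if "i < ?N" for i using ground_vector_top[OF G tf(1) g(1) eb' that] .
  have le: "\<mu> i \<le> M" if "i < ?N" for i using ground_vector_top[OF G2 tf(2) g(2) eb that] .
  \<comment> \<open>a shift that makes the spectrum of the doubled operator positive\<close>
  define c where "c = 1 + \<bar>M'\<bar> + \<bar>M\<bar> + (\<Sum>i<?N. \<bar>\<mu>' i\<bar>) + (\<Sum>i<?N. \<bar>\<mu> i\<bar>)"
  have sums: "(\<Sum>i<?N. \<bar>\<mu>' i\<bar>) \<ge> 0" "(\<Sum>i<?N. \<bar>\<mu> i\<bar>) \<ge> 0" by (auto intro: sum_nonneg)
  have c0: "c \<ge> 0" using sums by (simp add: c_def)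
  define L where "L = M' + M + c"
  have L: "L > 0" using sums unfolding c_def L_def by linarith
  have pos: "\<mu>' i + \<mu> j + c > 0" if "i < ?N" "j < ?N" for i j
  proof -
    have "\<bar>\<mu>' i\<bar> \<le> (\<Sum>i<?N. \<bar>\<mu>' i\<bar>)" "\<bar>\<mu> j\<bar> \<le> (\<Sum>i<?N. \<bar>\<mu> i\<bar>)"
      using that by (auto intro!: member_le_sum[of _ _ "\<lambda>i. \<bar>\<mu>' i\<bar>"] member_le_sum[of _ _ "\<lambda>i. \<bar>\<mu> i\<bar>"])
    then show ?thesis unfolding c_def by linarith
  qed
  define I where "I = {..<?N} \<times> {..<?N}"
  define a where "a = (\<lambda>p. ip ?C (\<phi>' (fst p)) (\<lambda>s. 1) * ip ?C (\<phi> (snd p)) (\<lambda>s. 1))"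
  define T where "T = pair_op V J E' \<delta>' E \<delta> c"
  have pow: "(T ^^ n) (\<lambda>s t. 1) s t
      = (\<Sum>p\<in>I. a p * (\<mu>' (fst p) + \<mu> (snd p) + c) ^ n * (\<phi>' (fst p) s * \<phi> (snd p) t))"
    if "s \<in> ?C" "t \<in> ?C" for n s t
    using that
  proof (induction n arbitrary: s t)
    case 0
    have "1 * 1 = (\<Sum>i<?N. ip ?C (\<phi>' i) (\<lambda>s. 1) * \<phi>' i s) * (\<Sum>j<?N. ip ?C (\<phi> j) (\<lambda>s. 1) * \<phi> j t)"
      using eigenbasis_expansion[OF _ eb' 0(1), of "\<lambda>s. 1"] eigenbasis_expansion[OF _ eb 0(2), of "\<lambda>s. 1"] V
      by simp
    also have "\<dots> = (\<Sum>p\<in>I. a p * (\<phi>' (fst p) s * \<phi> (snd p) t))"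
      unfolding sum_product I_def a_def sum.cartesian_product by (intro sum.cong) auto
    finally show ?case by simp
  next
    case (Suc n)
    have "(T ^^ Suc n) (\<lambda>s t. 1) s t = T (\<lambda>s t. \<Sum>p\<in>I. a p * (\<mu>' (fst p) + \<mu> (snd p) + c) ^ n * (\<phi>' (fst p) s * \<phi> (snd p) t)) s t"
      unfolding funpow.simps o_def T_def by (rule pair_op_cong) (use Suc in \<open>auto simp: T_def\<close>)
    also have "\<dots> = (\<Sum>p\<in>I. a p * (\<mu>' (fst p) + \<mu> (snd p) + c) ^ Suc n * (\<phi>' (fst p) s * \<phi> (snd p) t))"
      unfolding T_def pair_op_sum pair_op_product
      using Suc.prems by (intro sum.cong) (auto simp: I_def eig eig' algebra_simps)
    finally show ?case .
  qed
  have cone: "griffiths_cone V (\<lambda>s t. (1 / L ^ n) * (T ^^ n) (\<lambda>s t. 1) s t)" for n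
    unfolding T_def using G E J c0 d tf L V
    by (intro griffiths_cone_scale pair_op_power_griffiths_cone griffiths_cone_one) (auto simp: transverse_field_def)
  have lim: "(\<lambda>n. (1 / L ^ n) * (T ^^ n) (\<lambda>s t. 1) s t) \<longlonglongrightarrow>
      top_projection ?C \<phi>' \<mu>' M' (\<lambda>s. 1) s * top_projection ?C \<phi> \<mu> M (\<lambda>s. 1) t"
    if st: "s \<in> ?C" "t \<in> ?C" for s t
  proof -
    have "(\<lambda>n. \<Sum>p\<in>I. ((\<mu>' (fst p) + \<mu> (snd p) + c) / L) ^ n * (a p * (\<phi>' (fst p) s * \<phi> (snd p) t)))
      \<longlonglongrightarrow> (\<Sum>p\<in>I. of_bool ((\<mu>' (fst p) + \<mu> (snd p) + c) / L = 1) * (a p * (\<phi>' (fst p) s * \<phi> (snd p) t)))"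
    proof (intro tendsto_sum tendsto_mult tendsto_const power_tendsto_indicator)
      fix p assume p: "p \<in> I"
      then have "fst p < ?N" "snd p < ?N" by (auto simp: I_def)
      then show "0 < (\<mu>' (fst p) + \<mu> (snd p) + c) / L" "(\<mu>' (fst p) + \<mu> (snd p) + c) / L \<le> 1"
        using pos[of "fst p" "snd p"] le' le L by (auto simp: L_def intro: add_mono)
    qed
    moreover have "(\<Sum>p\<in>I. ((\<mu>' (fst p) + \<mu> (snd p) + c) / L) ^ n * (a p * (\<phi>' (fst p) s * \<phi> (snd p) t)))
        = (1 / L ^ n) * (T ^^ n) (\<lambda>s t. 1) s t" for n
      by (simp add: pow[OF st] sum_distrib_left power_divide mult_ac)
    moreover have "(\<Sum>p\<in>I. of_bool ((\<mu>' (fst p) + \<mu> (snd p) + c) / L = 1) * (a p * (\<phi>' (fst p) s * \<phi> (snd p) t)))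
        = top_projection ?C \<phi>' \<mu>' M' (\<lambda>s. 1) s * top_projection ?C \<phi> \<mu> M (\<lambda>s. 1) t"
    proof -
      have "((\<mu>' i + \<mu> j + c) / L = 1) \<longleftrightarrow> \<mu>' i = M' \<and> \<mu> j = M" if "i < ?N" "j < ?N" for i j
        using le'[OF that(1)] le[OF that(2)] L unfolding L_def by (auto simp: divide_eq_1_iff)
      then have "(\<Sum>p\<in>I. of_bool ((\<mu>' (fst p) + \<mu> (snd p) + c) / L = 1) * (a p * (\<phi>' (fst p) s * \<phi> (snd p) t)))
        = (\<Sum>p\<in>I. of_bool (\<mu>' (fst p) = M' \<and> \<mu> (snd p) = M) * (a p * (\<phi>' (fst p) s * \<phi> (snd p) t)))"
        by (intro sum.cong refl arg_cong2[where f = "(*)"] arg_cong[where f = of_bool])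
          (simp only: I_def mem_Times_iff lessThan_iff)
      also have "\<dots> = (\<Sum>p\<in>{i. i < ?N \<and> \<mu>' i = M'} \<times> {i. i < ?N \<and> \<mu> i = M}. a p * (\<phi>' (fst p) s * \<phi> (snd p) t))"
        by (intro sum.mono_neutral_cong_right) (auto simp: I_def)
      also have "\<dots> = top_projection ?C \<phi>' \<mu>' M' (\<lambda>s. 1) s * top_projection ?C \<phi> \<mu> M (\<lambda>s. 1) t"
        unfolding top_projection_def sum_product sum.cartesian_product a_def by (intro sum.cong) auto
      finally show ?thesis .
    qed
    ultimately show ?thesis by simp
  qed
  obtain b' b where b: "b' > 0" "b > 0"
    "\<forall>s\<in>?C. top_projection ?C \<phi>' \<mu>' M' (\<lambda>s. 1) s = b' * \<psi>' s"
    "\<forall>s\<in>?C. top_projection ?C \<phi> \<mu> M (\<lambda>s. 1) s = b * \<psi> s"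
    using top_projection_one[OF G tf(1) g(1) eb'] top_projection_one[OF G2 tf(2) g(2) eb] by blast
  have "griffiths_cone V (\<lambda>s t. top_projection ?C \<phi>' \<mu>' M' (\<lambda>s. 1) s * top_projection ?C \<phi> \<mu> M (\<lambda>s. 1) t)"
    using cone lim by (rule griffiths_cone_limit)
  then have "griffiths_cone V (\<lambda>s t. (1 / (b' * b)) * (top_projection ?C \<phi>' \<mu>' M' (\<lambda>s. 1) s * top_projection ?C \<phi> \<mu> M (\<lambda>s. 1) t))"
    using b by (intro griffiths_cone_scale) auto
  then show ?thesis
    by (rule griffiths_cone_cong) (use b in \<open>auto simp: field_simps\<close>)
qed

definition spin_mean :: "'v set \<Rightarrow> ('v config \<Rightarrow> real) \<Rightarrow> 'v set \<Rightarrow> real" where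
  "spin_mean V \<psi> B = (\<Sum>s\<in>configs V. chi B s * (\<psi> s)\<^sup>2) / (\<Sum>s\<in>configs V. (\<psi> s)\<^sup>2)"

lemma norm_pos:
  assumes "finite V" "ground_vector V E J \<delta> \<psi> M"
  shows "(\<Sum>s\<in>configs V. (\<psi> s)\<^sup>2) > 0"
  using assms by (intro sum_pos) (auto simp: ground_vector_def)

text \<open>
The function \<open>(chi B s - chi B t) \<psi>' s \<psi> t\<close> has nonnegative inner product with \<open>\<psi>' \<otimes> \<psi>\<close>; expanding it gives
the difference of the two means. The system with more edges and weaker field sits in the first copy.
\<close>

lemma spin_mean_mono_same_vertices:
  assumes G: "simple_graph V E'" and E: "E \<subseteq> E'" and J: "J \<ge> 0"
    and d: "\<And>x. x \<in> V \<Longrightarrow> \<delta>' x \<le> \<delta> x"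
    and tf: "transverse_field V \<delta>' c'" "transverse_field V \<delta> c"
    and g: "ground_vector V E' J \<delta>' \<psi>' M'" "ground_vector V E J \<delta> \<psi> M" and B: "B \<subseteq> V"
  shows "spin_mean V \<psi> B \<le> spin_mean V \<psi>' B"
proof -
  let ?C = "configs V"
  have V: "finite V" using simple_graph_finite[OF G] by auto
  have P: "griffiths_cone V (\<lambda>s t. \<psi>' s * \<psi> t)" by (rule ground_vectors_griffiths_cone[OF assms(1-8)])
  have "0 \<le> (\<Sum>s\<in>?C. \<Sum>t\<in>?C. ((1 * chi B s + (-1) * chi B t) * (\<psi>' s * \<psi> t)) * (\<psi>' s * \<psi> t))"
    using V B P by (intro griffiths_cone_inner_nonneg griffiths_cone_chi) auto
  also have "\<dots> = (\<Sum>s\<in>?C. chi B s * (\<psi>' s)\<^sup>2) * (\<Sum>t\<in>?C. (\<psi> t)\<^sup>2)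
      - (\<Sum>s\<in>?C. (\<psi>' s)\<^sup>2) * (\<Sum>t\<in>?C. chi B t * (\<psi> t)\<^sup>2)"
    unfolding sum_product by (simp add: power2_eq_square algebra_simps sum_subtractf)
  finally show ?thesis
    using norm_pos[OF V g(1)] norm_pos[OF V g(2)] by (simp add: spin_mean_def field_simps)
qed

lemma truncated_pair_griffiths_cone:
  assumes V: "finite V" "A \<subseteq> V" "B \<subseteq> V" and P: "griffiths_cone V (\<lambda>s t. \<psi> s * \<psi> t)"
  shows "griffiths_cone V (\<lambda>s t. (chi A s - chi A t) * (chi B s - chi B t) * (\<psi> s * \<psi> t))"
proof -
  have "griffiths_cone V (\<lambda>s t. (1 * chi A s + (-1) * chi A t) * ((1 * chi B s + (-1) * chi B t) * (\<psi> s * \<psi> t)))"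
    using V P by (intro griffiths_cone_chi) auto
  then show ?thesis by (rule griffiths_cone_cong) (simp add: algebra_simps)
qed

text \<open>
Twice the truncated correlation is the mean of \<open>(chi A s - chi A t) (chi B s - chi B t)\<close> in \<open>\<psi> \<otimes> \<psi>\<close>.
\<close>

lemma spin_mean_product_le:
  assumes G: "simple_graph V E" and J: "J \<ge> 0" and tf: "transverse_field V \<delta> c"
    and g: "ground_vector V E J \<delta> \<psi> M" and B: "A \<subseteq> V" "B \<subseteq> V"
  shows "spin_mean V \<psi> A * spin_mean V \<psi> B \<le> spin_mean V \<psi> (symdiff A B)"
proof -
  let ?C = "configs V"
  have V: "finite V" using simple_graph_finite[OF G] by auto
  have fin: "finite A" "finite B" using B V finite_subset by blast+
  have P: "griffiths_cone V (\<lambda>s t. \<psi> s * \<psi> t)"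
    using ground_vectors_griffiths_cone[OF G subset_refl J _ tf tf g g] by simp
  have "0 \<le> (\<Sum>s\<in>?C. \<Sum>t\<in>?C. ((chi A s - chi A t) * (chi B s - chi B t) * (\<psi> s * \<psi> t)) * (\<psi> s * \<psi> t))"
    using V B P by (intro griffiths_cone_inner_nonneg truncated_pair_griffiths_cone) auto
  also have "\<dots> = (\<Sum>s\<in>?C. \<Sum>t\<in>?C. (chi A s * chi B s * (\<psi> s)\<^sup>2) * (\<psi> t)\<^sup>2 + (\<psi> s)\<^sup>2 * (chi A t * chi B t * (\<psi> t)\<^sup>2)
       - (chi A s * (\<psi> s)\<^sup>2) * (chi B t * (\<psi> t)\<^sup>2) - (chi B s * (\<psi> s)\<^sup>2) * (chi A t * (\<psi> t)\<^sup>2))"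
    by (intro sum.cong refl) (simp add: power2_eq_square algebra_simps)
  also have "\<dots> = 2 * ((\<Sum>s\<in>?C. chi A s * chi B s * (\<psi> s)\<^sup>2) * (\<Sum>s\<in>?C. (\<psi> s)\<^sup>2)
       - (\<Sum>s\<in>?C. chi A s * (\<psi> s)\<^sup>2) * (\<Sum>s\<in>?C. chi B s * (\<psi> s)\<^sup>2))"
    unfolding sum_subtractf sum.distrib sum_product[symmetric] by (simp add: algebra_simps)
  finally have "(\<Sum>s\<in>?C. chi A s * (\<psi> s)\<^sup>2) * (\<Sum>s\<in>?C. chi B s * (\<psi> s)\<^sup>2)
      \<le> (\<Sum>s\<in>?C. chi (symdiff A B) s * (\<psi> s)\<^sup>2) * (\<Sum>s\<in>?C. (\<psi> s)\<^sup>2)"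
    by (simp add: chi_mult[OF fin])
  then show ?thesis using norm_pos[OF V g] by (simp add: spin_mean_def field_simps)
qed

definition shifted_ising where
  "shifted_ising V E J \<delta> a u s = ising V E J \<delta> u s + a * u s"

lemma shifted_ising_cong:
  assumes "\<And>s. s \<in> configs V \<Longrightarrow> u s = v s" "s \<in> configs V"
  shows "shifted_ising V E J \<delta> a u s = shifted_ising V E J \<delta> a v s"
  using ising_cong[of V u v s] assms by (simp add: shifted_ising_def)

lemma ip_shifted_ising:
  assumes "finite V"
  shows "ip (configs V) u (shifted_ising V E J \<delta> a v) = ip (configs V) (shifted_ising V E J \<delta> a u) v"
proof -
  have "ip (configs V) u (shifted_ising V E J \<delta> a v) = ip (configs V) u (ising V E J \<delta> v) + a * ip (configs V) u v"
    unfolding shifted_ising_def[abs_def] ip_add_right by (simp only: ip_scale_right)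
  also have "\<dots> = ip (configs V) (ising V E J \<delta> u) v + a * ip (configs V) u v"
    by (simp only: ip_ising[OF assms])
  also have "\<dots> = ip (configs V) (shifted_ising V E J \<delta> a u) v"
    unfolding shifted_ising_def[abs_def] ip_add_left by (simp only: ip_scale_left)
  finally show ?thesis .
qed

lemma ip_shifted_ising_power:
  assumes "finite V"
  shows "ip (configs V) u ((shifted_ising V E J \<delta> a ^^ n) v) = ip (configs V) ((shifted_ising V E J \<delta> a ^^ n) u) v"
proof (induction n arbitrary: u)
  case (Suc n)
  let ?K = "shifted_ising V E J \<delta> a"
  have "ip (configs V) u ((?K ^^ Suc n) v) = ip (configs V) (?K u) ((?K ^^ n) v)"
    by (simp add: ip_shifted_ising[OF assms])
  also have "\<dots> = ip (configs V) ((?K ^^ n) (?K u)) v" by (rule Suc)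
  also have "(?K ^^ n) (?K u) = (?K ^^ Suc n) u" by (simp add: funpow_swap1)
  finally show ?case .
qed simp

lemma shifted_ising_power_eigenvector:
  assumes "\<And>s. s \<in> configs V \<Longrightarrow> ising V E J \<delta> u s = M * u s" "s \<in> configs V"
  shows "(shifted_ising V E J \<delta> a ^^ n) u s = (M + a) ^ n * u s"
  using assms(2)
proof (induction n arbitrary: s)
  case (Suc n)
  have "(shifted_ising V E J \<delta> a ^^ Suc n) u s = shifted_ising V E J \<delta> a (\<lambda>s. (M + a) ^ n * u s) s"
    unfolding funpow.simps o_def by (rule shifted_ising_cong) (use Suc in auto)
  also have "\<dots> = (M + a) ^ Suc n * u s"
    unfolding shifted_ising_def ising_scale assms(1)[OF Suc.prems] by (simp add: algebra_simps)
  finally show ?case .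
qed simp

lemma pair_op_power_sum:
  "(pair_op V J E' \<delta>' E \<delta> c ^^ n) (\<lambda>s t. \<Sum>i\<in>I. \<Phi> i s t) s t
     = (\<Sum>i\<in>I. (pair_op V J E' \<delta>' E \<delta> c ^^ n) (\<Phi> i) s t)"
proof (induction n arbitrary: s t)
  case (Suc n)
  then have "(pair_op V J E' \<delta>' E \<delta> c ^^ n) (\<lambda>s t. \<Sum>i\<in>I. \<Phi> i s t)
     = (\<lambda>s t. \<Sum>i\<in>I. (pair_op V J E' \<delta>' E \<delta> c ^^ n) (\<Phi> i) s t)" by (intro ext)
  then show ?case by (simp add: pair_op_sum)
qed simp

lemma pair_op_power_add:
  "(pair_op V J E' \<delta>' E \<delta> c ^^ n) (\<lambda>s t. \<Phi> s t + \<Psi> s t) s t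
     = (pair_op V J E' \<delta>' E \<delta> c ^^ n) \<Phi> s t + (pair_op V J E' \<delta>' E \<delta> c ^^ n) \<Psi> s t"
  using pair_op_power_sum[of n V J E' \<delta>' E \<delta> c "\<lambda>i. if i then \<Phi> else \<Psi>" UNIV s t] by (simp add: UNIV_bool add.commute)

lemma pair_op_power_minus:
  "(pair_op V J E' \<delta>' E \<delta> c ^^ n) (\<lambda>s t. - \<Phi> s t) s t = - (pair_op V J E' \<delta>' E \<delta> c ^^ n) \<Phi> s t"
  using pair_op_power_add[of n V J E' \<delta>' E \<delta> c \<Phi> "\<lambda>s t. - \<Phi> s t" s t]
    pair_op_power_sum[of n V J E' \<delta>' E \<delta> c "\<lambda>i. \<Phi>" "{}::nat set" s t] by simp

text \<open>
Restricted to the diagonal, an operator acting on the first copy may be moved to the second one by symmetry.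
This folds two evolutions over half a time interval into one over the whole interval.
\<close>

lemma pair_op_power_diagonal:
  assumes V: "finite V"
  shows "(\<Sum>s\<in>configs V. (pair_op V J E \<delta> E \<delta> (2 * a) ^^ n) (\<lambda>s t. u s * v t) s s)
     = 2 ^ n * ip (configs V) u ((shifted_ising V E J \<delta> a ^^ n) v)"
proof (induction n arbitrary: u v)
  case 0
  then show ?case by (simp add: ip_def)
next
  case (Suc n)
  let ?K = "shifted_ising V E J \<delta> a" and ?T = "pair_op V J E \<delta> E \<delta> (2 * a)"
  have "?T (\<lambda>s t. u s * v t) = (\<lambda>s t. ?K u s * v t + u s * ?K v t)"
    using pair_op_product[of V J E \<delta> E \<delta> "2 * a" 1 u v]
    by (intro ext) (simp add: shifted_ising_def algebra_simps)
  then have "(\<Sum>s\<in>configs V. (?T ^^ Suc n) (\<lambda>s t. u s * v t) s s)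
     = 2 ^ n * ip (configs V) (?K u) ((?K ^^ n) v) + 2 ^ n * ip (configs V) u ((?K ^^ n) (?K v))"
    by (simp add: funpow_swap1 pair_op_power_add sum.distrib Suc del: funpow.simps(2) add: funpow_Suc_right)
  also have "ip (configs V) (?K u) ((?K ^^ n) v) = ip (configs V) u ((?K ^^ Suc n) v)"
    by (simp add: ip_shifted_ising[OF V])
  finally show ?case by (simp add: funpow_swap1)
qed

text \<open>
Imaginary-time correlations are largest at equal times. Folding the time axis at its midpoint turns the two
times into two copies; the inequality is the nonnegativity of the diagonal sum, that is of the coefficient
with \<open>A = D = {}\<close>, of a power of \<open>pair_op\<close> applied to
\<open>(chi A s - chi A t) (chi B s - chi B t) \<psi> s \<psi> t\<close>.
\<close>

theorem unequal_time_correlation_le: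
  assumes G: "simple_graph V E" and J: "J \<ge> 0" and tf: "transverse_field V \<delta> c"
    and g: "ground_vector V E J \<delta> \<psi> M" and B: "A \<subseteq> V" "B \<subseteq> V" and a: "a \<ge> 0"
  shows "ip (configs V) (\<lambda>s. chi A s * \<psi> s) ((shifted_ising V E J \<delta> a ^^ n) (\<lambda>s. chi B s * \<psi> s))
     \<le> (M + a) ^ n * ip (configs V) (\<lambda>s. chi A s * \<psi> s) (\<lambda>s. chi B s * \<psi> s)"
proof -
  let ?C = "configs V" and ?K = "shifted_ising V E J \<delta> a" and ?T = "pair_op V J E \<delta> E \<delta> (2 * a)"
  have V: "finite V" using simple_graph_finite[OF G] by auto
  have P: "griffiths_cone V (\<lambda>s t. \<psi> s * \<psi> t)"
    using ground_vectors_griffiths_cone[OF G subset_refl J _ tf tf g g] by simp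
  let ?A = "\<lambda>s. chi A s * \<psi> s" and ?B = "\<lambda>s. chi B s * \<psi> s" and ?AB = "\<lambda>s. chi A s * chi B s * \<psi> s"
  have "griffiths_cone V ((?T ^^ n) (\<lambda>s t. (chi A s - chi A t) * (chi B s - chi B t) * (\<psi> s * \<psi> t)))"
    using G J a tf V B P by (intro pair_op_power_griffiths_cone truncated_pair_griffiths_cone) (auto simp: transverse_field_def)
  then have "0 \<le> griffiths_coef V ((?T ^^ n) (\<lambda>s t. (chi A s - chi A t) * (chi B s - chi B t) * (\<psi> s * \<psi> t))) {} {}"
    by (simp add: griffiths_cone_def)
  also have "(\<lambda>s t. (chi A s - chi A t) * (chi B s - chi B t) * (\<psi> s * \<psi> t))
      = (\<lambda>s t. (?AB s * \<psi> t + \<psi> s * ?AB t) + (- (?A s * ?B t) + - (?B s * ?A t)))"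
    by (intro ext) (simp add: algebra_simps)
  also have "griffiths_coef V ((?T ^^ n) \<dots>) {} {} = 2 ^ n * (ip ?C ?AB ((?K ^^ n) \<psi>) + ip ?C \<psi> ((?K ^^ n) ?AB)
      - ip ?C ?A ((?K ^^ n) ?B) - ip ?C ?B ((?K ^^ n) ?A))"
    unfolding griffiths_coef_def pair_op_power_add pair_op_power_minus chi_empty mult_1 flip_empty sum.distrib sum_negf
      pair_op_power_diagonal[OF V] by (simp add: algebra_simps)
  also have "ip ?C \<psi> ((?K ^^ n) ?AB) = ip ?C ?AB ((?K ^^ n) \<psi>)"
    by (subst ip_shifted_ising_power[OF V]) (rule ip_commute)
  also have "ip ?C ?B ((?K ^^ n) ?A) = ip ?C ?A ((?K ^^ n) ?B)"
    by (subst ip_shifted_ising_power[OF V]) (rule ip_commute)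
  also have "ip ?C ?AB ((?K ^^ n) \<psi>) = (M + a) ^ n * ip ?C ?AB \<psi>"
  proof -
    have "(?K ^^ n) \<psi> s = (M + a) ^ n * \<psi> s" if "s \<in> ?C" for s
      using g that by (intro shifted_ising_power_eigenvector) (auto simp: ground_vector_def)
    then have "ip ?C ?AB ((?K ^^ n) \<psi>) = ip ?C ?AB (\<lambda>s. (M + a) ^ n * \<psi> s)"
      by (intro ip_cong) auto
    then show ?thesis by (simp only: ip_scale_right)
  qed
  also have "ip ?C ?AB \<psi> = ip ?C ?A ?B" by (simp add: ip_def mult_ac)
  finally have "0 \<le> 2 ^ n * ((M + a) ^ n * ip ?C ?A ?B + (M + a) ^ n * ip ?C ?A ?B
      - ip ?C ?A ((?K ^^ n) ?B) - ip ?C ?A ((?K ^^ n) ?B))" .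
  moreover have "\<not> (2 :: real) ^ n \<le> 0" by (simp add: not_le)
  ultimately show ?thesis by (simp add: zero_le_mult_iff)
qed

section \<open>Enlarging the graph\<close>

lemma restrict_in_configs: "V \<subseteq> V' \<Longrightarrow> s \<in> configs V' \<Longrightarrow> restrict s V \<in> configs V"
  by (auto simp: configs_def)

lemma sum_restrict:
  assumes "V \<subseteq> V'"
  shows "(\<Sum>s\<in>configs V'. f (restrict s V)) = real (card (configs (V' - V))) * (\<Sum>s\<in>configs V. f s)"
proof -
  have "(\<Sum>s\<in>configs V'. f (restrict s V)) = (\<Sum>p\<in>configs V \<times> configs (V' - V). f (fst p))"
    by (rule sum.reindex_bij_witness[of _ "\<lambda>p x. if x \<in> V then fst p x else snd p x"
          "\<lambda>s. (restrict s V, restrict s (V' - V))"])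
      (use assms in \<open>auto simp: configs_def PiE_iff extensional_def fun_eq_iff restrict_def\<close>)
  also have "\<dots> = (\<Sum>s\<in>configs V. \<Sum>t\<in>configs (V' - V). f s)"
    unfolding sum.cartesian_product by (intro sum.cong) auto
  finally show ?thesis by (simp add: sum_distrib_left)
qed

lemma chi_restrict: "B \<subseteq> V \<Longrightarrow> chi B (restrict s V) = chi B s"
  unfolding chi_def by (intro prod.cong) auto

text \<open>
An isolated spin contributes a constant factor to the ground vector and its field to the eigenvalue.
\<close>

lemma ground_vector_isolated_vertices:
  assumes G: "simple_graph V E" and V': "finite V'" "V \<subseteq> V'"
    and g: "ground_vector V E J \<delta> \<psi> M" and d: "\<And>x. x \<in> V \<Longrightarrow> \<delta>' x = \<delta> x"
  shows "ground_vector V' E J \<delta>' (\<lambda>s. \<psi> (restrict s V)) (M + (\<Sum>x\<in>V' - V. \<delta>' x))"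
  unfolding ground_vector_def
proof (intro conjI ballI)
  fix s assume s: "s \<in> configs V'"
  let ?r = "restrict s V"
  have r: "?r \<in> configs V" using restrict_in_configs[OF V'(2) s] .
  then show "\<psi> ?r > 0" using g by (simp add: ground_vector_def)
  have fl: "restrict (flip {x} s) V = (if x \<in> V then flip {x} ?r else ?r)" for x
    by (auto simp: flip_def fun_eq_iff)
  have "(\<Sum>e\<in>E. chi e s) = (\<Sum>e\<in>E. chi e ?r)"
    using G by (intro sum.cong refl chi_restrict[symmetric]) (auto simp: simple_graph_def)
  moreover have "(\<Sum>x\<in>V'. \<delta>' x * \<psi> (restrict (flip {x} s) V))
      = (\<Sum>x\<in>V. \<delta> x * \<psi> (flip {x} ?r)) + (\<Sum>x\<in>V' - V. \<delta>' x * \<psi> ?r)"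
    using V' by (subst sum.subset_diff[OF V'(2,1)]) (simp add: fl d)
  ultimately have "ising V' E J \<delta>' (\<lambda>s. \<psi> (restrict s V)) s
      = ising V E J \<delta> \<psi> ?r + (\<Sum>x\<in>V' - V. \<delta>' x) * \<psi> ?r"
    by (simp add: ising_def sum_distrib_right)
  then show "ising V' E J \<delta>' (\<lambda>s. \<psi> (restrict s V)) s = (M + (\<Sum>x\<in>V' - V. \<delta>' x)) * \<psi> ?r"
    using g r by (simp add: ground_vector_def distrib_right)
next
  show "even_fun V' (\<lambda>s. \<psi> (restrict s V))"
    unfolding even_fun_def
  proof
    fix s assume s: "s \<in> configs V'"
    have "restrict (flip V' s) V = flip V (restrict s V)"
      using V' by (auto simp: flip_def fun_eq_iff)
    then show "\<psi> (restrict (flip V' s) V) = \<psi> (restrict s V)"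
      using g restrict_in_configs[OF V'(2) s] by (simp add: ground_vector_def even_fun_def)
  qed
qed

lemma spin_mean_restrict:
  assumes "finite V'" "V \<subseteq> V'" "B \<subseteq> V"
  shows "spin_mean V' (\<lambda>s. \<psi> (restrict s V)) B = spin_mean V \<psi> B"
proof -
  have "card (configs (V' - V)) \<noteq> 0" using assms by (simp add: card_configs)
  then show ?thesis
    using sum_restrict[OF assms(2), of "\<lambda>s. chi B s * (\<psi> s)\<^sup>2"] sum_restrict[OF assms(2), of "\<lambda>s. (\<psi> s)\<^sup>2"]
    by (simp add: spin_mean_def chi_restrict[OF assms(3)])
qed

text \<open>
The smaller graph is first enlarged by isolated vertices carrying the fields of the larger one.
\<close>

theorem spin_mean_mono:
  assumes G: "simple_graph V E" "simple_graph V' E'" and sub: "V \<subseteq> V'" "E \<subseteq> E'" and J: "J \<ge> 0"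
    and d: "\<And>x. x \<in> V \<Longrightarrow> \<delta> x > 0" "\<And>x. x \<in> V \<Longrightarrow> \<delta>' x \<le> \<delta> x" and tf: "transverse_field V' \<delta>' c"
    and g: "ground_vector V E J \<delta> \<psi> M" "ground_vector V' E' J \<delta>' \<psi>' M'" and B: "B \<subseteq> V"
  shows "spin_mean V \<psi> B \<le> spin_mean V' \<psi>' B"
proof -
  have V': "finite V'" using simple_graph_finite[OF G(2)] by auto
  define \<delta>'' where "\<delta>'' = (\<lambda>x. if x \<in> V then \<delta> x else \<delta>' x)"
  have "spin_mean V' (\<lambda>s. \<psi> (restrict s V)) B \<le> spin_mean V' \<psi>' B"
  proof (rule spin_mean_mono_same_vertices[OF G(2) sub(2) J _ tf _ g(2)])
    show "ground_vector V' E J \<delta>'' (\<lambda>s. \<psi> (restrict s V)) (M + (\<Sum>x\<in>V' - V. \<delta>'' x))"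
      by (rule ground_vector_isolated_vertices[OF G(1) V' sub(1) g(1)]) (simp add: \<delta>''_def)
    show "transverse_field V' \<delta>'' c" using tf d by (auto simp: transverse_field_def \<delta>''_def less_imp_le)
  qed (use d sub B in \<open>auto simp: \<delta>''_def\<close>)
  then show ?thesis using spin_mean_restrict[OF V' sub(1) B] by simp
qed

section \<open>Fermionic modes on a chain\<close>

text \<open>
The operator \<open>\<sigma>\<^sup>(\<^sup>3\<^sup>)\<close> at \<open>x\<close> times a string of \<open>\<sigma>\<^sup>(\<^sup>1\<^sup>)\<close> over \<open>D\<close>: a Majorana fermion of the Jordan-Wigner
transformation (up to a phase) when \<open>D\<close> is the part of the chain before \<open>x\<close>, including \<open>x\<close> or not.
\<open>D = {}\<close> is the spin itself.
\<close>

definition mode :: "'v set \<Rightarrow> 'v \<Rightarrow> ('v config \<Rightarrow> real) \<Rightarrow> 'v config \<Rightarrow> real" where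
  "mode D x u s = spin (s x) * u (flip D s)"

text \<open>
The string fails to commute only with bonds crossing the boundary of \<open>D\<close>, and \<open>\<sigma>\<^sup>(\<^sup>3\<^sup>)\<close> only with the field
at \<open>x\<close>, where it adds \<open>x\<close> to the string or removes it.
\<close>

lemma mode_commutator:
  assumes V: "finite V" "x \<in> V"
  shows "ising V E J \<delta> (mode D x u) s = mode D x (ising V E J \<delta> u) s
     + J * (\<Sum>e\<in>E. chi e s - chi e (flip D s)) * mode D x u s
     - 2 * \<delta> x * mode (symdiff {x} D) x u s"
proof -
  have "(\<Sum>y\<in>V. \<delta> y * mode D x u (flip {y} s))
      = (\<Sum>y\<in>V. \<delta> y * spin (s x) * u (flip {y} (flip D s)) - (if y = x then 2 * \<delta> x * mode (symdiff {x} D) x u s else 0))"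
    by (intro sum.cong) (auto simp: mode_def flip_flip symdiff_commute flip_apply)
  also have "\<dots> = (\<Sum>y\<in>V. \<delta> y * spin (s x) * u (flip {y} (flip D s))) - 2 * \<delta> x * mode (symdiff {x} D) x u s"
    using V by (simp add: sum_subtractf)
  also have "(\<Sum>y\<in>V. \<delta> y * spin (s x) * u (flip {y} (flip D s))) = spin (s x) * (\<Sum>y\<in>V. \<delta> y * u (flip {y} (flip D s)))"
    by (simp add: sum_distrib_left mult_ac)
  finally have 1: "(\<Sum>y\<in>V. \<delta> y * mode D x u (flip {y} s)) =
    spin (s x) * (\<Sum>y\<in>V. \<delta> y * u (flip {y} (flip D s))) - 2 * \<delta> x * mode (symdiff {x} D) x u s" .
  show ?thesis
    unfolding ising_def[of V E J \<delta> "mode D x u" s] 1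
    by (simp add: mode_def ising_def sum_subtractf algebra_simps)
qed

text \<open>
Flipping \<open>D \<triangle> D'\<close> exchanges the two strings; exactly one of the two spins changes sign.
\<close>

lemma mode_orthogonal:
  assumes D: "D \<subseteq> V" "D' \<subseteq> V" and xy: "(x \<in> symdiff D D') \<noteq> (y \<in> symdiff D D')"
  shows "ip (configs V) (mode D x u) (mode D' y u) = 0"
proof -
  let ?G = "symdiff D D'"
  have "ip (configs V) (mode D x u) (mode D' y u)
      = ip (configs V) (\<lambda>s. mode D x u (flip ?G s)) (\<lambda>s. mode D' y u (flip ?G s))"
    using D by (intro ip_flip[symmetric]) simp
  also have "\<dots> = - ip (configs V) (mode D x u) (mode D' y u)"
  proof -
    have 1: "symdiff D ?G = D'" "symdiff D' ?G = D" by (auto simp: symdiff_def)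
    have "mode D x u (flip ?G s) * mode D' y u (flip ?G s) = - (mode D x u s * mode D' y u s)" for s
      using xy by (auto simp: mode_def flip_flip 1 flip_apply)
    then show ?thesis by (simp add: ip_def sum_negf)
  qed
  finally show ?thesis by simp
qed

lemma ip_mode_self:
  assumes "D \<subseteq> V"
  shows "ip (configs V) (mode D x u) (mode D x u) = ip (configs V) u u"
proof -
  have "ip (configs V) (mode D x u) (mode D x u) = ip (configs V) (\<lambda>s. u (flip D s)) (\<lambda>s. u (flip D s))"
    unfolding ip_def mode_def by (intro sum.cong) (auto simp: mult_ac)
  then show ?thesis using ip_flip[OF assms, of u u] by simp
qed

lemma abs_ip_le:
  assumes "ip C u u \<le> a" "ip C v v \<le> a"
  shows "\<bar>ip C u v\<bar> \<le> a"
proof -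
  have "0 \<le> ip C (\<lambda>s. u s + v s) (\<lambda>s. u s + v s)" "0 \<le> ip C (\<lambda>s. u s - v s) (\<lambda>s. u s - v s)"
    by (rule ip_self_nonneg)+
  then show ?thesis using assms ip_commute[of C v u]
    by (simp add: ip_add_left ip_add_right ip_diff_left ip_diff_right)
qed

lemma ip_orthogonal_sum:
  assumes "finite I" "\<And>i j. i \<in> I \<Longrightarrow> j \<in> I \<Longrightarrow> i \<noteq> j \<Longrightarrow> ip C (f i) (f j) = 0" "\<And>i. i \<in> I \<Longrightarrow> ip C (f i) (f i) = n"
  shows "ip C (\<lambda>s. \<Sum>i\<in>I. w i * f i s) (\<lambda>s. \<Sum>i\<in>I. w i * f i s) = n * (\<Sum>i\<in>I. (w i)\<^sup>2)"
proof -
  have "ip C (\<lambda>s. \<Sum>i\<in>I. w i * f i s) (\<lambda>s. \<Sum>i\<in>I. w i * f i s) = (\<Sum>i\<in>I. \<Sum>j\<in>I. w i * w j * ip C (f i) (f j))"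
    by (simp only: ip_sum_left ip_sum_right ip_scale_left ip_scale_right mult.assoc sum_distrib_left)
  also have "\<dots> = (\<Sum>i\<in>I. \<Sum>j\<in>I. if i = j then w i * w j * n else 0)"
    using assms by (intro sum.cong) auto
  also have "\<dots> = n * (\<Sum>i\<in>I. (w i)\<^sup>2)"
    using assms(1) by (simp add: sum.delta power2_eq_square sum_distrib_left mult_ac)
  finally show ?thesis .
qed

text \<open>
The chain \<open>p 0, \<dots>, p N\<close> is attached at \<open>p 0\<close> to an arbitrary graph on \<open>R\<close>. The strings below start with all of
\<open>R\<close>, so that they commute with every bond outside the chain.
\<close>

locale spin_chain =
  fixes V :: "'v set" and E E0 :: "'v set set" and R :: "'v set" and p :: "nat \<Rightarrow> 'v" and N :: nat
  assumes finite_V: "finite V"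
    and p_inj: "inj_on p {..N}"
    and p_notin_R: "\<And>i. i \<le> N \<Longrightarrow> p i \<notin> R"
    and V_eq: "V = R \<union> p ` {..N}"
    and E_eq: "E = E0 \<union> {{p i, p (Suc i)} |i. i < N}"
    and E0: "\<And>e. e \<in> E0 \<Longrightarrow> e \<subseteq> insert (p 0) R \<and> card e = 2"
begin

definition seg :: "nat \<Rightarrow> 'v set" where
  "seg i = R \<union> p ` {..<i}"

lemma p_eq_iff: "i \<le> N \<Longrightarrow> j \<le> N \<Longrightarrow> p i = p j \<longleftrightarrow> i = j"
  using p_inj by (auto simp: inj_on_def)

lemma p_in_V: "i \<le> N \<Longrightarrow> p i \<in> V" by (auto simp: V_eq)

lemma p_in_seg: "i \<le> N \<Longrightarrow> j \<le> Suc N \<Longrightarrow> p i \<in> seg j \<longleftrightarrow> i < j"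
  using p_notin_R p_eq_iff by (fastforce simp: seg_def)

lemma seg_subset: "i \<le> Suc N \<Longrightarrow> seg i \<subseteq> V"
  by (auto simp: seg_def V_eq)

lemma seg_0: "seg 0 = R" by (simp add: seg_def)

lemma seg_last: "seg (Suc N) = V"
  by (simp add: seg_def V_eq lessThan_Suc_atMost)

lemma seg_Suc: "seg (Suc i) = insert (p i) (seg i)"
  by (auto simp: seg_def lessThan_Suc)

lemma symdiff_seg:
  assumes "i \<le> N"
  shows "symdiff {p i} (seg i) = seg (Suc i)" "symdiff {p i} (seg (Suc i)) = seg i"
proof -
  have "p i \<notin> seg i" using p_in_seg[of i i] assms by simp
  then show "symdiff {p i} (seg i) = seg (Suc i)" "symdiff {p i} (seg (Suc i)) = seg i"
    by (auto simp: symdiff_def seg_Suc)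
qed

lemma simple_graph_chain: "simple_graph V E"
proof -
  have "e \<subseteq> V \<and> card e = 2" if "e \<in> E" for e
  proof (cases "e \<in> E0")
    case True
    then show ?thesis using E0[OF True] by (auto simp: V_eq)
  next
    case False
    then obtain i where "e = {p i, p (Suc i)}" "i < N" using \<open>e \<in> E\<close> by (auto simp: E_eq)
    then show ?thesis using p_eq_iff[of i "Suc i"] by (auto simp: V_eq)
  qed
  then show ?thesis using finite_V by (simp add: simple_graph_def)
qed

lemma bond_crossing_sum:
  assumes i: "i \<le> N"
  shows "(\<Sum>e\<in>E. chi e s - chi e (flip (seg (Suc i)) s))
     = (if i < N then 2 * (spin (s (p i)) * spin (s (p (Suc i)))) else 0)"
proof -
  let ?D = "seg (Suc i)"
  have finE: "finite E" using simple_graph_finite[OF simple_graph_chain] by auto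
  have fin: "finite e" if "e \<in> E" for e
    using simple_graph_chain that by (auto simp: simple_graph_def intro: card_ge_0_finite)
  have bond: "chi {p j, p (Suc j)} s - chi {p j, p (Suc j)} (flip ?D s)
      = (if i = j then 2 * (spin (s (p i)) * spin (s (p (Suc i)))) else 0)" if "j < N" for j
    using that i p_eq_iff[of j "Suc j"] p_in_seg[of j "Suc i"] p_in_seg[of "Suc j" "Suc i"]
    by (auto simp: chi_def flip_apply)
  have zero: "chi e s - chi e (flip ?D s) = 0" if e: "e \<in> E" "\<not> (i < N \<and> e = {p i, p (Suc i)})" for e
  proof (cases "e \<in> E0")
    case True
    have "p 0 \<in> ?D" "R \<subseteq> ?D" using i p_in_seg[of 0 "Suc i"] by (auto simp: seg_def)
    then have "e \<inter> ?D = e" "card e = 2" using E0[OF True] by auto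
    then show ?thesis using fin[OF e(1)] by (simp add: chi_flip)
  next
    case False
    then obtain j where "e = {p j, p (Suc j)}" "j < N" using e by (auto simp: E_eq)
    then show ?thesis using bond[of j] e(2) by (auto split: if_splits)
  qed
  show ?thesis
  proof (cases "i < N")
    case True
    then have "{p i, p (Suc i)} \<in> E" by (auto simp: E_eq)
    then have "(\<Sum>e\<in>E. chi e s - chi e (flip ?D s)) = (\<Sum>e\<in>{{p i, p (Suc i)}}. chi e s - chi e (flip ?D s))"
      using zero finE by (intro sum.mono_neutral_right) auto
    then show ?thesis using bond[OF True] True by simp
  next
    case False
    then show ?thesis using zero by (simp add: sum.neutral)
  qed
qed

definition amode :: "nat \<Rightarrow> ('v config \<Rightarrow> real) \<Rightarrow> 'v config \<Rightarrow> real" where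
  "amode i = mode (seg i) (p i)"

definition bmode :: "nat \<Rightarrow> ('v config \<Rightarrow> real) \<Rightarrow> 'v config \<Rightarrow> real" where
  "bmode i = mode (seg (Suc i)) (p i)"

text \<open>
Commutation with the Ising operator maps the span of all \<open>A\<^sub>i\<close> and \<open>B\<^sub>i\<close> to itself, with only
neighbouring indices coupled: the chain is a model of free fermions.
\<close>

lemma ising_bmode:
  assumes i: "i \<le> N"
  shows "ising V E J \<delta> (bmode i u) s = bmode i (ising V E J \<delta> u) s
     + (if i < N then 2 * J * amode (Suc i) u s else 0) - 2 * \<delta> (p i) * amode i u s"
  unfolding bmode_def mode_commutator[OF finite_V p_in_V[OF i]] bond_crossing_sum[OF i] symdiff_seg(2)[OF i]
  by (cases "i < N") (simp_all add: amode_def mode_def)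

lemma ising_amode:
  assumes i: "i \<le> N" and R: "R = {}"
  shows "ising V E J \<delta> (amode i u) s = amode i (ising V E J \<delta> u) s
     + (if 0 < i then 2 * J * bmode (i - 1) u s else 0) - 2 * \<delta> (p i) * bmode i u s"
proof (cases i)
  case 0
  have "seg i = {}" using seg_0 R 0 by metis
  then have "(\<Sum>e\<in>E. chi e s - chi e (flip (seg i) s)) = 0" by simp
  then show ?thesis
    unfolding amode_def mode_commutator[OF finite_V p_in_V[OF i]] symdiff_seg(1)[OF i] bmode_def
    by (simp add: 0)
next
  case (Suc j)
  then have "j < N" "j \<le> N" using i by auto
  then show ?thesis
    unfolding amode_def mode_commutator[OF finite_V p_in_V[OF i]] symdiff_seg(1)[OF i]
    by (simp add: Suc bond_crossing_sum bmode_def mode_def)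
qed

lemma amode_orthogonal:
  assumes "i \<le> N" "j \<le> N" "i \<noteq> j"
  shows "ip (configs V) (amode i u) (amode j u) = 0"
  unfolding amode_def using assms
  by (intro mode_orthogonal seg_subset) (cases i j rule: linorder_cases; simp add: symdiff_def p_in_seg)+

lemma bmode_orthogonal:
  assumes "i \<le> N" "j \<le> N" "i \<noteq> j"
  shows "ip (configs V) (bmode i u) (bmode j u) = 0"
  unfolding bmode_def using assms
  by (intro mode_orthogonal seg_subset) (cases i j rule: linorder_cases; simp add: symdiff_def p_in_seg)+

lemma ip_amode_self: "i \<le> N \<Longrightarrow> ip (configs V) (amode i u) (amode i u) = ip (configs V) u u"
  unfolding amode_def by (intro ip_mode_self seg_subset) auto

lemma ip_bmode_self: "i \<le> N \<Longrightarrow> ip (configs V) (bmode i u) (bmode i u) = ip (configs V) u u"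
  unfolding bmode_def by (intro ip_mode_self seg_subset) auto

lemma mode_of_eigenvector:
  assumes "D \<subseteq> V" "\<And>s. s \<in> configs V \<Longrightarrow> w s = M * u s" "s \<in> configs V"
  shows "mode D x w s = M * mode D x u s"
  using assms by (simp add: mode_def)

subsection \<open>Weak coupling: decay from a frozen end\<close>

text \<open>
The coefficients of the zero mode \<open>b\<close> solve \<open>w\<^sub>i\<^sub>+\<^sub>1 h = w\<^sub>i J\<close>; the boundary term at \<open>p 0\<close> is absent since the
field vanishes there. Being odd, \<open>b \<psi>\<close> becomes even after multiplication by the spin at \<open>p 0\<close>, which also
commutes with the operator, so \<open>b \<psi>\<close> is a multiple \<open>\<kappa>\<close> of that spin applied to \<open>\<psi>\<close>. Its norm gives
\<open>\<kappa>\<^sup>2 = \<Sum>\<^sub>i r\<^sup>2\<^sup>i \<ge> 1\<close>, and its inner product with the spin at \<open>p m\<close> only sees the modes with \<open>i \<ge> m\<close>.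
\<close>

theorem frozen_end_correlation_le:
  assumes J: "J > 0" and h: "J < h" and d0: "\<delta> (p 0) = 0" and d: "\<And>i. 0 < i \<Longrightarrow> i \<le> N \<Longrightarrow> \<delta> (p i) = h"
    and tf: "transverse_field V \<delta> (p 0)" and g: "ground_vector V E J \<delta> \<psi> M" and m: "m \<le> N"
  shows "ip (configs V) (mode {} (p m) \<psi>) (mode {} (p 0) \<psi>) \<le> (J / h) ^ m / (1 - J / h) * ip (configs V) \<psi> \<psi>"
proof -
  let ?C = "configs V"
  define r where "r = J / h"
  have r: "0 < r" "r < 1" "r * h = J" using J h by (auto simp: r_def)
  have eig: "ising V E J \<delta> \<psi> s = M * \<psi> s" if "s \<in> ?C" for s using g that by (simp add: ground_vector_def)
  have ev: "\<psi> (flip V s) = \<psi> s" if "s \<in> ?C" for s using g that by (simp add: ground_vector_def even_fun_def)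
  define b where "b = (\<lambda>s. \<Sum>i\<le>N. r ^ i * bmode i \<psi> s)"
  have bb: "ip ?C b b = ip ?C \<psi> \<psi> * (\<Sum>i\<le>N. (r ^ i)\<^sup>2)"
    unfolding b_def by (intro ip_orthogonal_sum) (auto intro: bmode_orthogonal ip_bmode_self)
  have beig: "ising V E J \<delta> b s = M * b s" if s: "s \<in> ?C" for s
  proof -
    have "ising V E J \<delta> b s = (\<Sum>i\<le>N. r ^ i * ising V E J \<delta> (bmode i \<psi>) s)"
      unfolding b_def by (simp only: ising_sum ising_scale)
    also have "\<dots> = (\<Sum>i\<le>N. M * (r ^ i * bmode i \<psi> s)
        + ((if i < N then 2 * J * r ^ i * amode (Suc i) \<psi> s else 0)
          - (if 0 < i then 2 * h * r ^ i * amode i \<psi> s else 0)))"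
    proof (intro sum.cong refl)
      fix i assume i: "i \<in> {..N}"
      have "bmode i (ising V E J \<delta> \<psi>) s = M * bmode i \<psi> s"
        unfolding bmode_def using i s eig by (intro mode_of_eigenvector seg_subset) auto
      then show "r ^ i * ising V E J \<delta> (bmode i \<psi>) s = M * (r ^ i * bmode i \<psi> s)
        + ((if i < N then 2 * J * r ^ i * amode (Suc i) \<psi> s else 0)
          - (if 0 < i then 2 * h * r ^ i * amode i \<psi> s else 0))"
        using i d0 d[of i] by (cases "i = 0") (auto simp: ising_bmode algebra_simps)
    qed
    also have "\<dots> = M * b s + ((\<Sum>i\<le>N. if i < N then 2 * J * r ^ i * amode (Suc i) \<psi> s else 0)
        - (\<Sum>i\<le>N. if 0 < i then 2 * h * r ^ i * amode i \<psi> s else 0))"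
      by (simp add: sum.distrib sum_subtractf b_def sum_distrib_left)
    also have "(\<Sum>i\<le>N. if i < N then 2 * J * r ^ i * amode (Suc i) \<psi> s else 0) = (\<Sum>i<N. 2 * J * r ^ i * amode (Suc i) \<psi> s)"
      by (intro sum.mono_neutral_cong_right) auto
    also have "(\<Sum>i\<le>N. if 0 < i then 2 * h * r ^ i * amode i \<psi> s else 0) = (\<Sum>i<N. 2 * h * r ^ Suc i * amode (Suc i) \<psi> s)"
      by (subst sum.atMost_shift) simp
    also have "\<dots> = (\<Sum>i<N. 2 * J * r ^ i * amode (Suc i) \<psi> s)"
      using r(3) by (intro sum.cong) (auto simp: mult_ac)
    finally show ?thesis by simp
  qed
  define f where "f = mode {} (p 0) b"
  have feig: "ising V E J \<delta> f s = M * f s" if s: "s \<in> ?C" for s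
    using mode_commutator[OF finite_V p_in_V[of 0], of E J \<delta> "{}" b s] d0
      mode_of_eigenvector[of "{}" "ising V E J \<delta> b" M b s "p 0"] beig s by (simp add: f_def)
  have "f (flip V s) = f s" if s: "s \<in> ?C" for s
  proof -
    have "bmode i \<psi> (flip V s) = - bmode i \<psi> s" if i: "i \<le> N" for i
    proof -
      have "\<psi> (flip V (flip (seg (Suc i)) s)) = \<psi> (flip (seg (Suc i)) s)"
        using s i by (intro ev flip_in_configs seg_subset) auto
      then show ?thesis using p_in_V[OF i]
        by (simp add: bmode_def mode_def flip_flip symdiff_commute flip_apply)
    qed
    then show ?thesis using p_in_V[of 0]
      by (simp add: f_def mode_def b_def sum_negf flip_apply)
  qed
  then have "even_fun V f" by (simp add: even_fun_def)
  then obtain \<kappa> where \<kappa>: "\<forall>s\<in>?C. f s = \<kappa> * \<psi> s"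
    using eigenvector_unique[OF finite_V tf _ g feig] by blast
  have b_eq: "b s = \<kappa> * mode {} (p 0) \<psi> s" if "s \<in> ?C" for s
  proof -
    have "spin (s (p 0)) * f s = b s" by (simp add: f_def mode_def)
    then show ?thesis using \<kappa> that by (simp add: mode_def mult_ac)
  qed
  have npos: "ip ?C \<psi> \<psi> > 0"
    using norm_pos[OF finite_V g] by (simp add: ip_def power2_eq_square)
  have "ip ?C b b = \<kappa>\<^sup>2 * ip ?C \<psi> \<psi>"
  proof -
    have "ip ?C b b = ip ?C (\<lambda>s. \<kappa> * mode {} (p 0) \<psi> s) (\<lambda>s. \<kappa> * mode {} (p 0) \<psi> s)"
      using b_eq by (intro ip_cong) auto
    then show ?thesis by (simp add: ip_scale_left ip_scale_right ip_mode_self power2_eq_square)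
  qed
  then have "\<kappa>\<^sup>2 = (\<Sum>i\<le>N. (r ^ i)\<^sup>2)" using bb npos by simp
  also have "\<dots> \<ge> (\<Sum>i\<in>{0}. (r ^ i)\<^sup>2)" by (intro sum_mono2) auto
  finally have k1: "1 \<le> \<bar>\<kappa>\<bar>" using abs_le_square_iff[of 1 \<kappa>] by simp
  have "\<kappa> * ip ?C (mode {} (p m) \<psi>) (mode {} (p 0) \<psi>) = ip ?C (mode {} (p m) \<psi>) b"
    using b_eq by (simp add: ip_scale_right[symmetric] cong: ip_cong)
  also have "\<dots> = (\<Sum>i\<le>N. r ^ i * ip ?C (mode {} (p m) \<psi>) (bmode i \<psi>))"
    unfolding b_def by (simp only: ip_sum_right ip_scale_right)
  finally have "\<bar>\<kappa>\<bar> * \<bar>ip ?C (mode {} (p m) \<psi>) (mode {} (p 0) \<psi>)\<bar>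
      = \<bar>\<Sum>i\<le>N. r ^ i * ip ?C (mode {} (p m) \<psi>) (bmode i \<psi>)\<bar>" by (simp flip: abs_mult)
  also have "\<dots> \<le> (\<Sum>i\<le>N. \<bar>r ^ i * ip ?C (mode {} (p m) \<psi>) (bmode i \<psi>)\<bar>)" by (rule sum_abs)
  also have "\<dots> \<le> (\<Sum>i\<le>N. if m \<le> i then r ^ i * ip ?C \<psi> \<psi> else 0)"
  proof (intro sum_mono)
    fix i assume i: "i \<in> {..N}"
    show "\<bar>r ^ i * ip ?C (mode {} (p m) \<psi>) (bmode i \<psi>)\<bar> \<le> (if m \<le> i then r ^ i * ip ?C \<psi> \<psi> else 0)"
    proof (cases "m \<le> i")
      case True
      have "\<bar>ip ?C (mode {} (p m) \<psi>) (bmode i \<psi>)\<bar> \<le> ip ?C \<psi> \<psi>"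
        using i by (intro abs_ip_le) (auto simp: ip_mode_self ip_bmode_self)
      then show ?thesis using True r by (simp add: abs_mult mult_left_mono)
    next
      case False
      then have "ip ?C (mode {} (p m) \<psi>) (bmode i \<psi>) = 0"
        unfolding bmode_def using i m
        by (intro mode_orthogonal seg_subset) (auto simp: symdiff_def p_in_seg)
      then show ?thesis using False by simp
    qed
  qed
  also have "\<dots> = (\<Sum>i=m..N. r ^ i) * ip ?C \<psi> \<psi>"
    unfolding sum_distrib_right by (intro sum.mono_neutral_cong_right) auto
  also have "\<dots> \<le> r ^ m / (1 - r) * ip ?C \<psi> \<psi>"
  proof (intro mult_right_mono)
    have "(\<Sum>i=m..N. r ^ i) = (r ^ m - r ^ Suc N) / (1 - r)"
      using r m by (subst sum_gp) auto
    also have "\<dots> \<le> r ^ m / (1 - r)" using r by (intro divide_right_mono) auto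
    finally show "(\<Sum>i=m..N. r ^ i) \<le> r ^ m / (1 - r)" .
  qed (use npos in auto)
  finally have "\<bar>\<kappa>\<bar> * \<bar>ip ?C (mode {} (p m) \<psi>) (mode {} (p 0) \<psi>)\<bar> \<le> r ^ m / (1 - r) * ip ?C \<psi> \<psi>" .
  moreover have "1 * \<bar>ip ?C (mode {} (p m) \<psi>) (mode {} (p 0) \<psi>)\<bar> \<le> \<bar>\<kappa>\<bar> * \<bar>ip ?C (mode {} (p m) \<psi>) (mode {} (p 0) \<psi>)\<bar>"
    using k1 by (intro mult_right_mono) auto
  ultimately show ?thesis by (simp add: r_def)
qed

subsection \<open>Strong coupling: correlation of the two ends\<close>

text \<open>
Let \<open>L\<close> be the top eigenvalue of the shifted operator \<open>K + a\<close>, where \<open>a\<close> makes the spectrum nonnegative, and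
\<open>P = (K + a) / L\<close>. Telescoping \<open>(1 - P) \<alpha> = (\<epsilon> / L) \<sigma>\<^sub>N \<psi>\<close> gives
\<open>\<langle>\<sigma>\<^sub>0 \<psi>, \<alpha>\<rangle> - \<langle>\<sigma>\<^sub>0 \<psi>, P\<^sup>T \<alpha>\<rangle> \<le> (\<epsilon> / L) T g0\<close> by the unequal-time inequality, with \<open>g0 = \<langle>\<sigma>\<^sub>0 \<psi>, \<sigma>\<^sub>N \<psi>\<rangle>\<close>.
Here \<open>\<langle>\<sigma>\<^sub>0 \<psi>, \<alpha>\<rangle> = \<parallel>\<psi>\<parallel>\<^sup>2\<close>, while
\<open>\<langle>\<sigma>\<^sub>0 \<psi>, P\<^sup>T \<alpha>\<rangle> = (L / \<epsilon>) \<langle>\<beta>, (1 - P) P\<^sup>T \<alpha>\<rangle> \<le> (L / \<epsilon>) Q \<parallel>\<psi>\<parallel>\<^sup>2 / (T + 1)\<close>, where \<open>Q \<parallel>\<psi>\<parallel>\<^sup>2\<close> is the squared norm of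
both \<open>\<alpha>\<close> and \<open>\<beta>\<close>, because \<open>(1 - x) x\<^sup>T \<le> 1 / (T + 1)\<close> on the unit interval. A time \<open>T\<close> near \<open>2 Q L / \<epsilon>\<close> makes the second term
at most \<open>\<parallel>\<psi>\<parallel>\<^sup>2 / 2\<close>, and \<open>g0 \<ge> \<parallel>\<psi>\<parallel>\<^sup>2 / (4 Q)\<close> follows.
\<close>

theorem end_to_end_correlation_ge:
  assumes h: "0 < h" "h < J" and R: "R = {}" and d: "\<And>i. i \<le> N \<Longrightarrow> \<delta> (p i) = h"
    and g: "ground_vector V E J \<delta> \<psi> M"
  shows "(1 - (h / J)\<^sup>2) / 4 * ip (configs V) \<psi> \<psi> \<le> ip (configs V) (mode {} (p 0) \<psi>) (mode {} (p N) \<psi>)"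
proof -
  let ?C = "configs V"
  define q where "q = h / J"
  have q: "0 < q" "q < 1" "q * J = h" using h by (auto simp: q_def)
  have J: "J > 0" using h by simp
  define \<epsilon> where "\<epsilon> = 2 * h * q ^ N"
  have \<epsilon>: "\<epsilon> > 0" using h q by (simp add: \<epsilon>_def)
  have eig: "ising V E J \<delta> \<psi> s = M * \<psi> s" if "s \<in> ?C" for s using g that by (simp add: ground_vector_def)
  have ev: "\<psi> (flip V s) = \<psi> s" if "s \<in> ?C" for s using g that by (simp add: ground_vector_def even_fun_def)
  have npos: "ip ?C \<psi> \<psi> > 0"
    using norm_pos[OF finite_V g] by (simp add: ip_def power2_eq_square)
  have tf: "transverse_field V \<delta> (p 0)" using d h R by (auto simp: transverse_field_def V_eq)
  have seg0: "seg 0 = {}" by (rule trans[OF seg_0 R])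
  define \<alpha> where "\<alpha> = (\<lambda>s. \<Sum>i\<le>N. q ^ i * amode i \<psi> s)"
  define \<beta> where "\<beta> = (\<lambda>s. \<Sum>i\<le>N. q ^ (N - i) * bmode i \<psi> s)"
  define Q where "Q = (\<Sum>i\<le>N. (q ^ i)\<^sup>2)"
  have aa: "ip ?C \<alpha> \<alpha> = ip ?C \<psi> \<psi> * Q"
    unfolding \<alpha>_def Q_def by (intro ip_orthogonal_sum) (auto intro: amode_orthogonal ip_amode_self)
  have "ip ?C \<beta> \<beta> = ip ?C \<psi> \<psi> * (\<Sum>i\<le>N. (q ^ (N - i))\<^sup>2)"
    unfolding \<beta>_def by (intro ip_orthogonal_sum) (auto intro: bmode_orthogonal ip_bmode_self)
  also have "(\<Sum>i\<le>N. (q ^ (N - i))\<^sup>2) = Q"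
    unfolding Q_def by (rule sum.reindex_bij_witness[of _ "\<lambda>i. N - i" "\<lambda>i. N - i"]) auto
  finally have bb: "ip ?C \<beta> \<beta> = ip ?C \<psi> \<psi> * Q" .
  have ameig: "amode i (ising V E J \<delta> \<psi>) s = M * amode i \<psi> s" if "i \<le> N" "s \<in> ?C" for i s
    unfolding amode_def using that eig by (intro mode_of_eigenvector seg_subset) auto
  have bmeig: "bmode i (ising V E J \<delta> \<psi>) s = M * bmode i \<psi> s" if "i \<le> N" "s \<in> ?C" for i s
    unfolding bmode_def using that eig by (intro mode_of_eigenvector seg_subset) auto
  have aeq: "ising V E J \<delta> \<alpha> s = M * \<alpha> s - \<epsilon> * mode {} (p N) \<psi> s" if s: "s \<in> ?C" for s
  proof -
    have "ising V E J \<delta> \<alpha> s = (\<Sum>i\<le>N. q ^ i * ising V E J \<delta> (amode i \<psi>) s)"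
      unfolding \<alpha>_def by (simp only: ising_sum ising_scale)
    also have "\<dots> = (\<Sum>i\<le>N. M * (q ^ i * amode i \<psi> s)
        + ((if 0 < i then 2 * J * q ^ i * bmode (i - 1) \<psi> s else 0) - 2 * h * q ^ i * bmode i \<psi> s))"
      using s by (intro sum.cong refl) (auto simp: ising_amode[OF _ R] ameig d algebra_simps)
    also have "\<dots> = M * \<alpha> s + ((\<Sum>i\<le>N. if 0 < i then 2 * J * q ^ i * bmode (i - 1) \<psi> s else 0)
        - (\<Sum>i\<le>N. 2 * h * q ^ i * bmode i \<psi> s))"
      by (simp add: sum.distrib sum_subtractf \<alpha>_def sum_distrib_left)
    also have "(\<Sum>i\<le>N. if 0 < i then 2 * J * q ^ i * bmode (i - 1) \<psi> s else 0) = (\<Sum>i<N. 2 * J * q ^ Suc i * bmode i \<psi> s)"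
      by (subst sum.atMost_shift) simp
    also have "\<dots> = (\<Sum>i<N. 2 * h * q ^ i * bmode i \<psi> s)"
      using q(3) by (intro sum.cong) (auto simp: mult_ac)
    also have "(\<Sum>i\<le>N. 2 * h * q ^ i * bmode i \<psi> s) = (\<Sum>i<N. 2 * h * q ^ i * bmode i \<psi> s) + \<epsilon> * bmode N \<psi> s"
      by (simp add: \<epsilon>_def flip: lessThan_Suc_atMost)
    \<comment> \<open>the string of \<open>B\<^sub>N\<close> covers the whole chain and acts trivially on the even vector \<open>\<psi>\<close>\<close>
    also have "bmode N \<psi> s = mode {} (p N) \<psi> s"
      by (simp add: bmode_def mode_def seg_last ev[OF s])
    finally show ?thesis by simp
  qed
  have beq: "ising V E J \<delta> \<beta> s = M * \<beta> s - \<epsilon> * mode {} (p 0) \<psi> s" if s: "s \<in> ?C" for s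
  proof -
    have "ising V E J \<delta> \<beta> s = (\<Sum>i\<le>N. q ^ (N - i) * ising V E J \<delta> (bmode i \<psi>) s)"
      unfolding \<beta>_def by (simp only: ising_sum ising_scale)
    also have "\<dots> = (\<Sum>i\<le>N. M * (q ^ (N - i) * bmode i \<psi> s)
        + ((if i < N then 2 * J * q ^ (N - i) * amode (Suc i) \<psi> s else 0) - 2 * h * q ^ (N - i) * amode i \<psi> s))"
      using s by (intro sum.cong refl) (auto simp: ising_bmode bmeig d algebra_simps)
    also have "\<dots> = M * \<beta> s + ((\<Sum>i\<le>N. if i < N then 2 * J * q ^ (N - i) * amode (Suc i) \<psi> s else 0)
        - (\<Sum>i\<le>N. 2 * h * q ^ (N - i) * amode i \<psi> s))"
      by (simp add: sum.distrib sum_subtractf \<beta>_def sum_distrib_left)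
    also have "(\<Sum>i\<le>N. if i < N then 2 * J * q ^ (N - i) * amode (Suc i) \<psi> s else 0)
        = (\<Sum>i<N. 2 * J * q ^ (N - i) * amode (Suc i) \<psi> s)"
      by (intro sum.mono_neutral_cong_right) auto
    also have "\<dots> = (\<Sum>i<N. 2 * h * q ^ (N - Suc i) * amode (Suc i) \<psi> s)"
    proof (intro sum.cong refl)
      fix i assume "i \<in> {..<N}"
      then have "N - i = Suc (N - Suc i)" by auto
      then show "2 * J * q ^ (N - i) * amode (Suc i) \<psi> s = 2 * h * q ^ (N - Suc i) * amode (Suc i) \<psi> s"
        using q(3) by (auto simp: mult_ac)
    qed
    also have "(\<Sum>i\<le>N. 2 * h * q ^ (N - i) * amode i \<psi> s) = \<epsilon> * amode 0 \<psi> s + (\<Sum>i<N. 2 * h * q ^ (N - Suc i) * amode (Suc i) \<psi> s)"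
      by (subst sum.atMost_shift) (simp add: \<epsilon>_def)
    also have "amode 0 \<psi> s = mode {} (p 0) \<psi> s" by (simp add: amode_def seg0)
    finally show ?thesis by simp
  qed
  have za: "ip ?C (mode {} (p 0) \<psi>) \<alpha> = ip ?C \<psi> \<psi>"
  proof -
    have "ip ?C (mode {} (p 0) \<psi>) \<alpha> = (\<Sum>i\<le>N. q ^ i * ip ?C (amode 0 \<psi>) (amode i \<psi>))"
      unfolding \<alpha>_def by (simp only: ip_sum_right ip_scale_right amode_def seg0)
    also have "\<dots> = (\<Sum>i\<le>N. if i = 0 then ip ?C \<psi> \<psi> else 0)"
      by (intro sum.cong refl) (auto simp: ip_amode_self amode_orthogonal)
    finally show ?thesis by simp
  qed
  obtain \<phi> \<mu> where eb: "eigenbasis ?C (ising_kernel V E J \<delta>) \<phi> \<mu>"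
    using eigenbasis_ising_exists[OF finite_V] by blast
  have phi: "ising V E J \<delta> (\<phi> i) s = \<mu> i * \<phi> i s" if "i < card ?C" "s \<in> ?C" for i s
    using eb that finite_V by (auto simp: eigenbasis_def apply_kernel_ising_kernel)
  have le: "\<mu> i \<le> M" if "i < card ?C" for i
    using ground_vector_top[OF simple_graph_chain tf g eb that] .
  \<comment> \<open>a shift that makes the spectrum nonnegative\<close>
  define a where "a = 1 + \<bar>M\<bar> + (\<Sum>i<card ?C. \<bar>\<mu> i\<bar>)"
  have sa: "(\<Sum>i<card ?C. \<bar>\<mu> i\<bar>) \<ge> 0" by (auto intro: sum_nonneg)
  have a0: "a \<ge> 0" using sa by (simp add: a_def)
  define L where "L = M + a"
  have L: "L > 0" using sa unfolding L_def a_def by linarith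
  have x0: "\<mu> i + a \<ge> 0" if "i < card ?C" for i
  proof -
    have "\<bar>\<mu> i\<bar> \<le> (\<Sum>i<card ?C. \<bar>\<mu> i\<bar>)"
      using that by (auto intro!: member_le_sum[of _ _ "\<lambda>i. \<bar>\<mu> i\<bar>"])
    then show ?thesis unfolding a_def by linarith
  qed
  have xL: "\<mu> i + a \<le> L" if "i < card ?C" for i using le[OF that] by (simp add: L_def)
  let ?K = "shifted_ising V E J \<delta> a"
  define g0 where "g0 = ip ?C (mode {} (p 0) \<psi>) (mode {} (p N) \<psi>)"
  define ta where "ta = (\<lambda>n. ip ?C (mode {} (p 0) \<psi>) ((?K ^^ n) \<alpha>))"
  have gn: "ip ?C (mode {} (p 0) \<psi>) ((?K ^^ n) (mode {} (p N) \<psi>)) \<le> L ^ n * g0" for n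
  proof -
    have m: "(\<lambda>s. chi {x} s * \<psi> s) = mode {} x \<psi>" for x by (simp add: mode_def fun_eq_iff)
    show ?thesis
      using unequal_time_correlation_le[OF simple_graph_chain _ tf g, of "{p 0}" "{p N}" a n] J a0 p_in_V[of 0] p_in_V[of N]
      unfolding m by (simp add: g0_def L_def)
  qed
  \<comment> \<open>one telescoping step; multiplication by powers of \<open>L\<close> avoids dividing by it\<close>
  have step: "ta (Suc n) \<ge> L * ta n - \<epsilon> * (L ^ n * g0)" for n
  proof -
    have "ta (Suc n) = ip ?C ((?K ^^ n) (mode {} (p 0) \<psi>)) (?K \<alpha>)"
      unfolding ta_def by (simp add: funpow_swap1 ip_shifted_ising_power[OF finite_V])
    also have "\<dots> = ip ?C ((?K ^^ n) (mode {} (p 0) \<psi>)) (\<lambda>s. L * \<alpha> s - \<epsilon> * mode {} (p N) \<psi> s)"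
      using aeq by (intro ip_cong) (auto simp: shifted_ising_def L_def algebra_simps)
    also have "\<dots> = L * ta n - \<epsilon> * ip ?C (mode {} (p 0) \<psi>) ((?K ^^ n) (mode {} (p N) \<psi>))"
      unfolding ip_diff_right ip_scale_right ta_def ip_shifted_ising_power[OF finite_V] ..
    finally show ?thesis using gn[of n] \<epsilon> by simp
  qed
  have lower: "L * ta n \<ge> L ^ n * (L * ip ?C \<psi> \<psi> - real n * \<epsilon> * g0)" for n
  proof (induction n)
    case 0
    then show ?case by (simp add: ta_def za)
  next
    case (Suc n)
    have "L ^ Suc n * (L * ip ?C \<psi> \<psi> - real (Suc n) * \<epsilon> * g0)
        = L * (L ^ n * (L * ip ?C \<psi> \<psi> - real n * \<epsilon> * g0)) - L * (\<epsilon> * (L ^ n * g0))"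
      by (simp add: algebra_simps)
    also have "\<dots> \<le> L * (L * ta n) - L * (\<epsilon> * (L ^ n * g0))"
      using Suc L by (intro diff_right_mono mult_left_mono) auto
    also have "\<dots> = L * (L * ta n - \<epsilon> * (L ^ n * g0))" by (simp add: algebra_simps)
    also have "\<dots> \<le> L * ta (Suc n)" using step L by (intro mult_left_mono) auto
    finally show ?case .
  qed
  have upper: "\<epsilon> * ta n \<le> L ^ Suc n / real (Suc n) * (Q * ip ?C \<psi> \<psi>)" for n
  proof -
    have cA: "ip ?C (\<phi> i) ((?K ^^ n) \<alpha>) = (\<mu> i + a) ^ n * ip ?C (\<phi> i) \<alpha>" if "i < card ?C" for i
    proof -
      have "ip ?C ((?K ^^ n) (\<phi> i)) \<alpha> = ip ?C (\<lambda>s. (\<mu> i + a) ^ n * \<phi> i s) \<alpha>"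
        using phi that by (intro ip_cong shifted_ising_power_eigenvector) auto
      then show ?thesis by (simp only: ip_shifted_ising_power[OF finite_V] ip_scale_left)
    qed
    have cB: "\<epsilon> * ip ?C (\<phi> i) (mode {} (p 0) \<psi>) = (L - (\<mu> i + a)) * ip ?C (\<phi> i) \<beta>" if "i < card ?C" for i
    proof -
      have "ip ?C (\<phi> i) (ising V E J \<delta> \<beta>) = ip ?C (\<lambda>s. \<mu> i * \<phi> i s) \<beta>"
        unfolding ip_ising[OF finite_V] using phi that by (intro ip_cong) auto
      moreover have "ip ?C (\<phi> i) (ising V E J \<delta> \<beta>) = ip ?C (\<phi> i) (\<lambda>s. M * \<beta> s - \<epsilon> * mode {} (p 0) \<psi> s)"
        using beq by (intro ip_cong) auto
      ultimately show ?thesis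
        by (simp add: ip_diff_right ip_scale_right ip_scale_left L_def algebra_simps)
    qed
    have ineq: "(L - x) * x ^ n \<le> L ^ Suc n / real (Suc n)" if "0 \<le> x" "x \<le> L" for x
    proof -
      have "real (Suc n) * ((L - x) * x ^ n) = (\<Sum>i<Suc n. (L - x) * x ^ n)" by simp
      also have "\<dots> \<le> (\<Sum>i<Suc n. (L - x) * (L ^ (n - i) * x ^ i))"
      proof (intro sum_mono mult_left_mono)
        fix i assume "i \<in> {..<Suc n}"
        then have "x ^ n = x ^ (n - i) * x ^ i" by (simp flip: power_add)
        also have "\<dots> \<le> L ^ (n - i) * x ^ i" using that by (intro mult_right_mono power_mono) auto
        finally show "x ^ n \<le> L ^ (n - i) * x ^ i" .
      qed (use that in auto)
      also have "\<dots> = L ^ Suc n - x ^ Suc n"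
      proof -
        have "x ^ Suc n - L ^ Suc n = (x - L) * (\<Sum>i<Suc n. x ^ i * L ^ (n - i))"
          by (rule diff_power_eq_sum)
        also have "\<dots> = - (\<Sum>i<Suc n. (L - x) * (L ^ (n - i) * x ^ i))"
          unfolding sum_distrib_left sum_negf[symmetric] by (intro sum.cong refl) (simp add: algebra_simps)
        finally show ?thesis by linarith
      qed
      also have "\<dots> \<le> L ^ Suc n" using that by simp
      finally show ?thesis by (simp add: field_simps)
    qed
    have "\<epsilon> * ta n = (\<Sum>i<card ?C. \<epsilon> * ip ?C (\<phi> i) (mode {} (p 0) \<psi>) * ip ?C (\<phi> i) ((?K ^^ n) \<alpha>))"
      unfolding ta_def eigenbasis_Parseval[OF finite_configs[OF finite_V] eb, of "mode {} (p 0) \<psi>"]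
      by (simp add: sum_distrib_left mult_ac)
    also have "\<dots> = (\<Sum>i<card ?C. ((L - (\<mu> i + a)) * (\<mu> i + a) ^ n) * (ip ?C (\<phi> i) \<beta> * ip ?C (\<phi> i) \<alpha>))"
      by (intro sum.cong refl) (simp add: cA cB)
    also have "\<dots> \<le> (\<Sum>i<card ?C. L ^ Suc n / real (Suc n) * (((ip ?C (\<phi> i) \<beta>)\<^sup>2 + (ip ?C (\<phi> i) \<alpha>)\<^sup>2) / 2))"
    proof (intro sum_mono)
      fix i assume i: "i \<in> {..<card ?C}"
      let ?c = "(L - (\<mu> i + a)) * (\<mu> i + a) ^ n"
      have "0 \<le> (ip ?C (\<phi> i) \<beta> - ip ?C (\<phi> i) \<alpha>)\<^sup>2" by simp
      then have "ip ?C (\<phi> i) \<beta> * ip ?C (\<phi> i) \<alpha> \<le> ((ip ?C (\<phi> i) \<beta>)\<^sup>2 + (ip ?C (\<phi> i) \<alpha>)\<^sup>2) / 2"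
        by (simp add: power2_diff)
      moreover have "0 \<le> ?c" using x0 xL i by (intro mult_nonneg_nonneg zero_le_power) auto
      ultimately have "?c * (ip ?C (\<phi> i) \<beta> * ip ?C (\<phi> i) \<alpha>) \<le> ?c * (((ip ?C (\<phi> i) \<beta>)\<^sup>2 + (ip ?C (\<phi> i) \<alpha>)\<^sup>2) / 2)"
        by (rule mult_left_mono)
      also have "\<dots> \<le> L ^ Suc n / real (Suc n) * (((ip ?C (\<phi> i) \<beta>)\<^sup>2 + (ip ?C (\<phi> i) \<alpha>)\<^sup>2) / 2)"
        using ineq[of "\<mu> i + a"] x0 xL i by (intro mult_right_mono) auto
      finally show "?c * (ip ?C (\<phi> i) \<beta> * ip ?C (\<phi> i) \<alpha>)
        \<le> L ^ Suc n / real (Suc n) * (((ip ?C (\<phi> i) \<beta>)\<^sup>2 + (ip ?C (\<phi> i) \<alpha>)\<^sup>2) / 2)" .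
    qed
    also have "\<dots> = L ^ Suc n / real (Suc n) * ((ip ?C \<beta> \<beta> + ip ?C \<alpha> \<alpha>) / 2)"
      unfolding eigenbasis_Parseval[OF finite_configs[OF finite_V] eb, of \<beta>]
        eigenbasis_Parseval[OF finite_configs[OF finite_V] eb, of \<alpha>] sum_distrib_left[symmetric]
        sum_divide_distrib[symmetric] sum.distrib power2_eq_square ..
    also have "\<dots> = L ^ Suc n / real (Suc n) * (Q * ip ?C \<psi> \<psi>)" by (simp add: aa bb mult_ac)
    finally show ?thesis .
  qed
  have Q1: "Q \<ge> 1"
  proof -
    have "(\<Sum>i\<in>{0}. (q ^ i)\<^sup>2) \<le> Q" unfolding Q_def by (intro sum_mono2) auto
    then show ?thesis by simp
  qed
  have Q2: "Q * (1 - q\<^sup>2) \<le> 1"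
  proof -
    have "Q = (\<Sum>i<Suc N. (q\<^sup>2) ^ i)" unfolding Q_def lessThan_Suc_atMost by (simp add: power_mult[symmetric] mult.commute)
    then have "(1 - q\<^sup>2) * Q = 1 - (q\<^sup>2) ^ Suc N" using one_diff_power_eq[of "q\<^sup>2" "Suc N"] by simp
    then show ?thesis using q by (simp add: mult.commute)
  qed
  define T where "T = nat \<lfloor>2 * Q * L / \<epsilon>\<rfloor>"
  have T: "real T \<le> 2 * Q * L / \<epsilon>" "2 * Q * L / \<epsilon> < real (Suc T)"
    using Q1 L \<epsilon> by (auto simp: T_def) linarith+
  have T': "real T * \<epsilon> \<le> 2 * Q * L" "2 * Q * L < real (Suc T) * \<epsilon>"
    using T \<epsilon> by (simp_all add: field_simps)
  let ?n = "ip ?C \<psi> \<psi>"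
  have "\<epsilon> * (L ^ T * (L * ?n - real T * \<epsilon> * g0)) \<le> \<epsilon> * (L * ta T)"
    using lower \<epsilon> by (intro mult_left_mono) auto
  also have "\<dots> = L * (\<epsilon> * ta T)" by simp
  also have "\<dots> \<le> L * (L ^ Suc T / real (Suc T) * (Q * ?n))"
    using upper L by (intro mult_left_mono) auto
  also have "\<dots> = L ^ T * (L * (L * Q * ?n / real (Suc T)))" by simp
  also have "\<dots> \<le> L ^ T * (L * (\<epsilon> * ?n / 2))"
  proof (intro mult_left_mono)
    have "L * Q \<le> \<epsilon> / 2 * real (Suc T)" using T'(2) by (simp add: mult_ac)
    then have "L * Q * ?n \<le> \<epsilon> / 2 * real (Suc T) * ?n" using npos by (intro mult_right_mono) auto
    then show "L * Q * ?n / real (Suc T) \<le> \<epsilon> * ?n / 2" by (simp add: divide_le_eq mult_ac)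
  qed (use L in auto)
  finally have "\<epsilon> * (L * ?n - real T * \<epsilon> * g0) \<le> L * (\<epsilon> * ?n / 2)"
    using L by (simp only: mult.left_commute[of \<epsilon>] mult_le_cancel_left_pos[OF zero_less_power])
  then have "\<epsilon> * (L * ?n - real T * \<epsilon> * g0) \<le> \<epsilon> * (L * ?n / 2)" by (simp add: mult_ac)
  then have main: "L * ?n \<le> 2 * (real T * \<epsilon> * g0)" using \<epsilon> by simp
  have g0: "g0 > 0"
  proof (rule ccontr)
    assume "\<not> g0 > 0"
    then have "real T * \<epsilon> * g0 \<le> 0" using \<epsilon> by (intro mult_nonneg_nonpos) auto
    moreover have "L * ?n > 0" using L npos by simp
    ultimately show False using main by linarith
  qed
  have "L * ?n \<le> 2 * (2 * Q * L * g0)"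
    using main mult_right_mono[OF T'(1), of g0] g0 by linarith
  then have "?n \<le> 4 * Q * g0" using L by (simp add: mult_ac)
  then have "(1 - q\<^sup>2) * ?n \<le> (1 - q\<^sup>2) * (4 * Q * g0)"
    using q by (intro mult_left_mono) (auto simp: power_le_one)
  also have "\<dots> = 4 * g0 * (Q * (1 - q\<^sup>2))" by simp
  also have "\<dots> \<le> 4 * g0 * 1" using Q2 g0 by (intro mult_left_mono) auto
  finally show ?thesis by (simp add: g0_def q_def)
qed

end

section \<open>The ground state as the expectation in the positive eigenvector\<close>

lemma pauli3_entry: "pauli3 $ i $ j = (if i = j then complex_of_real (spin i) else 0)"
  using two_cases[of i] two_cases[of j] by (auto simp: pauli3_def spin_def vector_def)

lemma pauli1_entry: "pauli1 $ i $ j = (if j = i + 1 then 1 else 0)"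
  using two_cases[of i] two_cases[of j] by (auto simp: pauli1_def vector_def)

lemma configs_eqI: "s \<in> configs V \<Longrightarrow> t \<in> configs V \<Longrightarrow> (\<And>x. x \<in> V \<Longrightarrow> s x = t x) \<Longrightarrow> s = t"
  by (auto simp: configs_def intro: PiE_ext)

lemma diagonal_tensor_entry:
  assumes V: "finite V" and st: "s \<in> configs V" "t \<in> configs V" and e: "e \<subseteq> V"
  shows "tensor_op V (\<lambda>z. if z \<in> e then pauli3 else mat 1) s t = (if s = t then complex_of_real (chi e s) else 0)"
proof (cases "s = t")
  case True
  have "tensor_op V (\<lambda>z. if z \<in> e then pauli3 else mat 1) s t
      = (\<Prod>x\<in>V. if x \<in> e then complex_of_real (spin (s x)) else 1)"
    unfolding tensor_op_def by (intro prod.cong) (auto simp: True pauli3_entry mat_def)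
  also have "\<dots> = (\<Prod>x\<in>e. complex_of_real (spin (s x)))"
    using V e by (intro prod.mono_neutral_cong_right) auto
  finally show ?thesis using True by (simp add: chi_def)
next
  case False
  then obtain x where "x \<in> V" "s x \<noteq> t x" using configs_eqI[OF st] by blast
  then show ?thesis unfolding tensor_op_def
    using V False by (auto intro!: prod_zero bexI[of _ x] simp: pauli3_entry mat_def)
qed

lemma bond_op_entry:
  assumes "finite V" "s \<in> configs V" "t \<in> configs V" "e \<subseteq> V"
  shows "bond_op V e s t = (if s = t then complex_of_real (chi e s) else 0)"
  unfolding bond_op_def by (rule diagonal_tensor_entry[OF assms])

lemma sigma3_entry:
  assumes "finite V" "s \<in> configs V" "t \<in> configs V" "x \<in> V"
  shows "sigma3 V x s t = (if s = t then complex_of_real (spin (s x)) else 0)"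
  using diagonal_tensor_entry[of V s t "{x}"] assms by (simp add: sigma3_def)

lemma sigma1_entry:
  assumes V: "finite V" and st: "s \<in> configs V" "t \<in> configs V" and x: "x \<in> V"
  shows "sigma1 V x s t = (if t = flip {x} s then 1 else 0)"
proof (cases "t = flip {x} s")
  case True
  have "(if z = x then pauli1 else mat 1) $ s z $ t z = 1" for z
    using True by (auto simp: pauli1_entry mat_def flip_apply)
  then show ?thesis using True by (simp add: sigma1_def tensor_op_def)
next
  case False
  then obtain z where z: "z \<in> V" "t z \<noteq> flip {x} s z"
    using configs_eqI[OF st(2), of "flip {x} s"] st x by auto
  then have "(if z = x then pauli1 else mat 1) $ s z $ t z = 0"
    by (cases "z = x") (simp_all add: pauli1_entry mat_def flip_apply)
  then show ?thesis unfolding sigma1_def tensor_op_def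
    using V z(1) False by (auto intro!: prod_zero bexI[of _ z])
qed

lemma hamiltonian_entry:
  assumes G: "finite_graph G" and st: "s \<in> configs (verts G)" "t \<in> configs (verts G)"
  shows "hamiltonian lam \<delta> G s t = - complex_of_real (ising_kernel (verts G) (edges G) (lam / 2) (\<lambda>_. \<delta>) s t)"
proof -
  have V: "finite (verts G)" and e: "\<And>e. e \<in> edges G \<Longrightarrow> e \<subseteq> verts G"
    using G by (auto simp: finite_graph_def)
  have "(\<Sum>e\<in>edges G. bond_op (verts G) e s t)
      = (if s = t then complex_of_real (\<Sum>e\<in>edges G. chi e s) else 0)"
    using bond_op_entry[OF V st] e by simp
  moreover have "(\<Sum>x\<in>verts G. sigma1 (verts G) x s t) = (\<Sum>x\<in>verts G. if t = flip {x} s then 1 else 0)"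
    using sigma1_entry[OF V st] by (intro sum.cong) auto
  moreover have "complex_of_real (\<Sum>x\<in>verts G. if t = flip {x} s then \<delta> else 0)
      = complex_of_real \<delta> * (\<Sum>x\<in>verts G. if t = flip {x} s then 1 else 0)"
    by (auto simp: sum_distrib_left intro!: sum.cong)
  ultimately show ?thesis
    by (simp add: hamiltonian_def ising_kernel_def)
qed

lemma op_power_eigenbasis:
  fixes C :: "'c set"
  assumes C: "finite C" and eb: "eigenbasis C K \<phi> \<mu>"
    and A: "\<And>s t. s \<in> C \<Longrightarrow> t \<in> C \<Longrightarrow> A s t = complex_of_real (b * K s t)"
    and st: "s \<in> C" "t \<in> C"
  shows "op_power C A n s t = complex_of_real (\<Sum>i<card C. (b * \<mu> i) ^ n * (\<phi> i s * \<phi> i t))"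
  using st
proof (induction n arbitrary: s t)
  case 0
  then show ?case using eb by (simp add: eigenbasis_def)
next
  case (Suc n)
  have "op_power C A (Suc n) s t
      = (\<Sum>u\<in>C. complex_of_real (b * K s u) * complex_of_real (\<Sum>i<card C. (b * \<mu> i) ^ n * (\<phi> i u * \<phi> i t)))"
    unfolding op_power.simps op_mult_def
    by (intro sum.cong refl) (simp only: Suc.IH[OF _ Suc.prems(2)] A[OF Suc.prems(1)])
  also have "\<dots> = complex_of_real (\<Sum>u\<in>C. \<Sum>i<card C. b * K s u * ((b * \<mu> i) ^ n * (\<phi> i u * \<phi> i t)))"
    by (simp add: sum_distrib_left)
  also have "(\<Sum>u\<in>C. \<Sum>i<card C. b * K s u * ((b * \<mu> i) ^ n * (\<phi> i u * \<phi> i t)))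
      = (\<Sum>i<card C. (b * \<mu> i) ^ n * b * \<phi> i t * apply_kernel C K (\<phi> i) s)"
    unfolding apply_kernel_def by (subst sum.swap) (simp add: sum_distrib_left mult_ac)
  also have "\<dots> = (\<Sum>i<card C. (b * \<mu> i) ^ Suc n * (\<phi> i s * \<phi> i t))"
    using eb Suc.prems by (intro sum.cong refl) (simp add: eigenbasis_def)
  finally show ?case .
qed

lemma op_exp_eigenbasis:
  fixes C :: "'c set"
  assumes C: "finite C" and eb: "eigenbasis C K \<phi> \<mu>"
    and A: "\<And>s t. s \<in> C \<Longrightarrow> t \<in> C \<Longrightarrow> A s t = complex_of_real (b * K s t)"
    and st: "s \<in> C" "t \<in> C"
  shows "op_exp C A s t = complex_of_real (\<Sum>i<card C. exp (b * \<mu> i) * (\<phi> i s * \<phi> i t))"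
proof -
  have "(\<lambda>n. (b * \<mu> i) ^ n / fact n) sums exp (b * \<mu> i)" for i
    using exp_converges[of "b * \<mu> i"] by (simp add: scaleR_conv_of_real divide_inverse mult.commute)
  then have "(\<lambda>n. \<Sum>i<card C. (b * \<mu> i) ^ n / fact n * (\<phi> i s * \<phi> i t)) sums (\<Sum>i<card C. exp (b * \<mu> i) * (\<phi> i s * \<phi> i t))"
    by (intro sums_sum sums_mult2)
  then have "(\<lambda>n. complex_of_real (\<Sum>i<card C. (b * \<mu> i) ^ n / fact n * (\<phi> i s * \<phi> i t)))
      sums complex_of_real (\<Sum>i<card C. exp (b * \<mu> i) * (\<phi> i s * \<phi> i t))"
    by (rule sums_of_real)
  moreover have "op_power C A n s t = complex_of_real (\<Sum>i<card C. (b * \<mu> i) ^ n * (\<phi> i s * \<phi> i t))" for n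
    by (rule op_power_eigenbasis[OF C eb A st])
  then have "op_power C A n s t / fact n = complex_of_real (\<Sum>i<card C. (b * \<mu> i) ^ n / fact n * (\<phi> i s * \<phi> i t))" for n
    by (simp add: sum_divide_distrib)
  ultimately have "(\<lambda>n. op_power C A n s t / fact n) sums complex_of_real (\<Sum>i<card C. exp (b * \<mu> i) * (\<phi> i s * \<phi> i t))"
    by (simp only:)
  then show ?thesis unfolding op_exp_def by (rule sums_unique[symmetric])
qed

lemma ip_spins:
  assumes "finite V" "ground_vector V E J \<delta> \<psi> M"
  shows "ip (configs V) (mode {} x \<psi>) (mode {} y \<psi>) = spin_mean V \<psi> (symdiff {x} {y}) * ip (configs V) \<psi> \<psi>"
proof -
  have "ip (configs V) (mode {} x \<psi>) (mode {} y \<psi>) = (\<Sum>s\<in>configs V. chi (symdiff {x} {y}) s * (\<psi> s)\<^sup>2)"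
    unfolding ip_def mode_def chi_mult[of "{x}" "{y}", simplified, symmetric]
    by (intro sum.cong) (auto simp: power2_eq_square)
  then show ?thesis using norm_pos[OF assms] by (simp add: spin_mean_def ip_def power2_eq_square)
qed

lemma exp_tendsto_indicator:
  fixes m M :: real
  assumes "m \<le> M"
  shows "((\<lambda>b. exp (b * (m - M))) \<longlongrightarrow> of_bool (m = M)) at_top"
proof (cases "m = M")
  case False
  then have "m - M < 0" using assms by simp
  then have "LIM b at_top. (m - M) * b :> at_bot"
    by (rule filterlim_tendsto_neg_mult_at_bot[OF tendsto_const _ filterlim_ident])
  then show ?thesis
    using filterlim_compose[OF exp_at_bot, of "\<lambda>b. (m - M) * b" at_top] False by (simp add: mult.commute)
qed simp

text \<open>
In an eigenbasis both traces are sums of exponentials in \<open>\<beta>\<close>, and as \<open>\<beta> \<rightarrow> \<infinity>\<close> only the eigenvectors for \<open>M\<close> survive,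
all of which are multiples of \<open>\<psi>\<close>.
\<close>

theorem ground_state_spins:
  fixes G :: "'v graph"
  assumes G: "finite_graph G" and d: "\<delta> > 0"
    and g: "ground_vector (verts G) (edges G) (lam / 2) (\<lambda>_. \<delta>) \<psi> M"
    and xy: "x \<in> verts G" "y \<in> verts G"
  shows "ground_state lam \<delta> G (op_mult (configs (verts G)) (sigma3 (verts G) x) (sigma3 (verts G) y))
    = complex_of_real (spin_mean (verts G) \<psi> (symdiff {x} {y}))"
proof -
  define V where "V = verts G"
  let ?C = "configs V"
  define K where "K = ising_kernel V (edges G) (lam / 2) (\<lambda>_. \<delta>)"
  have SG: "simple_graph V (edges G)" using G by (simp add: finite_graph_def simple_graph_def V_def)
  have V: "finite V" using simple_graph_finite[OF SG] by simp
  have tf: "transverse_field V (\<lambda>_. \<delta>) x" using d by (simp add: transverse_field_def)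
  have g': "ground_vector V (edges G) (lam / 2) (\<lambda>_. \<delta>) \<psi> M" using g by (simp add: V_def)
  obtain \<phi> \<mu> where eb: "eigenbasis ?C K \<phi> \<mu>"
    using eigenbasis_ising_exists[OF V] unfolding K_def by blast
  have le: "\<mu> i \<le> M" if "i < card ?C" for i
    using ground_vector_top[OF SG tf g' _ that] eb unfolding K_def by blast
  define w where "w = (\<lambda>s. spin (s x) * spin (s y))"
  define I where "I = {i. i < card ?C \<and> \<mu> i = M}"
  have gibbs: "gibbs_operator lam \<delta> G b s t = complex_of_real (\<Sum>i<card ?C. exp (b * \<mu> i) * (\<phi> i s * \<phi> i t))"
    if "s \<in> ?C" "t \<in> ?C" for b s t
    unfolding gibbs_operator_def V_def[symmetric]
    by (rule op_exp_eigenbasis[OF finite_configs[OF V] eb _ that])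
      (simp add: hamiltonian_entry[OF G, folded V_def] K_def)
  have Q: "op_mult ?C (sigma3 V x) (sigma3 V y) s t = (if s = t then complex_of_real (w s) else 0)"
    if st: "s \<in> ?C" "t \<in> ?C" for s t
  proof -
    have "op_mult ?C (sigma3 V x) (sigma3 V y) s t
        = (\<Sum>u\<in>?C. if u = s then complex_of_real (spin (s x)) * sigma3 V y s t else 0)"
      unfolding op_mult_def using sigma3_entry[OF V st(1)] xy
      by (intro sum.cong) (auto simp: V_def)
    also have "\<dots> = complex_of_real (spin (s x)) * sigma3 V y s t"
      using V st by simp
    finally show ?thesis using sigma3_entry[OF V st, of y] xy by (simp add: V_def w_def)
  qed
  define num where "num = (\<lambda>b. \<Sum>s\<in>?C. \<Sum>i<card ?C. exp (b * (\<mu> i - M)) * (\<phi> i s)\<^sup>2 * w s)"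
  define den where "den = (\<lambda>b. \<Sum>s\<in>?C. \<Sum>i<card ?C. exp (b * (\<mu> i - M)) * (\<phi> i s)\<^sup>2)"
  have shift: "exp (b * \<mu> i) = exp (b * M) * exp (b * (\<mu> i - M))" for b i
    by (simp add: algebra_simps flip: exp_add)
  have tr_den: "partition_function lam \<delta> G b = complex_of_real (exp (b * M) * den b)" for b
    unfolding partition_function_def op_trace_def V_def[symmetric] den_def
    by (simp add: gibbs shift sum_distrib_left power2_eq_square mult_ac)
  have tr_num: "op_trace ?C (op_mult ?C (gibbs_operator lam \<delta> G b) (op_mult ?C (sigma3 V x) (sigma3 V y)))
      = complex_of_real (exp (b * M) * num b)" for b
  proof -
    have "op_mult ?C (gibbs_operator lam \<delta> G b) (op_mult ?C (sigma3 V x) (sigma3 V y)) s s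
        = complex_of_real (exp (b * M) * (\<Sum>i<card ?C. exp (b * (\<mu> i - M)) * (\<phi> i s)\<^sup>2 * w s))" if s: "s \<in> ?C" for s
    proof -
      have "op_mult ?C (gibbs_operator lam \<delta> G b) (op_mult ?C (sigma3 V x) (sigma3 V y)) s s
          = (\<Sum>u\<in>?C. if u = s then gibbs_operator lam \<delta> G b s s * complex_of_real (w s) else 0)"
        unfolding op_mult_def[of _ "gibbs_operator lam \<delta> G b"] using Q s by (intro sum.cong) auto
      also have "\<dots> = gibbs_operator lam \<delta> G b s s * complex_of_real (w s)" using V s by simp
      finally show ?thesis
        by (simp add: gibbs[OF s s] shift sum_distrib_left sum_distrib_right power2_eq_square mult_ac)
    qed
    then show ?thesis by (simp add: op_trace_def num_def sum_distrib_left)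
  qed
  have state: "gibbs_state lam \<delta> G b (op_mult ?C (sigma3 V x) (sigma3 V y)) = complex_of_real (num b / den b)" for b
    unfolding gibbs_state_def tr_den V_def[symmetric] tr_num by simp
  have lim_sum: "((\<lambda>b. \<Sum>s\<in>?C. \<Sum>i<card ?C. exp (b * (\<mu> i - M)) * f i s) \<longlongrightarrow> (\<Sum>s\<in>?C. \<Sum>i\<in>I. f i s)) at_top" for f
  proof -
    have "((\<lambda>b. \<Sum>s\<in>?C. \<Sum>i<card ?C. exp (b * (\<mu> i - M)) * f i s) \<longlongrightarrow>
        (\<Sum>s\<in>?C. \<Sum>i<card ?C. of_bool (\<mu> i = M) * f i s)) at_top"
      by (intro tendsto_sum tendsto_mult tendsto_const exp_tendsto_indicator le) auto
    also have "(\<Sum>s\<in>?C. \<Sum>i<card ?C. of_bool (\<mu> i = M) * f i s) = (\<Sum>s\<in>?C. \<Sum>i\<in>I. f i s)"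
      unfolding I_def by (intro sum.cong refl sum.mono_neutral_cong_right) auto
    finally show ?thesis .
  qed
  have "\<exists>c. \<forall>s\<in>?C. \<phi> i s = c * \<psi> s" if "i \<in> I" for i
    using eb that V d unfolding K_def I_def
    by (intro eigenvector_unique[OF V tf _ g']) (auto simp: eigenbasis_def apply_kernel_ising_kernel)
  then obtain c where c: "\<And>i s. i \<in> I \<Longrightarrow> s \<in> ?C \<Longrightarrow> \<phi> i s = c i * \<psi> s" by metis
  define q where "q = (\<Sum>i\<in>I. (c i)\<^sup>2)"
  have sum_top: "(\<Sum>s\<in>?C. \<Sum>i\<in>I. (\<phi> i s)\<^sup>2 * f s) = q * (\<Sum>s\<in>?C. f s * (\<psi> s)\<^sup>2)" for f
    unfolding q_def sum_product by (subst sum.swap) (auto simp: c power_mult_distrib mult_ac intro!: sum.cong)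
  have "q > 0"
  proof -
    obtain a where a: "a > 0" "\<forall>s\<in>?C. top_projection ?C \<phi> \<mu> M (\<lambda>s. 1) s = a * \<psi> s"
      using top_projection_one[OF SG tf g'] eb unfolding K_def by blast
    obtain s where s: "s \<in> ?C" using configs_nonempty[of V] by blast
    have "\<psi> s > 0" using g' s by (simp add: ground_vector_def)
    then have "top_projection ?C \<phi> \<mu> M (\<lambda>s. 1) s \<noteq> 0" using a s by simp
    then have "I \<noteq> {}" unfolding top_projection_def I_def[symmetric] by force
    moreover have "c i \<noteq> 0" if "i \<in> I" for i
    proof
      assume "c i = 0"
      then have "ip ?C (\<phi> i) (\<phi> i) = 0" using c[OF that] by (simp add: ip_def)
      then show False using eb that by (auto simp: eigenbasis_def orthonormal_def I_def)
    qed
    ultimately show ?thesis unfolding q_def by (intro sum_pos) (auto simp: I_def)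
  qed
  have lim_num: "(num \<longlongrightarrow> q * (\<Sum>s\<in>?C. w s * (\<psi> s)\<^sup>2)) at_top"
    using lim_sum[of "\<lambda>i s. (\<phi> i s)\<^sup>2 * w s"] unfolding sum_top num_def by (simp add: mult.assoc)
  have lim_den: "(den \<longlongrightarrow> q * (\<Sum>s\<in>?C. (\<psi> s)\<^sup>2)) at_top"
    using lim_sum[of "\<lambda>i s. (\<phi> i s)\<^sup>2"] sum_top[of "\<lambda>_. 1"] unfolding den_def by simp
  have np: "(\<Sum>s\<in>?C. (\<psi> s)\<^sup>2) > 0" by (rule norm_pos[OF V g'])
  have "((\<lambda>b. num b / den b) \<longlongrightarrow> q * (\<Sum>s\<in>?C. w s * (\<psi> s)\<^sup>2) / (q * (\<Sum>s\<in>?C. (\<psi> s)\<^sup>2))) at_top"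
    using \<open>q > 0\<close> np by (intro tendsto_divide lim_num lim_den) auto
  also have "q * (\<Sum>s\<in>?C. w s * (\<psi> s)\<^sup>2) / (q * (\<Sum>s\<in>?C. (\<psi> s)\<^sup>2)) = spin_mean V \<psi> (symdiff {x} {y})"
    using \<open>q > 0\<close> chi_mult[of "{x}" "{y}"] by (simp add: spin_mean_def w_def)
  finally have "((\<lambda>b. gibbs_state lam \<delta> G b (op_mult ?C (sigma3 V x) (sigma3 V y)))
      \<longlongrightarrow> complex_of_real (spin_mean V \<psi> (symdiff {x} {y}))) at_top"
    unfolding state by (rule tendsto_of_real)
  then show ?thesis unfolding ground_state_def V_def by (intro tendsto_Lim) auto
qed

section \<open>The star graph\<close>

text \<open>
The choice of the ground vector is immaterial, as it is unique up to a positive factor.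
\<close>

definition ground_correlation :: "real \<Rightarrow> real \<Rightarrow> 'v graph \<Rightarrow> 'v \<Rightarrow> 'v \<Rightarrow> real" where
  "ground_correlation lam \<delta> G x y = spin_mean (verts G)
     (SOME \<psi>. \<exists>M. ground_vector (verts G) (edges G) (lam / 2) (\<lambda>_. \<delta>) \<psi> M) (symdiff {x} {y})"

lemma ground_correlation_ground_vector:
  assumes G: "finite_graph G" and d: "\<delta> > 0"
  shows "\<exists>\<psi> M. ground_vector (verts G) (edges G) (lam / 2) (\<lambda>_. \<delta>) \<psi> M \<and>
     (\<forall>x y. ground_correlation lam \<delta> G x y = spin_mean (verts G) \<psi> (symdiff {x} {y}))"
proof -
  let ?P = "\<lambda>\<psi>. \<exists>M. ground_vector (verts G) (edges G) (lam / 2) (\<lambda>_. \<delta>) \<psi> M"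
  have SG: "simple_graph (verts G) (edges G)" using G by (simp add: finite_graph_def simple_graph_def)
  have V: "finite (verts G)" using simple_graph_finite[OF SG] by simp
  have "transverse_field (verts G) (\<lambda>_. \<delta>) undefined" using d by (simp add: transverse_field_def)
  then have "\<exists>\<psi>. ?P \<psi>"
    using ground_vector_exists[OF SG] eigenbasis_ising_exists[OF V] by metis
  then have "?P (SOME \<psi>. ?P \<psi>)" by (rule someI_ex)
  then show ?thesis unfolding ground_correlation_def by blast
qed

lemma abs_spin_mean_le: "\<bar>spin_mean V \<psi> B\<bar> \<le> 1"
proof -
  have "\<bar>\<Sum>s\<in>configs V. chi B s * (\<psi> s)\<^sup>2\<bar> \<le> (\<Sum>s\<in>configs V. (\<psi> s)\<^sup>2)"
    by (rule order_trans[OF sum_abs]) (simp add: abs_mult)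
  moreover have "(\<Sum>s\<in>configs V. (\<psi> s)\<^sup>2) \<ge> 0" by (intro sum_nonneg) auto
  ultimately show ?thesis unfolding spin_mean_def by (auto simp: divide_le_eq_1 abs_divide less_le)
qed

lemma abs_ground_correlation_le: "\<bar>ground_correlation lam \<delta> G x y\<bar> \<le> 1"
  unfolding ground_correlation_def by (rule abs_spin_mean_le)

lemma ground_correlation_mono:
  assumes G: "finite_graph G" "finite_graph G'" and sub: "verts G \<subseteq> verts G'" "edges G \<subseteq> edges G'"
    and p: "lam > 0" "\<delta> > 0" and xy: "x \<in> verts G" "y \<in> verts G"
  shows "ground_correlation lam \<delta> G x y \<le> ground_correlation lam \<delta> G' x y"
proof -
  obtain \<psi> M where g: "ground_vector (verts G) (edges G) (lam / 2) (\<lambda>_. \<delta>) \<psi> M"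
      "ground_correlation lam \<delta> G x y = spin_mean (verts G) \<psi> (symdiff {x} {y})"
    using ground_correlation_ground_vector[OF G(1) p(2)] by blast
  obtain \<psi>' M' where g': "ground_vector (verts G') (edges G') (lam / 2) (\<lambda>_. \<delta>) \<psi>' M'"
      "ground_correlation lam \<delta> G' x y = spin_mean (verts G') \<psi>' (symdiff {x} {y})"
    using ground_correlation_ground_vector[OF G(2) p(2)] by blast
  show ?thesis unfolding g(2) g'(2)
    by (rule spin_mean_mono[OF _ _ sub _ _ _ _ g(1) g'(1)])
      (use G p xy in \<open>auto simp: finite_graph_def simple_graph_def transverse_field_def\<close>)
qed

lemma exhaustion_mono:
  assumes "exhaustion S G" "m \<le> n"
  shows "verts (G m) \<subseteq> verts (G n)" "edges (G m) \<subseteq> edges (G n)"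
proof -
  have step: "verts (G n) \<subseteq> verts (G (Suc n))" "edges (G n) \<subseteq> edges (G (Suc n))" for n
    using assms(1) unfolding exhaustion_def by blast+
  show "verts (G m) \<subseteq> verts (G n)" "edges (G m) \<subseteq> edges (G n)"
    by (rule lift_Suc_mono_le[OF _ assms(2)], rule step)+
qed

lemma exhaustion_eventually:
  assumes ex: "exhaustion S G" and A: "finite A" "A \<subseteq> verts S" and F: "finite F" "F \<subseteq> edges S"
  shows "\<exists>n0. \<forall>n\<ge>n0. A \<subseteq> verts (G n) \<and> F \<subseteq> edges (G n)"
proof -
  have union: "(\<Union>n. verts (G n)) = verts S" "(\<Union>n. edges (G n)) = edges S"
    using ex by (simp_all only: exhaustion_def)
  have "\<exists>n. A \<subseteq> verts (G n)" using A
  proof (induction A rule: finite_induct)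
    case (insert a A)
    then obtain n where "A \<subseteq> verts (G n)" by auto
    moreover have "a \<in> (\<Union>n. verts (G n))" unfolding union(1) using insert.prems by simp
    then obtain m where "a \<in> verts (G m)" by blast
    ultimately have "insert a A \<subseteq> verts (G (max m n))"
      using exhaustion_mono(1)[OF ex max.cobounded2, of n m] exhaustion_mono(1)[OF ex max.cobounded1, of m n] by blast
    then show ?case by blast
  qed simp
  moreover have "\<exists>n. F \<subseteq> edges (G n)" using F
  proof (induction F rule: finite_induct)
    case (insert a F)
    then obtain n where "F \<subseteq> edges (G n)" by auto
    moreover have "a \<in> (\<Union>n. edges (G n))" unfolding union(2) using insert.prems by simp
    then obtain m where "a \<in> edges (G m)" by blast
    ultimately have "insert a F \<subseteq> edges (G (max m n))"
      using exhaustion_mono(2)[OF ex max.cobounded2, of n m] exhaustion_mono(2)[OF ex max.cobounded1, of m n] by blast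
    then show ?case by blast
  qed simp
  ultimately obtain n m where nm: "A \<subseteq> verts (G n)" "F \<subseteq> edges (G m)" by blast
  have "A \<subseteq> verts (G l) \<and> F \<subseteq> edges (G l)" if "l \<ge> max m n" for l
  proof -
    have "n \<le> l" "m \<le> l" using that by auto
    then show ?thesis using nm exhaustion_mono[OF ex] by (meson order_trans)
  qed
  then show ?thesis by blast
qed

text \<open>
The finite-volume correlations are eventually increasing and bounded by \<open>1\<close>.
\<close>

lemma correlation_limit:
  assumes ex: "exhaustion S G" and p: "lam > 0" "\<delta> > 0" and xy: "x \<in> verts S" "y \<in> verts S"
  shows "(\<lambda>n. ground_correlation lam \<delta> (G n) x y) \<longlonglongrightarrow> correlation lam \<delta> G x y"
proof -
  obtain n0 where n0: "\<And>n. n \<ge> n0 \<Longrightarrow> {x, y} \<subseteq> verts (G n)"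
    using exhaustion_eventually[OF ex, of "{x, y}" "{}"] xy by auto
  have fg: "finite_graph (G n)" for n using ex by (simp add: exhaustion_def)
  have eq: "ground_state lam \<delta> (G n) (op_mult (configs (verts (G n))) (sigma3 (verts (G n)) x) (sigma3 (verts (G n)) y))
      = complex_of_real (ground_correlation lam \<delta> (G n) x y)" if "n \<ge> n0" for n
  proof -
    obtain \<psi> M where g: "ground_vector (verts (G n)) (edges (G n)) (lam / 2) (\<lambda>_. \<delta>) \<psi> M"
        "ground_correlation lam \<delta> (G n) x y = spin_mean (verts (G n)) \<psi> (symdiff {x} {y})"
      using ground_correlation_ground_vector[OF fg p(2)] by blast
    then show ?thesis using ground_state_spins[OF fg p(2) g(1)] n0[OF that] by auto
  qed
  have "incseq (\<lambda>n. ground_correlation lam \<delta> (G (n + n0)) x y)"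
    using n0 exhaustion_mono[OF ex] p by (intro incseq_SucI ground_correlation_mono fg) auto
  moreover have "ground_correlation lam \<delta> (G (n + n0)) x y \<le> 1" for n
    using abs_ground_correlation_le by (rule abs_le_D1)
  ultimately obtain l where "(\<lambda>n. ground_correlation lam \<delta> (G (n + n0)) x y) \<longlonglongrightarrow> l"
    using incseq_convergent[of "\<lambda>n. ground_correlation lam \<delta> (G (n + n0)) x y" 1] by blast
  then have l: "(\<lambda>n. ground_correlation lam \<delta> (G n) x y) \<longlonglongrightarrow> l" by (rule LIMSEQ_offset)
  then have "(\<lambda>n. complex_of_real (ground_correlation lam \<delta> (G n) x y)) \<longlonglongrightarrow> complex_of_real l" by (rule tendsto_of_real)
  then have "(\<lambda>n. ground_state lam \<delta> (G n) (op_mult (configs (verts (G n))) (sigma3 (verts (G n)) x) (sigma3 (verts (G n)) y)))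
      \<longlonglongrightarrow> complex_of_real l"
    by (rule Lim_transform_eventually) (use eq in \<open>auto simp: eventually_sequentially intro!: exI[of _ n0]\<close>)
  then have "correlation lam \<delta> G x y = l"
    unfolding correlation_def ground_state_limit_def by (simp add: limI)
  then show ?thesis using l by simp
qed

definition arm_path :: "nat \<Rightarrow> nat \<Rightarrow> star_vertex" where
  "arm_path j i = (case i of 0 \<Rightarrow> Centre | Suc m \<Rightarrow> Arm j m)"

lemma arm_path_simps [simp]: "arm_path j 0 = Centre" "arm_path j (Suc m) = Arm j m"
  by (simp_all add: arm_path_def)

lemma arm_path_eq_iff [simp]: "arm_path j i = arm_path j i' \<longleftrightarrow> i = i'"
  by (cases i; cases i') auto

lemma star_vertex_on_arm:
  assumes "v \<in> verts (star_graph k)" "k > 0"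
  shows "\<exists>j i. j < k \<and> v = arm_path j i"
proof (cases v)
  case Centre
  then show ?thesis using assms by (intro exI[of _ 0] exI[of _ 0]) auto
next
  case (Arm j m)
  then show ?thesis using assms by (intro exI[of _ j] exI[of _ "Suc m"]) (auto simp: star_graph_def)
qed

lemma arm_path_in_star: "j < k \<Longrightarrow> arm_path j i \<in> verts (star_graph k)"
  by (cases i) (auto simp: star_graph_def)

lemma arm_path_edge: "j < k \<Longrightarrow> {arm_path j i, arm_path j (Suc i)} \<in> edges (star_graph k)"
  by (cases i) (auto simp: star_graph_def)

text \<open>
A finite path from the centre lies in almost all graphs of the exhaustion, and adding the rest of the
graph only increases its end-to-end correlation.
\<close>

lemma eventually_ground_correlation_ge:
  assumes ex: "exhaustion (star_graph k) G" and p: "\<delta> > 0" "lam / 2 > \<delta>" and j: "j < k"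
  shows "\<exists>n0. \<forall>n\<ge>n0. arm_path j N \<in> verts (G n) \<and> Centre \<in> verts (G n) \<and>
     (1 - (\<delta> / (lam / 2))\<^sup>2) / 4 \<le> ground_correlation lam \<delta> (G n) Centre (arm_path j N)"
proof -
  let ?p = "arm_path j"
  define V where "V = ?p ` {..N}"
  define E where "E = {{?p i, ?p (Suc i)} |i. i < N}"
  interpret spin_chain V E "{}" "{}" ?p N
    by unfold_locales (auto simp: V_def E_def inj_on_def)
  have tf: "transverse_field V (\<lambda>_. \<delta>) Centre" using p by (simp add: transverse_field_def)
  obtain \<psi> M where g: "ground_vector V E (lam / 2) (\<lambda>_. \<delta>) \<psi> M"
    using ground_vector_exists[OF simple_graph_chain tf] eigenbasis_ising_exists[OF finite_V] by metis
  have "ip (configs V) \<psi> \<psi> > 0" using norm_pos[OF finite_V g] by (simp add: ip_def power2_eq_square)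
  then have chain: "(1 - (\<delta> / (lam / 2))\<^sup>2) / 4 \<le> spin_mean V \<psi> (symdiff {Centre} {?p N})"
    using end_to_end_correlation_ge[OF p(1) p(2) refl refl g] unfolding ip_spins[OF finite_V g] by simp
  have "E = (\<lambda>i. {?p i, ?p (Suc i)}) ` {..<N}" by (auto simp: E_def)
  then have "finite E" by simp
  moreover have "V \<subseteq> verts (star_graph k)" "E \<subseteq> edges (star_graph k)"
    using arm_path_in_star[OF j] arm_path_edge[OF j] by (auto simp: V_def E_def)
  ultimately obtain n0 where n0: "\<And>n. n \<ge> n0 \<Longrightarrow> V \<subseteq> verts (G n) \<and> E \<subseteq> edges (G n)"
    using exhaustion_eventually[OF ex finite_V] by metis
  have "arm_path j N \<in> verts (G n) \<and> Centre \<in> verts (G n) \<and>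
     (1 - (\<delta> / (lam / 2))\<^sup>2) / 4 \<le> ground_correlation lam \<delta> (G n) Centre (arm_path j N)" if n: "n \<ge> n0" for n
  proof -
    have fg: "finite_graph (G n)" using ex by (simp add: exhaustion_def)
    obtain \<psi>' M' where g': "ground_vector (verts (G n)) (edges (G n)) (lam / 2) (\<lambda>_. \<delta>) \<psi>' M'"
        "ground_correlation lam \<delta> (G n) Centre (?p N) = spin_mean (verts (G n)) \<psi>' (symdiff {Centre} {?p N})"
      using ground_correlation_ground_vector[OF fg p(1)] by blast
    have in_V: "Centre \<in> V" "?p N \<in> V" using p_in_V[of 0] p_in_V[of N] by auto
    have "spin_mean V \<psi> (symdiff {Centre} {?p N}) \<le> spin_mean (verts (G n)) \<psi>' (symdiff {Centre} {?p N})"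
      by (rule spin_mean_mono[OF simple_graph_chain _ _ _ _ _ _ _ g g'(1)])
        (use fg n0[OF n] p in_V in \<open>auto simp: finite_graph_def simple_graph_def transverse_field_def\<close>)
    then show ?thesis using chain g'(2) in_V n0[OF n] by auto
  qed
  then show ?thesis by blast
qed

theorem long_range_order_star:
  assumes k: "k > 0" and ex: "exhaustion (star_graph k) G" and p: "\<delta> > 0" "lam / 2 > \<delta>"
  shows "long_range_order lam \<delta> (star_graph k) G"
proof -
  define c where "c = (1 - (\<delta> / (lam / 2))\<^sup>2) / 4"
  have lam: "lam > 0" using p by linarith
  then have "0 < \<delta> / (lam / 2)" "\<delta> / (lam / 2) < 1" using p by (auto simp: field_simps)
  then have "(\<delta> / (lam / 2))\<^sup>2 < 1" using power_strict_mono[of "\<delta> / (lam / 2)" 1 2] by simp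
  then have c: "c > 0" by (simp add: c_def)
  have "c * c \<le> correlation lam \<delta> G x y" if xy: "x \<in> verts (star_graph k)" "y \<in> verts (star_graph k)" for x y
  proof -
    obtain j i where x: "j < k" "x = arm_path j i" using star_vertex_on_arm[OF xy(1) k] by blast
    obtain j' i' where y: "j' < k" "y = arm_path j' i'" using star_vertex_on_arm[OF xy(2) k] by blast
    obtain n1 where n1: "\<And>n. n \<ge> n1 \<Longrightarrow> x \<in> verts (G n) \<and> Centre \<in> verts (G n) \<and> c \<le> ground_correlation lam \<delta> (G n) Centre x"
      using eventually_ground_correlation_ge[OF ex p x(1), of i] unfolding c_def x(2) by blast
    obtain n2 where n2: "\<And>n. n \<ge> n2 \<Longrightarrow> y \<in> verts (G n) \<and> Centre \<in> verts (G n) \<and> c \<le> ground_correlation lam \<delta> (G n) Centre y"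
      using eventually_ground_correlation_ge[OF ex p y(1), of i'] unfolding c_def y(2) by blast
    have "c * c \<le> ground_correlation lam \<delta> (G n) x y" if n: "n \<ge> max n1 n2" for n
    proof -
      have fg: "finite_graph (G n)" using ex by (simp add: exhaustion_def)
      obtain \<psi> M where g: "ground_vector (verts (G n)) (edges (G n)) (lam / 2) (\<lambda>_. \<delta>) \<psi> M"
        "\<And>x y. ground_correlation lam \<delta> (G n) x y = spin_mean (verts (G n)) \<psi> (symdiff {x} {y})"
        using ground_correlation_ground_vector[OF fg p(1)] by blast
      have SG: "simple_graph (verts (G n)) (edges (G n))" using fg by (simp add: finite_graph_def simple_graph_def)
      have tf: "transverse_field (verts (G n)) (\<lambda>_. \<delta>) Centre" using p by (simp add: transverse_field_def)
      have "c * c \<le> ground_correlation lam \<delta> (G n) Centre x * ground_correlation lam \<delta> (G n) Centre y"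
        using n1[of n] n2[of n] n c by (intro mult_mono) auto
      also have "\<dots> \<le> spin_mean (verts (G n)) \<psi> (symdiff (symdiff {Centre} {x}) (symdiff {Centre} {y}))"
        unfolding g(2) using n1[of n] n2[of n] n p
        by (intro spin_mean_product_le[OF SG _ tf g(1)]) auto
      also have "symdiff (symdiff {Centre} {x}) (symdiff {Centre} {y}) = symdiff {x} {y}"
        by (auto simp: symdiff_def)
      finally show ?thesis by (simp add: g(2))
    qed
    then show ?thesis
      by (intro LIMSEQ_le_const[OF correlation_limit[OF ex lam p(1) xy]]) (auto intro!: exI[of _ "max n1 n2"])
  qed
  moreover have "c * c > 0" using c by simp
  ultimately show ?thesis unfolding long_range_order_def by blast
qed

text \<open>
The graph is enlarged to a ball of the star around the centre, viewed as a chain along one arm with the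
other arms attached at the centre, and the field at the centre is lowered to \<open>0\<close>. Both steps increase
the correlation.
\<close>

lemma ground_correlation_centre_arm_le:
  assumes k: "k > 0" and ex: "exhaustion (star_graph k) G" and p: "lam > 0" "lam / 2 < \<delta>"
    and xy: "Centre \<in> verts (G n)" "arm_path 0 m \<in> verts (G n)"
  shows "ground_correlation lam \<delta> (G n) Centre (arm_path 0 m) \<le> (lam / 2 / \<delta>) ^ m / (1 - lam / 2 / \<delta>)"
proof -
  let ?p = "arm_path 0"
  have d: "\<delta> > 0" using p by simp
  have fg: "finite_graph (G n)" using ex by (simp add: exhaustion_def)
  have sub: "verts (G n) \<subseteq> verts (star_graph k)" "edges (G n) \<subseteq> edges (star_graph k)"
    using ex by (auto simp: exhaustion_def)
  have finV: "finite (verts (G n))" using fg by (simp add: finite_graph_def)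
  define height where "height = (\<lambda>v. case v of Centre \<Rightarrow> 0 | Arm j i \<Rightarrow> Suc i)"
  \<comment> \<open>an upper bound for the heights of \<open>arm_path 0 m\<close> and of all vertices of \<open>G n\<close>\<close>
  define N where "N = Suc (m + (\<Sum>v\<in>verts (G n). height v))"
  have N: "i < N" if "Arm j i \<in> verts (G n)" for j i
  proof -
    have "height (Arm j i) \<le> (\<Sum>v\<in>verts (G n). height v)" using finV that by (intro member_le_sum) auto
    then show ?thesis by (simp add: N_def height_def)
  qed
  define R where "R = {Arm j i |j i. 0 < j \<and> j < k \<and> i < N}"
  define E0 where "E0 = {{Centre, Arm j 0} |j. 0 < j \<and> j < k} \<union> {{Arm j i, Arm j (Suc i)} |j i. 0 < j \<and> j < k \<and> Suc i < N}"
  define V where "V = R \<union> ?p ` {..N}"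
  define E where "E = E0 \<union> {{?p i, ?p (Suc i)} |i. i < N}"
  have "R = (\<lambda>(j, i). Arm j i) ` ({0<..<k} \<times> {..<N})" by (auto simp: R_def)
  then have "finite R" by simp
  moreover have "?p i \<notin> R" for i by (cases i) (auto simp: R_def)
  moreover have "e \<subseteq> insert (?p 0) R \<and> card e = 2" if "e \<in> E0" for e
    using that by (auto simp: E0_def R_def N_def)
  ultimately interpret spin_chain V E E0 R ?p N
    by unfold_locales (auto simp: V_def E_def inj_on_def)
  have VG: "verts (G n) \<subseteq> V"
  proof
    fix v assume v: "v \<in> verts (G n)"
    show "v \<in> V"
    proof (cases v)
      case Centre
      then show ?thesis using p_in_V[of 0] by simp
    next
      case (Arm j i)
      then have "j < k" "i < N" using v sub N by (auto simp: star_graph_def)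
      then show ?thesis using Arm p_in_V[of "Suc i"] by (cases "j = 0") (auto simp: V_def R_def)
    qed
  qed
  have EG: "edges (G n) \<subseteq> E"
  proof
    fix e assume e: "e \<in> edges (G n)"
    have eV: "e \<subseteq> verts (G n)" using fg e by (auto simp: finite_graph_def)
    have bond: "{?p i, ?p (Suc i)} \<in> E" if "i < N" for i using that by (auto simp: E_def)
    from e sub consider j where "j < k" "e = {Centre, Arm j 0}"
      | j i where "j < k" "e = {Arm j i, Arm j (Suc i)}" by (auto simp: star_graph_def)
    then show "e \<in> E"
    proof cases
      case 1
      then show ?thesis using bond[of 0] by (cases "j = 0") (auto simp: N_def E_def E0_def)
    next
      case (2 j i)
      then have "Suc i < N" using eV N by auto
      then show ?thesis using 2 bond[of "Suc i"] by (cases "j = 0") (auto simp: E_def E0_def)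
    qed
  qed
  let ?d = "\<lambda>v. if v = Centre then 0 else \<delta>"
  have tf: "transverse_field V ?d (?p 0)" using d by (simp add: transverse_field_def)
  obtain \<psi>' M' where g': "ground_vector V E (lam / 2) ?d \<psi>' M'"
    using ground_vector_exists[OF simple_graph_chain tf] eigenbasis_ising_exists[OF finite_V] by metis
  obtain \<psi> M where g: "ground_vector (verts (G n)) (edges (G n)) (lam / 2) (\<lambda>_. \<delta>) \<psi> M"
      "ground_correlation lam \<delta> (G n) Centre (?p m) = spin_mean (verts (G n)) \<psi> (symdiff {Centre} {?p m})"
    using ground_correlation_ground_vector[OF fg d] by blast
  have "ground_correlation lam \<delta> (G n) Centre (?p m) \<le> spin_mean V \<psi>' (symdiff {Centre} {?p m})"
    unfolding g(2)
    by (rule spin_mean_mono[OF _ simple_graph_chain VG EG _ _ _ tf g(1) g'])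
      (use fg d p xy in \<open>auto simp: finite_graph_def simple_graph_def\<close>)
  also have "\<dots> \<le> (lam / 2 / \<delta>) ^ m / (1 - lam / 2 / \<delta>)"
  proof -
    have d_arm: "?d (?p i) = \<delta>" if "0 < i" for i using that by (cases i) auto
    have "ip (configs V) (mode {} (?p m) \<psi>') (mode {} (?p 0) \<psi>')
        \<le> (lam / 2 / \<delta>) ^ m / (1 - lam / 2 / \<delta>) * ip (configs V) \<psi>' \<psi>'"
      by (rule frozen_end_correlation_le[OF _ p(2) _ _ tf g'])
        (use p d_arm in \<open>auto simp: N_def\<close>)
    then have "spin_mean V \<psi>' (symdiff {?p m} {?p 0}) * ip (configs V) \<psi>' \<psi>'
        \<le> (lam / 2 / \<delta>) ^ m / (1 - lam / 2 / \<delta>) * ip (configs V) \<psi>' \<psi>'"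
      unfolding ip_spins[OF finite_V g'] .
    moreover have "ip (configs V) \<psi>' \<psi>' > 0" using norm_pos[OF finite_V g'] by (simp add: ip_def power2_eq_square)
    ultimately have "spin_mean V \<psi>' (symdiff {?p m} {?p 0}) \<le> (lam / 2 / \<delta>) ^ m / (1 - lam / 2 / \<delta>)"
      by (rule mult_right_le_imp_le)
    then show ?thesis by (simp only: symdiff_commute[of "{Centre}"] arm_path_simps)
  qed
  finally show ?thesis .
qed

theorem no_long_range_order_star:
  assumes k: "k > 0" and ex: "exhaustion (star_graph k) G" and p: "lam > 0" "lam / 2 < \<delta>"
  shows "\<not> long_range_order lam \<delta> (star_graph k) G"
proof
  assume lro: "long_range_order lam \<delta> (star_graph k) G"
  have d: "\<delta> > 0" using p by simp
  have V: "Centre \<in> verts (star_graph k)" "arm_path 0 m \<in> verts (star_graph k)" for m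
    using arm_path_in_star[OF k, of 0] arm_path_in_star[OF k, of m] by auto
  obtain c where c: "c > 0" "\<And>y. y \<in> verts (star_graph k) \<Longrightarrow> correlation lam \<delta> G Centre y \<ge> c"
    using lro V unfolding long_range_order_def by blast
  define r where "r = lam / 2 / \<delta>"
  have r: "0 \<le> r" "r < 1" using p d by (auto simp: r_def)
  have "correlation lam \<delta> G Centre (arm_path 0 m) \<le> r ^ m / (1 - r)" for m
  proof -
    obtain n0 where n0: "\<And>n. n \<ge> n0 \<Longrightarrow> {Centre, arm_path 0 m} \<subseteq> verts (G n)"
      using exhaustion_eventually[OF ex, of "{Centre, arm_path 0 m}" "{}"] V by auto
    have "ground_correlation lam \<delta> (G n) Centre (arm_path 0 m) \<le> r ^ m / (1 - r)" if "n \<ge> n0" for n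
      using ground_correlation_centre_arm_le[OF k ex p] n0[OF that] unfolding r_def by auto
    then show ?thesis
      by (intro LIMSEQ_le_const2[OF correlation_limit[OF ex p(1) d V]]) auto
  qed
  then have "c \<le> r ^ m / (1 - r)" for m using c(2)[OF V(2)] order_trans by blast
  moreover have "(\<lambda>m. r ^ m / (1 - r)) \<longlonglongrightarrow> 0 / (1 - r)"
    using r by (intro tendsto_divide LIMSEQ_realpow_zero tendsto_const) auto
  ultimately have "c \<le> 0 / (1 - r)" by (intro LIMSEQ_le_const) auto
  then show False using c(1) by simp
qed

theorem theorem1:
  fixes k :: nat and G :: "nat \<Rightarrow> star_vertex graph"
  assumes "k \<ge> 3" and "exhaustion (star_graph k) G"
  shows "is_critical_ratio (star_graph k) G 2"
  unfolding is_critical_ratio_def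
proof (intro allI impI conjI)
  fix lam \<delta> :: real
  assume p: "lam > 0 \<and> \<delta> > 0"
  have k: "k > 0" using assms(1) by simp
  show "long_range_order lam \<delta> (star_graph k) G" if "lam / \<delta> > 2"
    using that p by (intro long_range_order_star[OF k assms(2)]) (auto simp: field_simps)
  show "\<not> long_range_order lam \<delta> (star_graph k) G" if "lam / \<delta> < 2"
    using that p by (intro no_long_range_order_star[OF k assms(2)]) (auto simp: field_simps)
qed

end
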